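(* Let $d\ge 1$ be an integer, $\sigma\in(0,1)$, and $\mathcal L=-\Delta+(-\Delta)^\sigma$ on $\mathbb R^d$. Let $h\in C([0,\infty))$ with $h\ge 0$. Let $f\in C([0,\infty))$ be a nonnegative convex function with $f(0)=0$ and $f(u)>0$ for all $u>0$, and let $f_m$ and $f_M$ be its minorant and majorant functions. Assume that $$\int_1^\infty \frac{du}{f_m(u)}<\infty\qquad\text{and}\qquad \lim_{u\to 0^+}\frac{f_M(u)}{u}=0 .$$ Then the following statements are equivalent: (i) for every $u_0\in C_0(\mathbb R^d)\cap L^1(\mathbb R^d)$ with $u_0>0$, $$\int_0^\infty h(t)\,\frac{f\big(\|e^{-t\mathcal L}u_0\|_{L^\infty(\mathbb R^d)}\big)}{\|e^{-t\mathcal L}u_0\|_{L^\infty(\mathbb R^d)}}\,dt=\infty;$$ (ii) for every real number $\epsilon>0$, $$\int_1^\infty h(t)\,t^{\frac{d}{2\sigma}}\,f\big(\epsilon\, t^{-\frac{d}{2\sigma}}\big)\,dt=\infty;$$ (iii) for every $u_0\in C_0(\mathbb R^d)\cap L^1(\mathbb R^d)$ with $u_0>0$, the local mild solution of $$u_t+\mathcal L u=h(t)f(u)\ \text{ in }\mathbb R^d\times(0,\infty),\qquad u(\cdot,0)=u_0,$$ blows up in finite time.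
   Context: $C_0(\mathbb R^d)$ is the space of continuous functions on $\mathbb R^d$ vanishing at infinity. For $\sigma\in(0,1)$, $(-\Delta)^\sigma v(x)=C_{d,\sigma}\,\mathrm{P.V.}\int_{\mathbb R^d}\frac{v(x)-v(y)}{|x-y|^{d+2\sigma}}\,dy$ with $C_{d,\sigma}=\frac{2^{2\sigma-1}\,2\sigma\,\Gamma(\frac{d+2\sigma}{2})}{\pi^{d/2}\Gamma(1-\sigma)}$ is the fractional Laplacian (Fourier multiplier $|\xi|^{2\sigma}$). The heat semigroup generated by $-\mathcal L$ is $e^{-t\mathcal L}\phi(x)=\int_{\mathbb R^d}p_t(x-y)\phi(y)\,dy$, where $p_t(x)=(4\pi t)^{-d/2}\int_{\mathbb R^d}e^{-|x-\xi|^2/(4t)}H^\sigma_t(\xi)\,d\xi$ for $t>0$, and $H_t^\sigma$ is the heat kernel of $(-\Delta)^\sigma$. Minorant and majorant functions $f_m,f_M:[0,\infty)\to[0,\infty)$ of $f$: for $u\ge0$, $f_m(u)=\inf_{0<\alpha<1}\frac{f(\alpha u)}{f(\alpha)}$ and $f_M(u)=\sup_{0<\alpha<1}\frac{f(\alpha u)}{f(\alpha)}$. Mild solution: for nonnegative nontrivial $u_0\in L^\infty(\mathbb R^d)$ and locally Lipschitz nonnegative $f$, the problem has a nonnegative local-in-time mild solution $u\in C([0,T_{\max});L^\infty(\mathbb R^d))$ with maximal existence time $T_{\max}\le\infty$, i.e. $u(x,t)=e^{-t\mathcal L}u_0(x)+\int_0^t e^{-(t-s)\mathcal L}h(s)f(u(x,s))\,ds$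 for all $t\in[0,T_{\max})$. It is global if $T_{\max}=\infty$; it blows up in finite time if $T_{\max}<\infty$, in which case $\lim_{t\to T_{\max}}\|u(\cdot,t)\|_{L^\infty(\mathbb R^d)}=\infty$. *)

theory Defs
  imports "HOL-Probability.Probability"
begin

text \<open>
  The space \<open>R^d\<close> is an arbitrary Euclidean space \<open>'a\<close> with \<open>d = DIM('a)\<close> (hence \<open>d \<ge> 1\<close>).
  Functions on \<open>[0,\<infinity>)\<close> are total functions on \<open>real\<close> whose values at negative arguments are
  irrelevant. Elements of \<open>L\<^sup>\<infinity>(R^d)\<close> are given by Borel representatives; the norm takes values in
  \<open>[0,\<infinity>]\<close>.
\<close>

definition Linf_norm :: "('a::euclidean_space \<Rightarrow> real) \<Rightarrow> ennreal" where
  "Linf_norm g = esssup lborel (\<lambda>x. ennreal \<bar>g x\<bar>)"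

definition in_Linf :: "('a::euclidean_space \<Rightarrow> real) \<Rightarrow> bool" where
  "in_Linf g \<longleftrightarrow> g \<in> borel_measurable lborel \<and> Linf_norm g < \<infinity>"

definition in_C0 :: "('a::euclidean_space \<Rightarrow> real) \<Rightarrow> bool" where
  "in_C0 g \<longleftrightarrow> continuous_on UNIV g \<and> (g \<longlongrightarrow> 0) at_infinity"

text \<open>
  The fractional Laplacian of order \<open>\<sigma>\<close> is the Fourier multiplier \<open>\<bar>\<xi>\<bar>\<^bsup>2\<sigma>\<^esup>\<close>, so its heat kernel is the
  inverse Fourier transform of \<open>\<xi> \<mapsto> exp (- t \<bar>\<xi>\<bar>\<^bsup>2\<sigma>\<^esup>)\<close>. The integral is real because the
  multiplier is even, and \<open>Re\<close> only changes the type.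
\<close>
definition frac_heat_kernel :: "real \<Rightarrow> real \<Rightarrow> 'a::euclidean_space \<Rightarrow> real" where
  "frac_heat_kernel \<sigma> t x =
     Re (LINT \<xi>|lborel. cis (x \<bullet> \<xi>) * of_real (exp (- t * norm \<xi> powr (2 * \<sigma>))))
       / (2 * pi) ^ DIM('a)"

text \<open>The heat kernel and heat semigroup of \<open>L = -\<Delta> + (-\<Delta>)\<^sup>\<sigma>\<close>.\<close>

definition mixed_heat_kernel :: "real \<Rightarrow> real \<Rightarrow> 'a::euclidean_space \<Rightarrow> real" where
  "mixed_heat_kernel \<sigma> t x =
     (4 * pi * t) powr (- (real DIM('a) / 2)) *
     (LINT \<xi>|lborel. exp (- (norm (x - \<xi>))\<^sup>2 / (4 * t)) * frac_heat_kernel \<sigma> t \<xi>)"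

definition heat_semigroup :: "real \<Rightarrow> real \<Rightarrow> ('a::euclidean_space \<Rightarrow> real) \<Rightarrow> 'a \<Rightarrow> real" where
  "heat_semigroup \<sigma> t \<phi> x =
     (if t = 0 then \<phi> x else LINT y|lborel. mixed_heat_kernel \<sigma> t (x - y) * \<phi> y)"

text \<open>
  The infimum is over a nonempty set that is bounded below whenever \<open>f\<close> is nonnegative. For convex
  \<open>f\<close> with \<open>f 0 = 0\<close>, the supremum at \<open>u \<in> [0,1]\<close> is over a set bounded by \<open>1\<close>; for \<open>u > 1\<close> the set
  may be unbounded, and then the value of \<open>majorant f u\<close> is meaningless.
\<close>
definition minorant :: "(real \<Rightarrow> real) \<Rightarrow> real \<Rightarrow> real" where
  "minorant f u = (INF \<alpha>\<in>{0<..<1}. f (\<alpha> * u) / f \<alpha>)"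

definition majorant :: "(real \<Rightarrow> real) \<Rightarrow> real \<Rightarrow> real" where
  "majorant f u = (SUP \<alpha>\<in>{0<..<1}. f (\<alpha> * u) / f \<alpha>)"

text \<open>
  Nonnegative mild solutions \<open>u \<in> C([0,T); L\<^sup>\<infinity>)\<close> of \<open>u\<^sub>t + L u = h(t) f(u)\<close>, \<open>u(0) = u\<^sub>0\<close>, where
  \<open>0 < T \<le> \<infinity>\<close> and \<open>u t x\<close> stands for \<open>u(x,t)\<close>. Representatives are taken nonnegative everywhere,
  so that \<open>f\<close> is only evaluated on \<open>[0,\<infinity>)\<close>.
\<close>
definition mild_solution ::
  "real \<Rightarrow> (real \<Rightarrow> real) \<Rightarrow> (real \<Rightarrow> real) \<Rightarrow> ('a::euclidean_space \<Rightarrow> real) \<Rightarrow> ereal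
     \<Rightarrow> (real \<Rightarrow> 'a \<Rightarrow> real) \<Rightarrow> bool" where
  "mild_solution \<sigma> h f u0 T u \<longleftrightarrow>
     0 < T \<and>
     (\<forall>t. 0 \<le> t \<and> ereal t < T \<longrightarrow>
        in_Linf (u t) \<and> (\<forall>x. 0 \<le> u t x) \<and>
        ((\<lambda>s. Linf_norm (\<lambda>x. u s x - u t x)) \<longlongrightarrow> 0) (at t within {s. 0 \<le> s \<and> ereal s < T}) \<and>
        (AE x in lborel.
           u t x = heat_semigroup \<sigma> t u0 x +
             (LINT s:{0..t}|lborel. heat_semigroup \<sigma> (t - s) (\<lambda>y. h s * f (u s y)) x)))"

text \<open>\<open>T\<close> is the maximal existence time and \<open>u\<close> the corresponding mild solution.\<close>
definition maximal_mild_solution ::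
  "real \<Rightarrow> (real \<Rightarrow> real) \<Rightarrow> (real \<Rightarrow> real) \<Rightarrow> ('a::euclidean_space \<Rightarrow> real) \<Rightarrow> ereal
     \<Rightarrow> (real \<Rightarrow> 'a \<Rightarrow> real) \<Rightarrow> bool" where
  "maximal_mild_solution \<sigma> h f u0 T u \<longleftrightarrow>
     mild_solution \<sigma> h f u0 T u \<and>
     \<not> (\<exists>T' v. T < T' \<and> mild_solution \<sigma> h f u0 T' v \<and>
           (\<forall>t. 0 \<le> t \<and> ereal t < T \<longrightarrow> (AE x in lborel. v t x = u t x)))"

definition blows_up_in_finite_time ::
  "real \<Rightarrow> (real \<Rightarrow> real) \<Rightarrow> (real \<Rightarrow> real) \<Rightarrow> ('a::euclidean_space \<Rightarrow> real) \<Rightarrow> bool" where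
  "blows_up_in_finite_time \<sigma> h f u0 \<longleftrightarrow>
     (\<exists>(T::real) u. maximal_mild_solution \<sigma> h f u0 (ereal T) u \<and>
        ((\<lambda>t. Linf_norm (u t)) \<longlongrightarrow> \<infinity>) (at_left T))"

end

theory Submission
  imports Defs
begin

text \<open>
  Write \<open>K\<^sub>t\<close> for the heat kernel and \<open>\<gamma> = d / (2 \<sigma>)\<close>. By subordination \<open>K\<^sub>t\<close> is a mixture of Gaussians of
  variance parameter at least \<open>t\<close>, which yields positivity and the inequality
  \<open>K\<^sub>t * g(x) \<ge> g(x) (K\<^sub>t * g)(0)\<close> for \<open>g(x) = exp (- b \<bar>x\<bar>\<^sup>2)\<close>; Fourier inversion yields mass one and the
  semigroup law, and scaling gives \<open>\<parallel>exp (- t L) u\<^sub>0\<parallel>\<^sub>\<infinity> \<asymp> t\<^bsup>-\<gamma>\<^esup>\<close> for large \<open>t\<close>. As \<open>f(r) / r\<close> is nondecreasing, this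
  gives the equivalence of (i) and (ii).

  If (ii) holds, test the minimal solution \<open>u\<close> with \<open>\<psi>\<^sub>t(x) = exp (- \<bar>x\<bar>\<^sup>2 / t\<^bsup>1/\<sigma>\<^esup>)\<close>. Since \<open>exp (- \<tau> L) \<psi>\<^sub>t \<ge> c \<psi>\<^sub>r\<close>
  for \<open>r, \<tau> \<le> t\<close>, Duhamel's formula and Jensen's inequality show that \<open>m(t) = \<integral> \<psi>\<^sub>t u(t)\<close> dominates a solution of
  \<open>z' = c h(t) t\<^bsup>\<gamma>\<^esup> f(z t\<^bsup>-\<gamma>\<^esup>)\<close>, and \<open>f(\<alpha> z) \<ge> f(\<alpha>) f\<^sub>m(z)\<close> separates the variables; so \<open>u\<close> is not global.
  If (ii) fails, then for small data \<open>2 exp (- t L) u\<^sub>0\<close> is a supersolution, by the condition on \<open>f\<^sub>M\<close>, and it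
  dominates every mild solution.
\<close>

section \<open>Gaussians and Fourier inversion\<close>

text \<open>Blow-up asks for one maximal solution with diverging norm, whereas its failure must be
  shown for every mild solution, so the two directions use different tools. Existence comes from
  Picard iterates with values in [0,\<infinity>]: their supremum is defined at all times before
  anything is known to be finite, and its blow-up time is read off from it. Arbitrary mild solutions
  are compared with 2 exp (- t L) u0 by iterating Duhamel's inequality, with an error of the form M
  (C t)^n / n!. The kernel is handled through its symbol exp (- t |\<xi>|^(2\<sigma>)) exp (- t
  |\<xi>|^2). Rescaled to the stable width t^(1/(2\<sigma>)), the second factor has parameter
  t^(1-1/\<sigma>), at most 1 for t \<ge> 1, so at large times the first factor decides. The test
  functions have this width, which is why one constant c serves all times. The two conditions on f
  act at opposite ends: integrability of 1 / f_m is the Osgood condition that rules out unlimited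
  growth over an infinite time, while f_M(u) / u tending to 0 means that scaling the data by
  \<delta> shrinks the source faster than the data, against a weight integral that stays
  fixed.\<close>

lemma lborel_integral_prod_Basis:
  fixes g :: "'a::euclidean_space \<Rightarrow> real \<Rightarrow> 'b::{real_normed_field,banach,second_countable_topology}"
  assumes g: "\<And>b. b \<in> Basis \<Longrightarrow> integrable lborel (g b)"
  shows "integrable lborel (\<lambda>x::'a. \<Prod>b\<in>Basis. g b (x \<bullet> b))"
    and "(LINT x|lborel. (\<Prod>b\<in>Basis. g b (x \<bullet> b))) = (\<Prod>b\<in>(Basis::'a set). (LINT r|lborel. g b r))"
proof -
  interpret P: product_sigma_finite "\<lambda>_::'a. lborel :: real measure" ..
  have gm[measurable]: "g b \<in> borel_measurable lborel" if "b \<in> Basis" for b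
    using g[OF that] by auto
  have gm': "g b \<in> borel_measurable borel" if "b \<in> Basis" for b
    using gm[OF that] by simp
  let ?T = "\<lambda>f. \<Sum>b\<in>(Basis::'a set). f b *\<^sub>R b"
  have T: "?T \<in> measurable (\<Pi>\<^sub>M b\<in>(Basis::'a set). lborel) borel" by measurable
  have F: "(\<lambda>x::'a. \<Prod>b\<in>Basis. g b (x \<bullet> b)) \<in> borel_measurable borel"
    by (rule borel_measurable_prod) (use gm' in measurable)
  have eq: "(\<Prod>b\<in>Basis. g b (?T f \<bullet> b)) = (\<Prod>b\<in>Basis. g b (f b))" for f
    by (rule prod.cong) (auto simp: inner_sum_left inner_Basis if_distrib cong: if_cong)
  have 1: "integrable (\<Pi>\<^sub>M b\<in>(Basis::'a set). lborel) (\<lambda>x. (\<Prod>b\<in>Basis. g b (x b)))"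
    by (rule P.product_integrable_prod) (use g in auto)
  have 2: "(LINT x|(\<Pi>\<^sub>M b\<in>(Basis::'a set). lborel). (\<Prod>b\<in>Basis. g b (x b))) = (\<Prod>b\<in>(Basis::'a set). (LINT r|lborel. g b r))"
    by (rule P.product_integral_prod) (use g in auto)
  show "integrable lborel (\<lambda>x::'a. \<Prod>b\<in>Basis. g b (x \<bullet> b))"
    by (subst lborel_eq, subst integrable_distr_eq[OF T F]) (use 1 eq in simp)
  show "(LINT x|lborel. (\<Prod>b\<in>Basis. g b (x \<bullet> b))) = (\<Prod>b\<in>(Basis::'a set). (LINT r|lborel. g b r))"
    by (subst lborel_eq, subst integral_distr[OF T F]) (use 2 eq in simp)
qed

lemma borel_measurable_cis [measurable (raw)]:
  assumes f: "f \<in> borel_measurable M"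
  shows "(\<lambda>x. cis (f x)) \<in> borel_measurable M"
  by (rule measurable_compose[OF f]) (intro borel_measurable_continuous_onI continuous_intros)

text \<open>This is the characteristic function of the standard normal law after a change of scale.
  Complex values are kept so that the transform in d dimensions factors over the
  coordinates.\<close>

lemma gaussian_fourier_real:
  fixes a t :: real
  assumes a: "a > 0"
  shows "integrable lborel (\<lambda>x. cis (t * x) * of_real (exp (- a * x\<^sup>2)))"
    and "(LINT x|lborel. cis (t * x) * of_real (exp (- a * x\<^sup>2))) = of_real (sqrt (pi / a) * exp (- t\<^sup>2 / (4 * a)))"
proof -
  \<comment> \<open>The scale at which the exponent of the standard normal density becomes - a x^2,
    because c^2 / 2 = a.\<close>
  define c where "c = sqrt (2 * a)"
  have c: "c > 0" "c\<^sup>2 = 2 * a" using a by (auto simp: c_def)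
  let ?s = "t / c"
  have ch: "(LINT x|lborel. std_normal_density x *\<^sub>R cis (?s * x)) = of_real (exp (- ?s\<^sup>2 / 2))"
    using fun_cong[OF char_std_normal_distribution, of ?s]
    by (simp add: char_def integral_density normal_density_nonneg cis_conv_exp)
  have int: "integrable lborel (\<lambda>x. std_normal_density x *\<^sub>R cis (?s * x))"
    by (rule Bochner_Integration.integrable_bound[of _ "\<lambda>x. std_normal_density x"])
       (auto simp: integrable_normal_density)
  have eq: "std_normal_density (0 + c * x) *\<^sub>R cis (?s * (0 + c * x)) = of_real (1 / sqrt (2 * pi)) * (cis (t * x) * of_real (exp (- a * x\<^sup>2)))" for x
    using c by (simp add: std_normal_density_def scaleR_conv_of_real power_mult_distrib)
  have I0: "integrable lborel (\<lambda>x. of_real (1 / sqrt (2 * pi)) * (cis (t * x) * of_real (exp (- a * x\<^sup>2))))"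
    using lborel_integrable_real_affine[OF int, of c 0] c unfolding eq by simp
  have "integrable lborel (\<lambda>x. of_real (sqrt (2 * pi)) * (of_real (1 / sqrt (2 * pi)) * (cis (t * x) * of_real (exp (- a * x\<^sup>2)))))"
    by (rule integrable_mult_right) (rule I0)
  moreover have "of_real (sqrt (2 * pi)) * (of_real (1 / sqrt (2 * pi)) * z) = (z::complex)" for z
    by (simp add: mult.assoc[symmetric] of_real_mult[symmetric] del: of_real_mult)
  ultimately show I: "integrable lborel (\<lambda>x. cis (t * x) * of_real (exp (- a * x\<^sup>2)))"
    by simp
  have "of_real (exp (- ?s\<^sup>2 / 2)) = \<bar>c\<bar> *\<^sub>R (LINT x|lborel. of_real (1 / sqrt (2 * pi)) * (cis (t * x) * of_real (exp (- a * x\<^sup>2))))"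
    unfolding ch[symmetric] using c lborel_integral_real_affine[of c "\<lambda>x. std_normal_density x *\<^sub>R cis (?s * x)" 0]
    unfolding eq by simp
  also have "\<dots> = of_real (c / sqrt (2 * pi)) * (LINT x|lborel. (cis (t * x) * of_real (exp (- a * x\<^sup>2))))"
    using c by (simp add: scaleR_conv_of_real)
  finally have *: "(LINT x|lborel. (cis (t * x) * of_real (exp (- a * x\<^sup>2)))) = of_real (sqrt (2 * pi) / c * exp (- ?s\<^sup>2 / 2))"
    using c by (simp add: field_simps)
  have "sqrt (2 * pi) / c = sqrt (pi / a)" using a by (simp add: c_def real_sqrt_divide[symmetric])
  moreover have "- ?s\<^sup>2 / 2 = - t\<^sup>2 / (4 * a)" using c by (simp add: power_divide)
  ultimately show "(LINT x|lborel. cis (t * x) * of_real (exp (- a * x\<^sup>2))) = of_real (sqrt (pi / a) * exp (- t\<^sup>2 / (4 * a)))"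
    using * by simp
qed

lemma cis_sum: "finite A \<Longrightarrow> cis (\<Sum>i\<in>A. f i) = (\<Prod>i\<in>A. cis (f i))"
  by (induction rule: finite_induct) (auto simp: cis_mult[symmetric])

lemma norm_power2_sum_Basis: "(norm (x::'a::euclidean_space))\<^sup>2 = (\<Sum>b\<in>Basis. (x \<bullet> b)\<^sup>2)"
  unfolding power2_norm_eq_inner by (subst euclidean_inner) (simp add: power2_eq_square)

lemma gaussian_fourier_complex:
  fixes x :: "'a::euclidean_space"
  assumes a: "a > 0"
  shows "integrable lborel (\<lambda>\<xi>. cis (x \<bullet> \<xi>) * of_real (exp (- a * (norm \<xi>)\<^sup>2)))"
    and "(LINT \<xi>|lborel. cis (x \<bullet> \<xi>) * of_real (exp (- a * (norm \<xi>)\<^sup>2)))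
          = of_real (sqrt (pi / a) ^ DIM('a) * exp (- (norm x)\<^sup>2 / (4 * a)))"
proof -
  let ?g = "\<lambda>b r. cis ((x \<bullet> b) * r) * of_real (exp (- a * r\<^sup>2))"
  have eq: "(\<Prod>b\<in>Basis. ?g b (\<xi> \<bullet> b)) = cis (x \<bullet> \<xi>) * of_real (exp (- a * (norm \<xi>)\<^sup>2))" for \<xi>
  proof -
    have "(\<Prod>b\<in>Basis. ?g b (\<xi> \<bullet> b)) = cis (\<Sum>b\<in>Basis. (x \<bullet> b) * (\<xi> \<bullet> b)) * of_real (exp (\<Sum>b\<in>Basis. - a * (\<xi> \<bullet> b)\<^sup>2))"
      by (simp add: prod.distrib cis_sum exp_sum)
    also have "(\<Sum>b\<in>Basis. (x \<bullet> b) * (\<xi> \<bullet> b)) = x \<bullet> \<xi>" by (simp add: euclidean_inner[of x \<xi>])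
    also have "(\<Sum>b\<in>Basis. - a * (\<xi> \<bullet> b)\<^sup>2) = - a * (norm \<xi>)\<^sup>2" by (simp add: norm_power2_sum_Basis sum_distrib_left sum_negf)
    finally show ?thesis .
  qed
  show "integrable lborel (\<lambda>\<xi>. cis (x \<bullet> \<xi>) * of_real (exp (- a * (norm \<xi>)\<^sup>2)))"
    using lborel_integral_prod_Basis(1)[of ?g] gaussian_fourier_real(1)[OF a] unfolding eq by blast
  have "(LINT \<xi>|lborel. cis (x \<bullet> \<xi>) * of_real (exp (- a * (norm \<xi>)\<^sup>2))) = (\<Prod>b\<in>(Basis::'a set). (LINT r|lborel. ?g b r))"
    using lborel_integral_prod_Basis(2)[of ?g] gaussian_fourier_real(1)[OF a] unfolding eq by blast
  also have "\<dots> = (\<Prod>b\<in>(Basis::'a set). of_real (sqrt (pi / a) * exp (- (x \<bullet> b)\<^sup>2 / (4 * a))))"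
    by (simp only: gaussian_fourier_real(2)[OF a])
  also have "\<dots> = of_real (\<Prod>b\<in>(Basis::'a set). sqrt (pi / a) * exp (- (x \<bullet> b)\<^sup>2 / (4 * a)))"
    by simp
  also have "(\<Prod>b\<in>(Basis::'a set). sqrt (pi / a) * exp (- (x \<bullet> b)\<^sup>2 / (4 * a))) = sqrt (pi / a) ^ DIM('a) * exp (\<Sum>b\<in>Basis. - (x \<bullet> b)\<^sup>2 / (4 * a))"
    by (simp add: prod.distrib exp_sum)
  also have "(\<Sum>b\<in>Basis. - (x \<bullet> b)\<^sup>2 / (4 * a)) = - (norm x)\<^sup>2 / (4 * a)"
    by (simp add: norm_power2_sum_Basis sum_divide_distrib sum_negf)
  finally show "(LINT \<xi>|lborel. cis (x \<bullet> \<xi>) * of_real (exp (- a * (norm \<xi>)\<^sup>2)))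
          = of_real (sqrt (pi / a) ^ DIM('a) * exp (- (norm x)\<^sup>2 / (4 * a)))" .
qed

text \<open>The parameter is the coefficient in the exponent, so that products add parameters. The
  same family then plays two roles: \<open>gauss t\<close> is the symbol of the heat flow at time t,
  and \<open>gauss (1 / (4 * t))\<close> is, up to normalisation, its kernel.\<close>

definition gauss :: "real \<Rightarrow> 'a::euclidean_space \<Rightarrow> real" where
  "gauss a x = exp (- a * (norm x)\<^sup>2)"

lemma gauss_pos [simp]: "0 < gauss a x"
  and gauss_nonneg [simp]: "0 \<le> gauss a x"
  and gauss_0 [simp]: "gauss a 0 = 1"
  and gauss_minus [simp]: "gauss a (- x) = gauss a x"
  by (simp_all add: gauss_def)

lemma gauss_le_1: "0 \<le> a \<Longrightarrow> gauss a x \<le> 1"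
  by (simp add: gauss_def)

lemma gauss_antimono: "a \<le> b \<Longrightarrow> gauss b x \<le> gauss a x"
  by (simp add: gauss_def mult_right_mono)

lemma gauss_add: "gauss (a + b) x = gauss a x * gauss b x"
  by (simp add: gauss_def exp_add[symmetric] algebra_simps)

lemma gauss_scaleR: "gauss a (c *\<^sub>R x) = gauss (a * c\<^sup>2) x"
  by (simp add: gauss_def power_mult_distrib)

lemma continuous_gauss [continuous_intros]:
  "continuous_on S f \<Longrightarrow> continuous_on S (\<lambda>x. gauss a (f x))"
  unfolding gauss_def by (intro continuous_intros)

lemma borel_measurable_gauss [measurable]:
  assumes [measurable]: "a \<in> borel_measurable M" "f \<in> borel_measurable M"
  shows "(\<lambda>x. gauss (a x) (f x)) \<in> borel_measurable M"
  unfolding gauss_def by measurable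

lemma gauss_fourier:
  fixes x :: "'a::euclidean_space"
  assumes a: "a > 0"
  shows "integrable lborel (gauss a :: 'a \<Rightarrow> real)"
    and "(LINT \<xi>|lborel. cos (x \<bullet> \<xi>) * gauss a \<xi>) = sqrt (pi / a) ^ DIM('a) * gauss (1 / (4 * a)) x"
    and "(LINT \<xi>::'a|lborel. gauss a \<xi>) = sqrt (pi / a) ^ DIM('a)"
proof -
  note G = gaussian_fourier_complex[OF a, folded gauss_def]
  have "integrable lborel (\<lambda>\<xi>::'a. of_real (gauss a \<xi>) :: complex)"
    using G(1)[of 0] by simp
  then show I: "integrable lborel (gauss a :: 'a \<Rightarrow> real)"
    unfolding complex_of_real_integrable_eq .
  show "(LINT \<xi>|lborel. cos (x \<bullet> \<xi>) * gauss a \<xi>) = sqrt (pi / a) ^ DIM('a) * gauss (1 / (4 * a)) x"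
    using arg_cong[OF G(2)[of x], of Re] integral_Re[OF G(1)[of x]] by (simp add: gauss_def)
  show "(LINT \<xi>::'a|lborel. gauss a \<xi>) = sqrt (pi / a) ^ DIM('a)"
    using arg_cong[OF G(2)[of 0], of Re] integral_Re[OF G(1)[of 0]] by simp
qed

section \<open>Substitution and Fubini for Lebesgue measure\<close>

lemma AE_False_lborel: "\<not> (AE x::'a::euclidean_space in lborel. False)"
proof
  assume "AE x::'a in lborel. False"
  then have "emeasure lborel (UNIV::'a set) = 0"
    by (subst (asm) AE_iff_measurable[of UNIV]) auto
  then show False by simp
qed

lemma lborel_integral_affine:
  fixes f :: "'a::euclidean_space \<Rightarrow> 'b::{banach,second_countable_topology}"
  assumes c: "c \<noteq> 0" and [measurable]: "f \<in> borel_measurable borel"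
  shows "(LINT x|lborel. f x) = \<bar>c\<bar>^DIM('a) *\<^sub>R (LINT x|lborel. f (t + c *\<^sub>R x))"
proof -
  have "(LINT x|lborel. f x) = (LINT x|density (distr lborel borel (\<lambda>x. t + c *\<^sub>R x)) (\<lambda>_. \<bar>c\<bar>^DIM('a)). f x)"
    by (subst lborel_affine[OF c, of t]) rule
  also have "\<dots> = (LINT x|distr lborel borel (\<lambda>x. t + c *\<^sub>R x). \<bar>c\<bar>^DIM('a) *\<^sub>R f x)"
    by (subst integral_density) auto
  also have "\<dots> = (LINT x|lborel. \<bar>c\<bar>^DIM('a) *\<^sub>R f (t + c *\<^sub>R x))"
    by (subst integral_distr) auto
  finally show ?thesis by simp
qed

lemma lborel_nn_integral_affine:
  fixes f :: "'a::euclidean_space \<Rightarrow> ennreal"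
  assumes c: "c \<noteq> 0" and [measurable]: "f \<in> borel_measurable borel"
  shows "(\<integral>\<^sup>+x. f x \<partial>lborel) = ennreal (\<bar>c\<bar>^DIM('a)) * (\<integral>\<^sup>+x. f (t + c *\<^sub>R x) \<partial>lborel)"
proof -
  have "(\<integral>\<^sup>+x. f x \<partial>lborel) = (\<integral>\<^sup>+x. f x \<partial>density (distr lborel borel (\<lambda>x. t + c *\<^sub>R x)) (\<lambda>_. \<bar>c\<bar>^DIM('a)))"
    by (subst lborel_affine[OF c, of t]) rule
  also have "\<dots> = (\<integral>\<^sup>+x. ennreal (\<bar>c\<bar>^DIM('a)) * f (t + c *\<^sub>R x) \<partial>lborel)"
    by (simp add: nn_integral_density nn_integral_distr)
  finally show ?thesis by (simp add: nn_integral_cmult)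
qed

text \<open>In each exchange of signed integrals below, the integrand has a majorant that splits
  into a function of x and a function of y.\<close>

lemma lborel_integral_swap_bound:
  fixes F :: "'a::euclidean_space \<Rightarrow> 'b::euclidean_space \<Rightarrow> real"
  assumes g: "integrable lborel g" and h: "integrable lborel h"
    and F [measurable]: "(\<lambda>(x, y). F x y) \<in> borel_measurable (borel \<Otimes>\<^sub>M borel)"
    and le: "\<And>x y. \<bar>F x y\<bar> \<le> \<bar>g x :: real\<bar> * \<bar>h y :: real\<bar>"
  shows "(LINT x|lborel. (LINT y|lborel. F x y)) = (LINT y|lborel. (LINT x|lborel. F x y))"
proof -
  have [measurable]: "g \<in> borel_measurable borel" "h \<in> borel_measurable borel"
    using g h by auto
  have "integrable (lborel \<Otimes>\<^sub>M lborel) (\<lambda>(x, y). F x y)"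
  proof (rule integrableI_bounded)
    have "(\<integral>\<^sup>+ p. ennreal (norm (case p of (x, y) \<Rightarrow> F x y)) \<partial>(lborel \<Otimes>\<^sub>M lborel))
      \<le> (\<integral>\<^sup>+ p. ennreal \<bar>g (fst p)\<bar> * ennreal \<bar>h (snd p)\<bar> \<partial>(lborel \<Otimes>\<^sub>M lborel))"
      using le by (intro nn_integral_mono) (auto simp: ennreal_mult'[symmetric] ennreal_leI split: prod.split)
    also have "\<dots> = (\<integral>\<^sup>+ x. (\<integral>\<^sup>+ y. ennreal \<bar>g x\<bar> * ennreal \<bar>h y\<bar> \<partial>lborel) \<partial>lborel)"
      by (subst lborel.nn_integral_fst[symmetric]) auto
    also have "\<dots> = (\<integral>\<^sup>+ x. ennreal \<bar>g x\<bar> \<partial>lborel) * (\<integral>\<^sup>+ y. ennreal \<bar>h y\<bar> \<partial>lborel)"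
      by (simp add: nn_integral_cmult nn_integral_multc)
    also have "\<dots> < \<infinity>"
      using g h by (auto simp: integrable_iff_bounded ennreal_mult_less_top)
    finally show "(\<integral>\<^sup>+ p. ennreal (norm (case p of (x, y) \<Rightarrow> F x y)) \<partial>(lborel \<Otimes>\<^sub>M lborel)) < \<infinity>" .
  qed simp
  from lborel_pair.Fubini_integral[OF this] show ?thesis by simp
qed

text \<open>For even symbols, the kind used here, the inverse Fourier transform reduces to a real
  cosine transform.\<close>

definition inv_fourier :: "('a::euclidean_space \<Rightarrow> real) \<Rightarrow> 'a \<Rightarrow> real" where
  "inv_fourier \<Psi> x = (LINT \<eta>|lborel. cos (x \<bullet> \<eta>) * \<Psi> \<eta>) / (2 * pi) ^ DIM('a)"

lemma integrable_cos_mult: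
  fixes \<Psi> :: "'a::euclidean_space \<Rightarrow> real"
  assumes "integrable lborel \<Psi>"
  shows "integrable lborel (\<lambda>\<eta>. cos (x \<bullet> \<eta>) * \<Psi> \<eta>)"
proof -
  have [measurable]: "\<Psi> \<in> borel_measurable borel" using assms by auto
  show ?thesis
    by (rule Bochner_Integration.integrable_bound[OF assms])
       (auto simp: abs_mult intro!: mult_left_le_one_le AE_I2)
qed

lemma borel_measurable_inv_fourier [measurable]:
  assumes [measurable]: "\<Psi> \<in> borel_measurable borel"
  shows "inv_fourier \<Psi> \<in> borel_measurable borel"
  unfolding inv_fourier_def by measurable

lemma inv_fourier_minus [simp]: "inv_fourier \<Psi> (- x) = inv_fourier \<Psi> x"
  by (simp add: inv_fourier_def)

lemma inv_fourier_le_0: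
  assumes "integrable lborel \<Psi>" and "\<And>\<eta>. 0 \<le> \<Psi> \<eta>"
  shows "\<bar>inv_fourier \<Psi> x\<bar> \<le> inv_fourier \<Psi> 0"
proof -
  have "\<bar>LINT \<eta>|lborel. cos (x \<bullet> \<eta>) * \<Psi> \<eta>\<bar> \<le> (LINT \<eta>|lborel. \<bar>cos (x \<bullet> \<eta>) * \<Psi> \<eta>\<bar>)"
    by (rule integral_abs_bound)
  also have "\<dots> \<le> (LINT \<eta>|lborel. \<Psi> \<eta>)"
    using assms by (intro integral_mono integrable_abs integrable_cos_mult) (auto simp: abs_mult intro: mult_left_le_one_le)
  finally show ?thesis
    by (simp add: inv_fourier_def abs_divide divide_right_mono)
qed

lemma inv_fourier_0_nonneg: "(\<And>\<xi>. 0 \<le> f \<xi>) \<Longrightarrow> 0 \<le> inv_fourier f 0"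
  unfolding inv_fourier_def by (intro divide_nonneg_nonneg Bochner_Integration.integral_nonneg) auto

lemma inv_fourier_0_mono:
  "integrable lborel f \<Longrightarrow> integrable lborel g \<Longrightarrow> (\<And>\<xi>. f \<xi> \<le> g \<xi>) \<Longrightarrow> inv_fourier f 0 \<le> inv_fourier g 0"
  unfolding inv_fourier_def by (intro divide_right_mono integral_mono) auto

lemma inv_fourier_0_scale:
  fixes f :: "'a::euclidean_space \<Rightarrow> real"
  assumes [measurable]: "f \<in> borel_measurable borel" and c: "c > 0"
  shows "inv_fourier f 0 = c ^ DIM('a) * inv_fourier (\<lambda>\<xi>. f (c *\<^sub>R \<xi>)) 0"
  using lborel_integral_affine[of c f 0] c by (simp add: inv_fourier_def)

lemma inv_fourier_0_pos:
  fixes f :: "'a::euclidean_space \<Rightarrow> real"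
  assumes f: "integrable lborel f" and pos: "\<And>\<xi>. 0 < f \<xi>"
  shows "0 < inv_fourier f 0"
proof -
  have "(LINT \<xi>|lborel. f \<xi>) \<noteq> 0"
  proof
    assume "(LINT \<xi>|lborel. f \<xi>) = 0"
    then have "AE \<xi> in lborel. f \<xi> = 0"
      using integral_nonneg_eq_0_iff_AE[OF f] pos by (auto simp: less_imp_le)
    then have "AE \<xi>::'a in lborel. False" using pos by (auto simp: less_le)
    then show False using AE_False_lborel by blast
  qed
  moreover have "0 \<le> (LINT \<xi>|lborel. f \<xi>)" using pos by (intro Bochner_Integration.integral_nonneg) (auto simp: less_imp_le)
  ultimately show ?thesis by (simp add: inv_fourier_def)
qed

lemma inv_fourier_gauss:
  fixes x :: "'a::euclidean_space"
  assumes "a > 0"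
  shows "inv_fourier (gauss a) x = gauss (1 / (4 * a)) x / sqrt (4 * pi * a) ^ DIM('a)"
proof -
  have "sqrt (4 * pi * a) * sqrt (pi / a) = sqrt (4 * pi * a * (pi / a))"
    by (simp add: real_sqrt_mult[symmetric])
  also have "\<dots> = 2 * pi"
    using assms by (simp add: real_sqrt_mult)
  finally have "2 * pi = sqrt (4 * pi * a) * sqrt (pi / a)" ..
  then have "(2 * pi) ^ DIM('a) = sqrt (4 * pi * a) ^ DIM('a) * sqrt (pi / a) ^ DIM('a)"
    by (simp add: power_mult_distrib)
  then show ?thesis
    unfolding inv_fourier_def gauss_fourier(2)[OF assms] using assms by simp
qed

text \<open>The inner integral of the damped inversion formula. The product of cosines splits into
  the difference and the sum of the frequencies, and each part gives a Gaussian, one centred at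
  \<zeta> = \<eta> and the other at its reflection.\<close>

lemma gauss_fourier_shift:
  fixes \<zeta> \<eta> :: "'a::euclidean_space"
  assumes b: "b > 0"
  shows "(LINT y|lborel. cos (y \<bullet> \<zeta>) * cos (y \<bullet> \<eta>) * gauss b y)
    = sqrt (pi / b) ^ DIM('a) / 2 * (gauss (1 / (4 * b)) (\<zeta> - \<eta>) + gauss (1 / (4 * b)) (- \<zeta> - \<eta>))"
proof -
  have eq: "cos (y \<bullet> \<zeta>) * cos (y \<bullet> \<eta>) * gauss b y
     = (cos ((\<zeta> - \<eta>) \<bullet> y) * gauss b y + cos ((- \<zeta> - \<eta>) \<bullet> y) * gauss b y) / 2" for y
  proof -
    have 1: "cos ((- \<zeta> - \<eta>) \<bullet> y) = cos ((\<zeta> + \<eta>) \<bullet> y)"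
      by (metis cos_minus inner_minus_left minus_add_distrib uminus_add_conv_diff add.commute)
    show ?thesis
      unfolding 1 by (simp add: inner_diff_left inner_add_left cos_add cos_diff inner_commute[of y] algebra_simps)
  qed
  show ?thesis
    unfolding eq integral_divide_zero
    by (subst Bochner_Integration.integral_add) (auto simp: integrable_cos_mult gauss_fourier[OF b] distrib_left add_divide_distrib)
qed

text \<open>Inversion is wanted for kernels that are known only through their symbol, without decay
  estimates in space. Nonnegativity of the transform takes the place of decay: it makes the
  Gaussian-damped integrals increase as the damping is removed.\<close>

locale positive_inv_fourier =
  fixes \<Psi> :: "'a::euclidean_space \<Rightarrow> real" and B :: real
  assumes cont: "continuous_on UNIV \<Psi>" and int: "integrable lborel \<Psi>"
    and even: "\<And>\<eta>. \<Psi> (- \<eta>) = \<Psi> \<eta>" and bd: "\<And>\<eta>. \<bar>\<Psi> \<eta>\<bar> \<le> B"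
    and pos: "\<And>x. 0 \<le> inv_fourier \<Psi> x"
begin

lemma meas [measurable]: "\<Psi> \<in> borel_measurable borel"
  by (rule borel_measurable_continuous_onI[OF cont])

lemma inv_fourier_bound: "\<bar>inv_fourier \<Psi> x\<bar> \<le> inv_fourier (\<lambda>\<eta>. \<bar>\<Psi> \<eta>\<bar>) 0"
proof -
  have "\<bar>LINT \<eta>|lborel. cos (x \<bullet> \<eta>) * \<Psi> \<eta>\<bar> \<le> (LINT \<eta>|lborel. \<bar>cos (x \<bullet> \<eta>) * \<Psi> \<eta>\<bar>)"
    by (rule integral_abs_bound)
  also have "\<dots> \<le> (LINT \<eta>|lborel. \<bar>\<Psi> \<eta>\<bar>)"
    using int by (intro integral_mono integrable_abs integrable_cos_mult) (auto simp: abs_mult intro: mult_left_le_one_le)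
  finally show ?thesis
    by (simp add: inv_fourier_def abs_divide divide_right_mono)
qed

lemma damped_integrable:
  assumes b: "b > 0"
  shows "integrable lborel (\<lambda>y. inv_fourier \<Psi> y * cos (y \<bullet> \<eta>) * gauss b y)"
proof (rule Bochner_Integration.integrable_bound)
  show "integrable lborel (\<lambda>y::'a. inv_fourier (\<lambda>\<eta>. \<bar>\<Psi> \<eta>\<bar>) 0 * gauss b y)"
    by (simp add: gauss_fourier(1) b)
  show "AE y in lborel. norm (inv_fourier \<Psi> y * cos (y \<bullet> \<eta>) * gauss b y) \<le> norm (inv_fourier (\<lambda>\<eta>. \<bar>\<Psi> \<eta>\<bar>) 0 * gauss b y)"
  proof (rule AE_I2)
    fix y :: 'a
    have "\<bar>inv_fourier \<Psi> y\<bar> * \<bar>cos (y \<bullet> \<eta>)\<bar> \<le> inv_fourier (\<lambda>\<eta>. \<bar>\<Psi> \<eta>\<bar>) 0 * 1"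
      by (intro mult_mono inv_fourier_bound) (auto intro: order_trans[OF _ inv_fourier_bound])
    then show "norm (inv_fourier \<Psi> y * cos (y \<bullet> \<eta>) * gauss b y) \<le> norm (inv_fourier (\<lambda>\<eta>. \<bar>\<Psi> \<eta>\<bar>) 0 * gauss b y)"
      by (simp add: abs_mult mult_right_mono)
  qed
qed simp

text \<open>The damping makes the order of integration exchangeable. What results is an average of
  \<Psi> over a Gaussian cloud of width proportional to c around \<eta>, that is, an approximate
  identity. The damping parameter is a square so that the substitution is linear in c.\<close>

lemma damped_integral:
  assumes c: "c > 0"
  shows "(LINT y|lborel. inv_fourier \<Psi> y * cos (y \<bullet> \<eta>) * gauss (c\<^sup>2) y)
    = (LINT w|lborel. \<Psi> (\<eta> + (2 * c) *\<^sub>R w) * gauss 1 w) / sqrt pi ^ DIM('a)"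
proof -
  let ?d = "DIM('a)"
  have c2: "c\<^sup>2 > 0" using c by simp
  let ?F = "\<lambda>y \<zeta>. cos (y \<bullet> \<zeta>) * \<Psi> \<zeta> * (cos (y \<bullet> \<eta>) * gauss (c\<^sup>2) y)"
  let ?g = "\<lambda>\<zeta>. gauss (1 / (4 * c\<^sup>2)) (\<zeta> - \<eta>)"
  have gi: "integrable lborel (\<lambda>\<zeta>. \<Psi> \<zeta> * ?g \<zeta>)" and gi': "integrable lborel (\<lambda>\<zeta>. \<Psi> \<zeta> * ?g (- \<zeta>))"
    by (rule Bochner_Integration.integrable_bound[OF int], simp,
        auto simp: abs_mult intro!: AE_I2 mult_left_le gauss_le_1)+
  have "(LINT y|lborel. inv_fourier \<Psi> y * cos (y \<bullet> \<eta>) * gauss (c\<^sup>2) y)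
    = (LINT y|lborel. (LINT \<zeta>|lborel. ?F y \<zeta>)) / (2 * pi) ^ ?d"
    unfolding inv_fourier_def integral_divide_zero[symmetric] by (rule Bochner_Integration.integral_cong) simp_all
  also have "(LINT y|lborel. (LINT \<zeta>|lborel. ?F y \<zeta>)) = (LINT \<zeta>|lborel. (LINT y|lborel. ?F y \<zeta>))"
  proof (rule lborel_integral_swap_bound[OF gauss_fourier(1)[OF c2] int])
    show "\<bar>?F y \<zeta>\<bar> \<le> \<bar>gauss (c\<^sup>2) y\<bar> * \<bar>\<Psi> \<zeta>\<bar>" for y \<zeta>
    proof -
      have "\<bar>cos (y \<bullet> \<zeta>)\<bar> * \<bar>cos (y \<bullet> \<eta>)\<bar> \<le> 1 * 1" by (intro mult_mono) auto
      then have "(\<bar>cos (y \<bullet> \<zeta>)\<bar> * \<bar>cos (y \<bullet> \<eta>)\<bar>) * (gauss (c\<^sup>2) y * \<bar>\<Psi> \<zeta>\<bar>) \<le> 1 * (gauss (c\<^sup>2) y * \<bar>\<Psi> \<zeta>\<bar>)"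
        by (intro mult_right_mono) auto
      then show ?thesis by (simp add: abs_mult ac_simps)
    qed
  qed measurable
  also have "\<dots> = (LINT \<zeta>|lborel. sqrt (pi / c\<^sup>2) ^ ?d / 2 * (\<Psi> \<zeta> * ?g \<zeta> + \<Psi> \<zeta> * ?g (- \<zeta>)))"
  proof (rule Bochner_Integration.integral_cong[OF refl])
    fix \<zeta>
    have "(LINT y|lborel. ?F y \<zeta>) = \<Psi> \<zeta> * (LINT y|lborel. cos (y \<bullet> \<zeta>) * cos (y \<bullet> \<eta>) * gauss (c\<^sup>2) y)"
      by (subst integral_mult_right_zero[symmetric]) (simp add: ac_simps)
    then show "(LINT y|lborel. ?F y \<zeta>) = sqrt (pi / c\<^sup>2) ^ ?d / 2 * (\<Psi> \<zeta> * ?g \<zeta> + \<Psi> \<zeta> * ?g (- \<zeta>))"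
      unfolding gauss_fourier_shift[OF c2] by (simp add: algebra_simps)
  qed
  also have "\<dots> = sqrt (pi / c\<^sup>2) ^ ?d / 2 * ((LINT \<zeta>|lborel. \<Psi> \<zeta> * ?g \<zeta>) + (LINT \<zeta>|lborel. \<Psi> \<zeta> * ?g (- \<zeta>)))"
    using gi gi' by simp
  \<comment> \<open>Evenness of \<Psi> identifies the contribution of the reflected Gaussian with
    the other one, which cancels the factor 1 / 2.\<close>
  also have "(LINT \<zeta>|lborel. \<Psi> \<zeta> * ?g (- \<zeta>)) = (LINT \<zeta>|lborel. \<Psi> \<zeta> * ?g \<zeta>)"
    using lborel_integral_affine[of "-1" "\<lambda>\<zeta>. \<Psi> \<zeta> * ?g (- \<zeta>)" 0] by (simp add: even)
  also have "(LINT \<zeta>|lborel. \<Psi> \<zeta> * ?g \<zeta>) = (2 * c) ^ ?d * (LINT w|lborel. \<Psi> (\<eta> + (2 * c) *\<^sub>R w) * gauss 1 w)"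
  proof -
    have "gauss (1 / (4 * c\<^sup>2)) ((\<eta> + (2 * c) *\<^sub>R w) - \<eta>) = gauss 1 w" for w :: 'a
      using c by (simp add: gauss_scaleR power_mult_distrib)
    then show ?thesis
      using c lborel_integral_affine[of "2 * c" "\<lambda>\<zeta>. \<Psi> \<zeta> * ?g \<zeta>" \<eta>] by simp
  qed
  finally have *: "(LINT y|lborel. inv_fourier \<Psi> y * cos (y \<bullet> \<eta>) * gauss (c\<^sup>2) y)
     = (sqrt (pi / c\<^sup>2) ^ ?d * (2 * c) ^ ?d / (2 * pi) ^ ?d) * (LINT w|lborel. \<Psi> (\<eta> + (2 * c) *\<^sub>R w) * gauss 1 w)"
    by simp
  have "sqrt (pi / c\<^sup>2) * (2 * c) / (2 * pi) = 1 / sqrt pi"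
    using c by (simp add: real_sqrt_divide field_simps)
  then have E: "sqrt (pi / c\<^sup>2) ^ ?d * (2 * c) ^ ?d / (2 * pi) ^ ?d = 1 / sqrt pi ^ ?d"
    by (metis power_divide power_mult_distrib power_one)
  show ?thesis unfolding * E by simp
qed

lemma damped_limit:
  "(\<lambda>n. LINT y|lborel. inv_fourier \<Psi> y * cos (y \<bullet> \<eta>) * gauss ((inverse (real (Suc n)))\<^sup>2) y) \<longlonglongrightarrow> \<Psi> \<eta>"
proof -
  have g1: "integrable lborel (\<lambda>w::'a. gauss 1 w)" by (rule gauss_fourier(1)) simp
  have "(\<lambda>n. LINT w|lborel. \<Psi> (\<eta> + (2 * inverse (real (Suc n))) *\<^sub>R w) * gauss 1 w)
      \<longlonglongrightarrow> (LINT w::'a|lborel. \<Psi> \<eta> * gauss 1 w)"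
  proof (rule integral_dominated_convergence)
    show "integrable lborel (\<lambda>w::'a. B * gauss 1 w)" using g1 by simp
    show "AE w in lborel. (\<lambda>n. \<Psi> (\<eta> + (2 * inverse (real (Suc n))) *\<^sub>R w) * gauss 1 w) \<longlonglongrightarrow> \<Psi> \<eta> * gauss 1 w"
    proof (rule AE_I2)
      fix w :: 'a
      have "(\<lambda>n. \<eta> + (2 * inverse (real (Suc n))) *\<^sub>R w) \<longlonglongrightarrow> \<eta> + (2 * 0) *\<^sub>R w"
        by (intro tendsto_intros LIMSEQ_inverse_real_of_nat)
      then have "(\<lambda>n. \<eta> + (2 * inverse (real (Suc n))) *\<^sub>R w) \<longlonglongrightarrow> \<eta>" by simp
      from continuous_on_tendsto_compose[OF cont this]
      show "(\<lambda>n. \<Psi> (\<eta> + (2 * inverse (real (Suc n))) *\<^sub>R w) * gauss 1 w) \<longlonglongrightarrow> \<Psi> \<eta> * gauss 1 w"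
        by (intro tendsto_intros) auto
    qed
    show "AE w in lborel. norm (\<Psi> (\<eta> + (2 * inverse (real (Suc n))) *\<^sub>R w) * gauss 1 w) \<le> B * gauss 1 w" for n
      by (auto simp: abs_mult bd)
  qed measurable
  from tendsto_divide[OF this tendsto_const[of "sqrt pi ^ DIM('a)"]]
  have "(\<lambda>n. LINT y|lborel. inv_fourier \<Psi> y * cos (y \<bullet> \<eta>) * gauss ((inverse (real (Suc n)))\<^sup>2) y)
    \<longlonglongrightarrow> (LINT w::'a|lborel. \<Psi> \<eta> * gauss 1 w) / sqrt pi ^ DIM('a)"
    by (subst damped_integral) auto
  moreover have "(LINT w::'a|lborel. \<Psi> \<eta> * gauss 1 w) / sqrt pi ^ DIM('a) = \<Psi> \<eta>"
    by (simp add: gauss_fourier(3))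
  ultimately show ?thesis by (simp only:)
qed

lemma damping_factor_limit: "(\<lambda>n. gauss ((inverse (real (Suc n)))\<^sup>2) (y::'a)) \<longlonglongrightarrow> 1"
proof -
  have "(\<lambda>n. exp (- (inverse (real (Suc n)))\<^sup>2 * (norm y)\<^sup>2)) \<longlonglongrightarrow> exp (- 0\<^sup>2 * (norm y)\<^sup>2)"
    by (intro tendsto_intros LIMSEQ_inverse_real_of_nat)
  then show ?thesis by (simp add: gauss_def)
qed

text \<open>At frequency 0 the damped integrals converge to \<Psi> 0, and they increase as the
  damping is removed. Monotone convergence thus yields integrability without any pointwise decay of
  the transform.\<close>

lemma inv_fourier_integrable: "integrable lborel (inv_fourier \<Psi>)"
proof (rule integrable_monotone_convergence)
  let ?f = "\<lambda>n y. inv_fourier \<Psi> y * cos (y \<bullet> 0) * gauss ((inverse (real (Suc n)))\<^sup>2) y"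
  show "integrable lborel (?f n)" for n by (rule damped_integrable) simp
  show "AE y in lborel. mono (\<lambda>n. ?f n y)"
  proof (rule AE_I2, rule monoI)
    fix y :: 'a and m n :: nat assume "m \<le> n"
    then have "inverse (real (Suc n)) ^ 2 \<le> inverse (real (Suc m)) ^ 2"
      by (intro power_mono le_imp_inverse_le) auto
    then show "?f m y \<le> ?f n y"
      using pos[of y] by (auto intro!: mult_left_mono gauss_antimono)
  qed
  show "AE y in lborel. (\<lambda>n. ?f n y) \<longlonglongrightarrow> inv_fourier \<Psi> y"
  proof (rule AE_I2)
    fix y
    show "(\<lambda>n. ?f n y) \<longlonglongrightarrow> inv_fourier \<Psi> y"
      using tendsto_mult[OF tendsto_const[of "inv_fourier \<Psi> y"] damping_factor_limit[of y]] by simp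
  qed
  show "(\<lambda>n. LINT y|lborel. ?f n y) \<longlonglongrightarrow> \<Psi> 0" by (rule damped_limit)
qed simp

lemma fourier_inv_fourier: "(LINT y|lborel. inv_fourier \<Psi> y * cos (y \<bullet> \<eta>)) = \<Psi> \<eta>"
proof (rule LIMSEQ_unique[OF _ damped_limit])
  show "(\<lambda>n. LINT y|lborel. inv_fourier \<Psi> y * cos (y \<bullet> \<eta>) * gauss ((inverse (real (Suc n)))\<^sup>2) y)
     \<longlonglongrightarrow> (LINT y|lborel. inv_fourier \<Psi> y * cos (y \<bullet> \<eta>))"
  proof (rule integral_dominated_convergence)
    show "integrable lborel (inv_fourier \<Psi>)" by (rule inv_fourier_integrable)
    show "AE y in lborel. (\<lambda>n. inv_fourier \<Psi> y * cos (y \<bullet> \<eta>) * gauss ((inverse (real (Suc n)))\<^sup>2) y) \<longlonglongrightarrow> inv_fourier \<Psi> y * cos (y \<bullet> \<eta>)"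
    proof (rule AE_I2)
      fix y
      show "(\<lambda>n. inv_fourier \<Psi> y * cos (y \<bullet> \<eta>) * gauss ((inverse (real (Suc n)))\<^sup>2) y) \<longlonglongrightarrow> inv_fourier \<Psi> y * cos (y \<bullet> \<eta>)"
        using tendsto_mult[OF tendsto_const[of "inv_fourier \<Psi> y * cos (y \<bullet> \<eta>)"] damping_factor_limit[of y]] by simp
    qed
    show "AE y in lborel. norm (inv_fourier \<Psi> y * cos (y \<bullet> \<eta>) * gauss ((inverse (real (Suc n)))\<^sup>2) y) \<le> inv_fourier \<Psi> y" for n
    proof (rule AE_I2)
      fix y :: 'a
      have "\<bar>cos (y \<bullet> \<eta>)\<bar> * gauss ((inverse (real (Suc n)))\<^sup>2) y \<le> 1 * 1"
        by (intro mult_mono gauss_le_1) auto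
      then have "inv_fourier \<Psi> y * (\<bar>cos (y \<bullet> \<eta>)\<bar> * gauss ((inverse (real (Suc n)))\<^sup>2) y) \<le> inv_fourier \<Psi> y * 1"
        using pos[of y] by (intro mult_left_mono) auto
      then show "norm (inv_fourier \<Psi> y * cos (y \<bullet> \<eta>) * gauss ((inverse (real (Suc n)))\<^sup>2) y) \<le> inv_fourier \<Psi> y"
        using pos[of y] by (simp add: abs_mult ac_simps)
    qed
  qed measurable
qed

text \<open>Expanding the second factor by its symbol and exchanging the integrals leaves the
  Fourier transform of the first factor, which inversion identifies with \<Psi>.\<close>

lemma inv_fourier_convolution:
  assumes \<Psi>': "integrable lborel \<Psi>'"
  shows "(LINT y|lborel. inv_fourier \<Psi> y * inv_fourier \<Psi>' (x - y)) = inv_fourier (\<lambda>\<eta>. \<Psi> \<eta> * \<Psi>' \<eta>) x"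
proof -
  have [measurable]: "\<Psi>' \<in> borel_measurable borel" using \<Psi>' by auto
  let ?K = "inv_fourier \<Psi>"
  let ?F = "\<lambda>y \<eta>. ?K y * (cos ((x - y) \<bullet> \<eta>) * \<Psi>' \<eta>)"
  have si: "integrable lborel (\<lambda>y. ?K y * sin (y \<bullet> \<eta>))" and ci: "integrable lborel (\<lambda>y. ?K y * cos (y \<bullet> \<eta>))" for \<eta>
    by (rule Bochner_Integration.integrable_bound[OF inv_fourier_integrable],
        auto simp: abs_mult intro!: AE_I2 mult_left_le)+
  \<comment> \<open>The kernel is even, so only the cosine part of the addition theorem for the
    cosine of (x - y) \<bullet> \<eta> survives.\<close>
  have s0: "(LINT y|lborel. ?K y * sin (y \<bullet> \<eta>)) = 0" for \<eta>
    using lborel_integral_affine[of "-1" "\<lambda>y. ?K y * sin (y \<bullet> \<eta>)" 0] by simp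
  have "(LINT y|lborel. ?K y * inv_fourier \<Psi>' (x - y)) = (LINT y|lborel. (LINT \<eta>|lborel. ?F y \<eta>)) / (2 * pi) ^ DIM('a)"
    unfolding inv_fourier_def[of \<Psi>'] by simp
  also have "(LINT y|lborel. (LINT \<eta>|lborel. ?F y \<eta>)) = (LINT \<eta>|lborel. (LINT y|lborel. ?F y \<eta>))"
  proof (rule lborel_integral_swap_bound[OF inv_fourier_integrable \<Psi>'])
    show "\<bar>?F y \<eta>\<bar> \<le> \<bar>?K y\<bar> * \<bar>\<Psi>' \<eta>\<bar>" for y \<eta>
      by (auto simp: abs_mult intro!: mult_left_mono mult_left_le_one_le)
  qed measurable
  also have "\<dots> = (LINT \<eta>|lborel. cos (x \<bullet> \<eta>) * (\<Psi> \<eta> * \<Psi>' \<eta>))"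
  proof (rule Bochner_Integration.integral_cong[OF refl])
    fix \<eta>
    have "(LINT y|lborel. ?F y \<eta>) = (LINT y|lborel. (cos (x \<bullet> \<eta>) * \<Psi>' \<eta>) * (?K y * cos (y \<bullet> \<eta>)) + (sin (x \<bullet> \<eta>) * \<Psi>' \<eta>) * (?K y * sin (y \<bullet> \<eta>)))"
      by (rule Bochner_Integration.integral_cong) (auto simp: inner_diff_left cos_diff algebra_simps)
    also have "\<dots> = cos (x \<bullet> \<eta>) * \<Psi>' \<eta> * \<Psi> \<eta>"
      using si ci s0 fourier_inv_fourier by simp
    finally show "(LINT y|lborel. ?F y \<eta>) = cos (x \<bullet> \<eta>) * (\<Psi> \<eta> * \<Psi>' \<eta>)" by (simp add: ac_simps)
  qed
  finally show ?thesis by (simp add: inv_fourier_def)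
qed

end

lemma positive_inv_fourier_gauss:
  "a > 0 \<Longrightarrow> positive_inv_fourier (gauss a :: 'a::euclidean_space \<Rightarrow> real) 1"
  by standard (auto intro!: continuous_intros gauss_fourier(1) gauss_le_1 simp: inv_fourier_gauss)

section \<open>The stable symbol as a Gaussian mixture\<close>

lemma power_div_fact_le_exp: "0 \<le> (x::real) \<Longrightarrow> x ^ n / fact n \<le> exp x"
proof -
  assume x: "0 \<le> x"
  have "(\<Sum>k\<in>{n}. x ^ k /\<^sub>R fact k) \<le> (\<Sum>k. x ^ k /\<^sub>R fact k)"
    by (rule sum_le_suminf) (use x summable_exp_generic[of x] in auto)
  then show ?thesis by (simp add: exp_def field_simps)
qed

lemma integrable_inverse_prod_one_plus_square:
  "integrable lborel (\<lambda>x::'a::euclidean_space. \<Prod>b\<in>Basis. inverse (1 + (x \<bullet> b)\<^sup>2))"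
proof -
  have "integrable lborel (\<lambda>x::real. inverse (1 + x\<^sup>2))"
    using integrable_inverse_1_plus_square by (simp add: set_integrable_def einterval_def)
  then show ?thesis by (intro lborel_integral_prod_Basis) auto
qed

text \<open>A single term of the exponential series, of order n with \<sigma> n \<ge> d, beats the
  power R^d for R > 1.\<close>

lemma stretched_exp_le_inverse_power:
  fixes t \<sigma> :: real
  assumes "t > 0" "\<sigma> > 0"
  shows "\<exists>C. \<forall>R\<ge>0. exp (- t * R powr \<sigma>) \<le> C / (1 + R) ^ d"
proof -
  obtain n :: nat where n: "real d \<le> \<sigma> * n"
    by (metis assms(2) mult.commute pos_divide_le_eq real_arch_simple)
  let ?C = "2 ^ d * (1 + fact n / t ^ n)"
  have "exp (- t * R powr \<sigma>) \<le> ?C / (1 + R) ^ d" if R: "R \<ge> 0" for R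
  proof -
    have "(1 + R) ^ d \<le> ?C * exp (t * R powr \<sigma>)"
    proof (cases "R \<le> 1")
      case True
      then have "(1 + R) ^ d \<le> 2 ^ d" using R by (intro power_mono) auto
      also have "\<dots> \<le> 2 ^ d * ((1 + fact n / t ^ n) * exp (t * R powr \<sigma>))"
      proof -
        have "1 * 1 \<le> (1 + fact n / t ^ n) * exp (t * R powr \<sigma>)"
          using assms by (intro mult_mono) auto
        then show ?thesis by simp
      qed
      finally show ?thesis by (simp add: mult.assoc)
    next
      case False
      then have R1: "R > 1" by simp
      have "(1 + R) ^ d \<le> (2 * R) ^ d" using R1 by (intro power_mono) auto
      also have "\<dots> = 2 ^ d * R powr (real d)" using R1 by (simp add: power_mult_distrib powr_realpow)
      also have "\<dots> \<le> 2 ^ d * R powr (\<sigma> * n)" using R1 n by (intro mult_left_mono powr_mono) auto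
      also have "R powr (\<sigma> * n) = (R powr \<sigma>) ^ n"
        using R1 by (simp add: powr_powr[symmetric] powr_realpow)
      also have "\<dots> = (t * R powr \<sigma>) ^ n / t ^ n" using assms by (simp add: power_mult_distrib)
      also have "\<dots> \<le> fact n * exp (t * R powr \<sigma>) / t ^ n"
        using power_div_fact_le_exp[of "t * R powr \<sigma>" n] assms by (intro divide_right_mono) (auto simp: field_simps)
      also have "2 ^ d * (fact n * exp (t * R powr \<sigma>) / t ^ n) \<le> ?C * exp (t * R powr \<sigma>)"
        by (simp add: algebra_simps)
      finally show ?thesis by simp
    qed
    then show ?thesis using R by (simp add: exp_minus field_simps)
  qed
  then show ?thesis by blast
qed

lemma one_plus_norm_ge_prod: "(\<Prod>b\<in>Basis. (1 + (x \<bullet> b)\<^sup>2)) \<le> (1 + (norm (x::'a::euclidean_space))\<^sup>2) ^ DIM('a)"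
proof -
  have "(\<Prod>b\<in>Basis. (1 + (x \<bullet> b)\<^sup>2)) \<le> (\<Prod>b\<in>(Basis::'a set). (1 + (norm x)\<^sup>2))"
    by (intro prod_mono) (auto simp: abs_le_square_iff[symmetric] Basis_le_norm)
  then show ?thesis by simp
qed

definition stable_symbol :: "real \<Rightarrow> real \<Rightarrow> 'a::euclidean_space \<Rightarrow> real" where
  "stable_symbol \<sigma> t \<xi> = exp (- t * norm \<xi> powr (2 * \<sigma>))"

lemma stable_symbol_pos [simp]: "0 < stable_symbol \<sigma> t \<xi>"
  and stable_symbol_nonneg [simp]: "0 \<le> stable_symbol \<sigma> t \<xi>"
  and stable_symbol_minus [simp]: "stable_symbol \<sigma> t (- \<xi>) = stable_symbol \<sigma> t \<xi>"
  by (simp_all add: stable_symbol_def)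

lemma stable_symbol_le_1: "0 \<le> t \<Longrightarrow> stable_symbol \<sigma> t \<xi> \<le> 1"
  by (simp add: stable_symbol_def)

lemma stable_symbol_add: "stable_symbol \<sigma> (s + t) \<xi> = stable_symbol \<sigma> s \<xi> * stable_symbol \<sigma> t \<xi>"
  by (simp add: stable_symbol_def exp_add[symmetric] algebra_simps)

lemma stable_symbol_antimono: "s \<le> t \<Longrightarrow> stable_symbol \<sigma> t \<xi> \<le> stable_symbol \<sigma> s \<xi>"
  by (simp add: stable_symbol_def mult_right_mono)

lemma stable_symbol_scaleR: "stable_symbol \<sigma> t (c *\<^sub>R \<xi>) = stable_symbol \<sigma> (t * \<bar>c\<bar> powr (2 * \<sigma>)) \<xi>"
  by (simp add: stable_symbol_def powr_mult)

lemma borel_measurable_stable_symbol [measurable]: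
  assumes [measurable]: "a \<in> borel_measurable M" "f \<in> borel_measurable M"
  shows "(\<lambda>x. stable_symbol \<sigma> (a x) (f x)) \<in> borel_measurable M"
  unfolding stable_symbol_def by measurable

lemma continuous_stable_symbol [continuous_intros]:
  "\<sigma> > 0 \<Longrightarrow> continuous_on S f \<Longrightarrow> continuous_on S (\<lambda>x. stable_symbol \<sigma> t (f x))"
  unfolding stable_symbol_def by (intro continuous_intros continuous_on_powr') auto

text \<open>The majorant is a product of one-dimensional functions 1 / (1 + x^2), whose integral
  factors over the coordinates.\<close>

lemma integrable_stable_symbol:
  assumes "t > 0" "\<sigma> > 0"
  shows "integrable lborel (stable_symbol \<sigma> t :: 'a::euclidean_space \<Rightarrow> real)"
proof -
  obtain C where C: "\<And>R. R \<ge> 0 \<Longrightarrow> exp (- t * R powr \<sigma>) \<le> C / (1 + R) ^ DIM('a)"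
    using stretched_exp_le_inverse_power[OF assms, of "DIM('a)"] by blast
  have C0: "C \<ge> 0" using order_trans[OF _ C[of 0]] by force
  show ?thesis
  proof (rule Bochner_Integration.integrable_bound[OF integrable_mult_right[OF integrable_inverse_prod_one_plus_square]])
    show "AE \<xi> in lborel. norm (stable_symbol \<sigma> t \<xi>) \<le> norm (C * (\<Prod>b\<in>Basis. inverse (1 + ((\<xi>::'a) \<bullet> b)\<^sup>2)))"
    proof (rule AE_I2)
      fix \<xi> :: 'a
      have "norm \<xi> powr (2 * \<sigma>) = ((norm \<xi>)\<^sup>2) powr \<sigma>"
        unfolding powr_powr[symmetric] by simp
      then have "stable_symbol \<sigma> t \<xi> = exp (- t * ((norm \<xi>)\<^sup>2) powr \<sigma>)"
        by (simp add: stable_symbol_def)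
      also have "\<dots> \<le> C / (1 + (norm \<xi>)\<^sup>2) ^ DIM('a)" by (rule C) simp
      also have "\<dots> \<le> C / (\<Prod>b\<in>Basis. (1 + (\<xi> \<bullet> b)\<^sup>2))"
        using C0 by (intro divide_left_mono one_plus_norm_ge_prod mult_pos_pos prod_pos zero_less_power)
           (auto simp: add_pos_nonneg)
      also have "\<dots> = C * (\<Prod>b\<in>Basis. inverse (1 + (\<xi> \<bullet> b)\<^sup>2))"
        by (simp add: prod_inversef[symmetric] divide_inverse comp_def)
      finally show "norm (stable_symbol \<sigma> t \<xi>) \<le> norm (C * (\<Prod>b\<in>Basis. inverse (1 + (\<xi> \<bullet> b)\<^sup>2)))"
        by (simp add: abs_of_pos)
    qed
  qed measurable
qed

lemma integrable_mult_gauss: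
  fixes \<Psi> :: "'a::euclidean_space \<Rightarrow> real"
  assumes [measurable]: "\<Psi> \<in> borel_measurable borel" and b: "\<And>\<xi>. \<bar>\<Psi> \<xi>\<bar> \<le> B" and a: "a > 0"
  shows "integrable lborel (\<lambda>\<xi>. \<Psi> \<xi> * gauss a \<xi>)"
proof (rule Bochner_Integration.integrable_bound[OF integrable_mult_right[OF gauss_fourier(1)[OF a]]])
  show "AE \<xi> in lborel. norm (\<Psi> \<xi> * gauss a \<xi>) \<le> norm (B * gauss a \<xi>)"
    using b by (intro AE_I2) (auto simp: abs_mult intro!: mult_right_mono order_trans[OF b])
qed measurable

text \<open>Gaussian mixtures \<open>\<integral> gauss s d\<mu>(s)\<close> satisfy the lower bound below, which is stable under
  pointwise limits and under multiplication by Laplace transforms. This avoids constructing the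
  mixing measure of the stable law.\<close>

definition super_gaussian :: "('a::euclidean_space \<Rightarrow> real) \<Rightarrow> bool" where
  "super_gaussian \<Psi> \<longleftrightarrow> \<Psi> \<in> borel_measurable borel \<and> (\<exists>B. \<forall>\<xi>. 0 \<le> \<Psi> \<xi> \<and> \<Psi> \<xi> \<le> B) \<and>
     (\<forall>a>0. \<forall>x. gauss (1 / (4 * a)) x * inv_fourier (\<lambda>\<xi>. \<Psi> \<xi> * gauss a \<xi>) 0 \<le> inv_fourier (\<lambda>\<xi>. \<Psi> \<xi> * gauss a \<xi>) x)"

lemma super_gaussianD:
  "super_gaussian \<Psi> \<Longrightarrow> 0 < a \<Longrightarrow>
    gauss (1 / (4 * a)) x * inv_fourier (\<lambda>\<xi>. \<Psi> \<xi> * gauss a \<xi>) 0 \<le> inv_fourier (\<lambda>\<xi>. \<Psi> \<xi> * gauss a \<xi>) x"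
  by (simp add: super_gaussian_def)

lemma inv_fourier_gauss_0:
  fixes x :: "'a::euclidean_space"
  assumes "a > 0"
  shows "inv_fourier (gauss a) x = gauss (1 / (4 * a)) x * inv_fourier (gauss a) (0::'a)"
  by (simp add: inv_fourier_gauss[OF assms])

lemma super_gaussian_1: "super_gaussian (\<lambda>_. 1)"
  unfolding super_gaussian_def
  by (auto intro!: exI[of _ 1] simp: inv_fourier_gauss_0[symmetric])

lemma inv_fourier_add:
  "integrable lborel f \<Longrightarrow> integrable lborel g \<Longrightarrow> inv_fourier (\<lambda>\<xi>. f \<xi> + g \<xi>) x = inv_fourier f x + inv_fourier g x"
  by (simp add: inv_fourier_def distrib_left integrable_cos_mult add_divide_distrib)

lemma inv_fourier_cmult: "inv_fourier (\<lambda>\<xi>. c * f \<xi>) x = c * inv_fourier f x"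
proof -
  have "(LINT \<eta>|lborel. cos (x \<bullet> \<eta>) * (c * f \<eta>)) = (LINT \<eta>|lborel. c * (cos (x \<bullet> \<eta>) * f \<eta>))"
    by (rule Bochner_Integration.integral_cong) auto
  then show ?thesis by (simp add: inv_fourier_def)
qed

lemma super_gaussian_add:
  assumes f: "super_gaussian f" and g: "super_gaussian g"
  shows "super_gaussian (\<lambda>\<xi>. f \<xi> + g \<xi>)"
proof -
  obtain B C where B: "\<And>\<xi>. 0 \<le> f \<xi> \<and> f \<xi> \<le> B" and C: "\<And>\<xi>. 0 \<le> g \<xi> \<and> g \<xi> \<le> C"
    using f g unfolding super_gaussian_def by metis
  have [measurable]: "f \<in> borel_measurable borel" "g \<in> borel_measurable borel"
    using f g by (auto simp: super_gaussian_def)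
  have "inv_fourier (\<lambda>\<xi>. (f \<xi> + g \<xi>) * gauss a \<xi>) x = inv_fourier (\<lambda>\<xi>. f \<xi> * gauss a \<xi>) x + inv_fourier (\<lambda>\<xi>. g \<xi> * gauss a \<xi>) x" if "a > 0" for a x
    unfolding distrib_right
    by (rule inv_fourier_add; rule integrable_mult_gauss) (use B C that in auto)
  moreover have "\<exists>D. \<forall>\<xi>. 0 \<le> f \<xi> + g \<xi> \<and> f \<xi> + g \<xi> \<le> D"
    using B C by (intro exI[of _ "B + C"]) (auto intro: add_mono)
  ultimately show ?thesis
    using f g unfolding super_gaussian_def by (simp add: distrib_left add_mono)
qed

lemma super_gaussian_cmult:
  assumes f: "super_gaussian f" and c: "c \<ge> 0"
  shows "super_gaussian (\<lambda>\<xi>. c * f \<xi>)"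
proof -
  obtain B where B: "\<And>\<xi>. 0 \<le> f \<xi> \<and> f \<xi> \<le> B"
    using f unfolding super_gaussian_def by metis
  then have "0 \<le> c * f \<xi> \<and> c * f \<xi> \<le> c * B" for \<xi> using c by (auto intro: mult_left_mono)
  moreover have "gauss (1 / (4 * a)) x * (c * inv_fourier (\<lambda>\<xi>. f \<xi> * gauss a \<xi>) 0) \<le> c * inv_fourier (\<lambda>\<xi>. f \<xi> * gauss a \<xi>) x" if "a > 0" for a x
    using f c that unfolding super_gaussian_def by (metis mult.left_commute mult_left_mono)
  ultimately show ?thesis
    using f unfolding super_gaussian_def mult.assoc inv_fourier_cmult by auto
qed

lemma super_gaussian_sum:
  assumes "finite I" "\<And>i. i \<in> I \<Longrightarrow> super_gaussian (f i)"
  shows "super_gaussian (\<lambda>\<xi>. \<Sum>i\<in>I. f i \<xi>)"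
  using assms
proof (induction rule: finite_induct)
  case empty
  show ?case using super_gaussian_cmult[OF super_gaussian_1, of 0] by simp
next
  case (insert i I)
  then show ?case using super_gaussian_add[of "f i" "\<lambda>\<xi>. \<Sum>i\<in>I. f i \<xi>"] by auto
qed

text \<open>The Gaussian factor inside the definition provides the dominating function, so bounded
  pointwise convergence of the symbols is enough for the transforms to converge.\<close>

lemma super_gaussian_limit:
  assumes f: "\<And>n. super_gaussian (f n)" and B: "\<And>n \<xi>. f n \<xi> \<le> B"
    and lim: "\<And>\<xi>. (\<lambda>n::nat. f n \<xi>) \<longlonglongrightarrow> g \<xi>"
  shows "super_gaussian g"
proof -
  have [measurable]: "f n \<in> borel_measurable borel" for n
    using f by (auto simp: super_gaussian_def)
  have gm[measurable]: "g \<in> borel_measurable borel"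
    by (rule borel_measurable_LIMSEQ_real[OF lim]) auto
  have nn: "0 \<le> f n \<xi>" for n \<xi> using f[of n] by (auto simp: super_gaussian_def)
  have conv: "(\<lambda>n. inv_fourier (\<lambda>\<xi>. f n \<xi> * gauss a \<xi>) x) \<longlonglongrightarrow> inv_fourier (\<lambda>\<xi>. g \<xi> * gauss a \<xi>) x" if a: "a > 0" for a x
    unfolding inv_fourier_def
  proof (intro tendsto_divide tendsto_const)
    show "(\<lambda>n. LINT \<xi>|lborel. cos (x \<bullet> \<xi>) * (f n \<xi> * gauss a \<xi>)) \<longlonglongrightarrow> (LINT \<xi>|lborel. cos (x \<bullet> \<xi>) * (g \<xi> * gauss a \<xi>))"
    proof (rule integral_dominated_convergence)
      show "integrable lborel (\<lambda>\<xi>::'a. B * gauss a \<xi>)" by (intro integrable_mult_right gauss_fourier a)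
      show "AE \<xi> in lborel. (\<lambda>n. cos (x \<bullet> \<xi>) * (f n \<xi> * gauss a \<xi>)) \<longlonglongrightarrow> cos (x \<bullet> \<xi>) * (g \<xi> * gauss a \<xi>)"
        by (intro AE_I2 tendsto_intros lim)
      show "AE \<xi> in lborel. norm (cos (x \<bullet> \<xi>) * (f n \<xi> * gauss a \<xi>)) \<le> B * gauss a \<xi>" for n
      proof (rule AE_I2)
        fix \<xi> :: 'a
        have "\<bar>cos (x \<bullet> \<xi>)\<bar> * (f n \<xi> * gauss a \<xi>) \<le> 1 * (B * gauss a \<xi>)"
          by (intro mult_mono mult_nonneg_nonneg B nn order_trans[OF nn B]) auto
        then show "norm (cos (x \<bullet> \<xi>) * (f n \<xi> * gauss a \<xi>)) \<le> B * gauss a \<xi>"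
          by (simp add: abs_mult nn)
      qed
    qed measurable
  qed simp
  have "gauss (1 / (4 * a)) x * inv_fourier (\<lambda>\<xi>. g \<xi> * gauss a \<xi>) 0 \<le> inv_fourier (\<lambda>\<xi>. g \<xi> * gauss a \<xi>) x" if a: "a > 0" for a x
    by (rule LIMSEQ_le[OF tendsto_mult[OF tendsto_const conv] conv])
       (use f a in \<open>auto simp: super_gaussian_def\<close>)
  moreover have "0 \<le> g \<xi> \<and> g \<xi> \<le> B" for \<xi>
    using LIMSEQ_le_const[OF lim, of 0 \<xi>] LIMSEQ_le_const2[OF lim, of \<xi> B] nn B by auto
  ultimately show ?thesis unfolding super_gaussian_def using gm by blast
qed

text \<open>The Laplace transform of the density \<kappa>, evaluated at |\<xi>|^2.\<close>

definition gauss_laplace :: "(real \<Rightarrow> real) \<Rightarrow> 'a::euclidean_space \<Rightarrow> real" where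
  "gauss_laplace \<kappa> \<xi> = (LINT s|lborel. \<kappa> s * gauss s \<xi>)"

context
  fixes \<kappa> :: "real \<Rightarrow> real"
  assumes \<kappa>: "integrable lborel \<kappa>" and \<kappa>_nonneg: "\<And>s. 0 \<le> \<kappa> s" and \<kappa>_neg: "\<And>s. s < 0 \<Longrightarrow> \<kappa> s = 0"
begin

lemma \<kappa>_meas: "\<kappa> \<in> borel_measurable borel"
  using \<kappa> by auto

lemma \<kappa>_gauss_le: "\<kappa> s * gauss s \<xi> \<le> \<kappa> s"
  using \<kappa>_nonneg[of s] \<kappa>_neg[of s] gauss_le_1[of s \<xi>] by (cases "s < 0") (auto intro: mult_left_le)

lemma integrable_\<kappa>_gauss: "integrable lborel (\<lambda>s. \<kappa> s * gauss s \<xi>)"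
proof -
  note [measurable] = \<kappa>_meas
  show ?thesis
    by (rule Bochner_Integration.integrable_bound[OF \<kappa>]) (auto simp: abs_mult \<kappa>_nonneg \<kappa>_gauss_le)
qed

lemma gauss_laplace_meas: "gauss_laplace \<kappa> \<in> borel_measurable borel"
proof -
  note [measurable] = \<kappa>_meas
  show ?thesis unfolding gauss_laplace_def by measurable
qed

lemma gauss_laplace_bounds: "0 \<le> gauss_laplace \<kappa> \<xi>" "gauss_laplace \<kappa> \<xi> \<le> (LINT s|lborel. \<kappa> s)"
  unfolding gauss_laplace_def
  by (auto intro!: Bochner_Integration.integral_nonneg mult_nonneg_nonneg \<kappa>_nonneg integral_mono integrable_\<kappa>_gauss \<kappa> \<kappa>_gauss_le)

text \<open>A factor \<open>gauss s\<close> with s \<ge> 0 replaces a by a + s. The bound for a + s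
  involves the flatter Gaussian \<open>gauss (1 / (4 * (a + s)))\<close>, which lies above the one
  for a, so the inequality survives and can be averaged over s.\<close>

lemma super_gaussian_mult_laplace:
  assumes f: "super_gaussian f"
  shows "super_gaussian (\<lambda>\<xi>. gauss_laplace \<kappa> \<xi> * f \<xi>)"
proof -
  note [measurable] = \<kappa>_meas gauss_laplace_meas
  obtain B where B: "\<And>\<xi>. 0 \<le> f \<xi> \<and> f \<xi> \<le> B"
    using f unfolding super_gaussian_def by metis
  have [measurable]: "f \<in> borel_measurable borel" using f by (auto simp: super_gaussian_def)
  let ?G = "\<lambda>a x. inv_fourier (\<lambda>\<xi>. f \<xi> * gauss a \<xi>) x"
  have B0: "0 \<le> B" using B[of 0] by auto
  have int: "integrable lborel (\<lambda>\<xi>. f \<xi> * gauss a \<xi>)" if "a > 0" for a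
    by (rule integrable_mult_gauss[of _ B]) (use B that in auto)
  have G0: "\<bar>?G a x\<bar> \<le> ?G a 0" if "a > 0" for a x
    by (rule inv_fourier_le_0[OF int[OF that]]) (use B in auto)
  have G0': "0 \<le> ?G a 0" for a
    unfolding inv_fourier_def using B by (intro divide_nonneg_nonneg Bochner_Integration.integral_nonneg) auto
  have Gmono: "?G (a + s) 0 \<le> ?G a 0" if "a > 0" "s \<ge> 0" for a s
    unfolding inv_fourier_def using that B
    by (intro divide_right_mono integral_mono integrable_cos_mult int) (auto intro!: mult_left_mono gauss_antimono)
  have rep: "inv_fourier (\<lambda>\<xi>. (gauss_laplace \<kappa> \<xi> * f \<xi>) * gauss a \<xi>) x = (LINT s|lborel. \<kappa> s * ?G (a + s) x)" if a: "a > 0" for a x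
  proof -
    let ?F = "\<lambda>\<xi> s. cos (x \<bullet> \<xi>) * (f \<xi> * gauss a \<xi>) * (\<kappa> s * gauss s \<xi>)"
    have "inv_fourier (\<lambda>\<xi>. (gauss_laplace \<kappa> \<xi> * f \<xi>) * gauss a \<xi>) x = (LINT \<xi>|lborel. (LINT s|lborel. ?F \<xi> s)) / (2 * pi) ^ DIM('a)"
      unfolding inv_fourier_def gauss_laplace_def by (simp add: ac_simps flip: integral_mult_right_zero)
    also have "(LINT \<xi>|lborel. (LINT s|lborel. ?F \<xi> s)) = (LINT s|lborel. (LINT \<xi>|lborel. ?F \<xi> s))"
    proof (rule lborel_integral_swap_bound[OF int[OF a] \<kappa>])
      show "\<bar>?F \<xi> s\<bar> \<le> \<bar>f \<xi> * gauss a \<xi>\<bar> * \<bar>\<kappa> s\<bar>" for \<xi> s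
      proof -
        have "\<bar>cos (x \<bullet> \<xi>)\<bar> * (f \<xi> * gauss a \<xi>) \<le> 1 * (f \<xi> * gauss a \<xi>)"
          using B by (intro mult_right_mono) auto
        then have c1: "\<bar>cos (x \<bullet> \<xi>)\<bar> * (f \<xi> * gauss a \<xi>) \<le> f \<xi> * gauss a \<xi>" by simp
        have "\<bar>cos (x \<bullet> \<xi>)\<bar> * (f \<xi> * gauss a \<xi>) * (\<kappa> s * gauss s \<xi>) \<le> (f \<xi> * gauss a \<xi>) * \<kappa> s"
          by (rule mult_mono[OF c1 \<kappa>_gauss_le]) (use B \<kappa>_nonneg in \<open>auto intro!: mult_nonneg_nonneg\<close>)
        then show ?thesis using B \<kappa>_nonneg by (simp add: abs_mult)
      qed
    qed measurable
    also have "\<dots> = (LINT s|lborel. \<kappa> s * (LINT \<xi>|lborel. cos (x \<bullet> \<xi>) * (f \<xi> * gauss (a + s) \<xi>)))"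
      by (simp add: gauss_add ac_simps flip: integral_mult_right_zero)
    finally show ?thesis by (simp add: inv_fourier_def)
  qed
  have integ: "integrable lborel (\<lambda>s. \<kappa> s * ?G (a + s) x)" if a: "a > 0" for a x
  proof (rule Bochner_Integration.integrable_bound[OF integrable_mult_left[OF \<kappa>]])
    show "AE s in lborel. norm (\<kappa> s * ?G (a + s) x) \<le> norm (\<kappa> s * ?G a 0)"
    proof (rule AE_I2)
      fix s
      show "norm (\<kappa> s * ?G (a + s) x) \<le> norm (\<kappa> s * ?G a 0)"
      proof (cases "s < 0")
        case False
        then have "\<bar>?G (a + s) x\<bar> \<le> ?G a 0"
          using a G0[of "a + s" x] Gmono[of a s] by auto
        then show ?thesis using \<kappa>_nonneg[of s] G0'[of a] by (simp add: abs_mult mult_left_mono)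
      qed (simp add: \<kappa>_neg)
    qed
    have "(\<lambda>s. \<kappa> s * ((LINT \<eta>|lborel. cos (x \<bullet> \<eta>) * (f \<eta> * gauss (a + s) \<eta>)) / (2 * pi) ^ DIM('a))) \<in> borel_measurable lborel"
      by measurable
    then show "(\<lambda>s. \<kappa> s * ?G (a + s) x) \<in> borel_measurable lborel" by (simp add: inv_fourier_def)
  qed
  have main: "gauss (1 / (4 * a)) x * inv_fourier (\<lambda>\<xi>. (gauss_laplace \<kappa> \<xi> * f \<xi>) * gauss a \<xi>) 0
     \<le> inv_fourier (\<lambda>\<xi>. (gauss_laplace \<kappa> \<xi> * f \<xi>) * gauss a \<xi>) x" if a: "a > 0" for a x
    unfolding rep[OF a] integral_mult_right_zero[symmetric]
  proof (rule integral_mono)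
    fix s
    show "gauss (1 / (4 * a)) x * (\<kappa> s * ?G (a + s) 0) \<le> \<kappa> s * ?G (a + s) x"
    proof (cases "s < 0")
      case False
      have "gauss (1 / (4 * a)) x * ?G (a + s) 0 \<le> gauss (1 / (4 * (a + s))) x * ?G (a + s) 0"
        using False a G0' by (intro mult_right_mono gauss_antimono) (auto simp: field_simps)
      also have "\<dots> \<le> ?G (a + s) x"
        using f False a unfolding super_gaussian_def by (metis add_pos_nonneg not_less)
      finally show ?thesis using \<kappa>_nonneg[of s] by (metis mult.left_commute mult_left_mono)
    qed (simp add: \<kappa>_neg)
  qed (use integ[OF a] in auto)
  have "0 \<le> gauss_laplace \<kappa> \<xi> * f \<xi> \<and> gauss_laplace \<kappa> \<xi> * f \<xi> \<le> (LINT s|lborel. \<kappa> s) * B" for \<xi>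
    using B[of \<xi>] gauss_laplace_bounds[of \<xi>] B0 by (auto intro!: mult_mono mult_nonneg_nonneg)
  with main show ?thesis unfolding super_gaussian_def by (auto intro!: exI[of _ "(LINT s|lborel. \<kappa> s) * B"])
qed

lemma super_gaussian_laplace_power: "super_gaussian (\<lambda>\<xi>. gauss_laplace \<kappa> \<xi> ^ n)"
  by (induction n) (auto intro: super_gaussian_1 super_gaussian_mult_laplace)

text \<open>The exponential series has nonnegative coefficients, so its partial sums stay in the
  class, and they increase to a bounded limit.\<close>

lemma super_gaussian_exp_laplace: "super_gaussian (\<lambda>\<xi>. exp (gauss_laplace \<kappa> \<xi>))"
proof (rule super_gaussian_limit)
  let ?f = "\<lambda>n \<xi>. \<Sum>k<n. (1 / fact k) * gauss_laplace \<kappa> \<xi> ^ k"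
  show "super_gaussian (?f n)" for n
    by (intro super_gaussian_sum super_gaussian_cmult super_gaussian_laplace_power) auto
  show lim: "(\<lambda>n. ?f n \<xi>) \<longlonglongrightarrow> exp (gauss_laplace \<kappa> \<xi>)" for \<xi>
    using exp_converges[of "gauss_laplace \<kappa> \<xi>"] by (simp add: sums_def field_simps)
  show "?f n \<xi> \<le> exp (LINT s|lborel. \<kappa> s)" for n \<xi>
  proof -
    have "incseq (\<lambda>n. ?f n \<xi>)"
      by (rule incseq_SucI) (simp add: gauss_laplace_bounds)
    from incseq_le[OF this lim] have "?f n \<xi> \<le> exp (gauss_laplace \<kappa> \<xi>)" .
    also have "\<dots> \<le> exp (LINT s|lborel. \<kappa> s)" by (simp add: gauss_laplace_bounds)
    finally show ?thesis .
  qed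
qed

text \<open>The Laplace exponent of a compound Poisson subordinator with jump density \<kappa>,
  taken at |\<xi>|^2. Finite mass of \<kappa> allows the exponent to be split into a constant and a
  Laplace transform.\<close>

lemma super_gaussian_compound_poisson: "super_gaussian (\<lambda>\<xi>. exp (- (LINT s|lborel. \<kappa> s * (1 - gauss s \<xi>))))"
proof -
  have "(LINT s|lborel. \<kappa> s * (1 - gauss s \<xi>)) = (LINT s|lborel. \<kappa> s) - gauss_laplace \<kappa> \<xi>" for \<xi> :: 'a
    by (simp add: right_diff_distrib gauss_laplace_def integrable_\<kappa>_gauss \<kappa>)
  then show ?thesis
    using super_gaussian_cmult[OF super_gaussian_exp_laplace, of "exp (- (LINT s|lborel. \<kappa> s))"]
    by (simp add: exp_add[symmetric])
qed

end

section \<open>The Levy measure of the stable subordinator\<close>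

lemma integrable_powr_near_0:
  assumes "a > (-1::real)"
  shows "integrable lborel (\<lambda>s::real. indicator {0..1} s * s powr a)"
proof (rule integrableI_nn_integral_finite)
  show "(\<integral>\<^sup>+s. ennreal (indicator {0..1} s * s powr a) \<partial>lborel) = ennreal (1 powr (a + 1) / (a + 1))"
    by (rule nn_integral_has_integral_lebesgue[OF _ has_integral_powr_from_0[OF assms]]) auto
qed auto

lemma integrable_powr_at_top:
  assumes "e < (-1::real)" "a > 0"
  shows "integrable lborel (\<lambda>s::real. indicator {a..} s * s powr e)"
proof (rule integrableI_nn_integral_finite)
  show "(\<integral>\<^sup>+s. ennreal (indicator {a..} s * s powr e) \<partial>lborel) = ennreal (- (a powr (e + 1)) / (e + 1))"
    by (rule nn_integral_has_integral_lebesgue[OF _ has_integral_powr_to_inf[OF assms]]) auto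
qed auto

text \<open>Up to a constant, the Laplace exponent of the \<sigma>-stable subordinator. Its Levy
  density s^(-1-\<sigma>) has infinite mass at 0, hence is not a compound Poisson density
  itself.\<close>

definition levy_integral :: "real \<Rightarrow> real \<Rightarrow> real" where
  "levy_integral \<sigma> r = (LINT s|lborel. indicator {0<..} s * (s powr (-1 - \<sigma>) * (1 - exp (- (s * r)))))"

text \<open>Near 0 the integrand is at most r s^(-\<sigma>), integrable because \<sigma> < 1; at
  infinity it is at most s^(-1-\<sigma>), integrable because \<sigma> > 0.\<close>

lemma integrable_levy:
  fixes \<sigma> r :: real
  assumes \<sigma>: "0 < \<sigma>" "\<sigma> < 1" and r: "r \<ge> 0"
  shows "integrable lborel (\<lambda>s. indicator {0<..} s * (s powr (-1 - \<sigma>) * (1 - exp (- (s * r)))))"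
proof (rule Bochner_Integration.integrable_bound)
  show "integrable lborel (\<lambda>s::real. r * (indicator {0..1} s * s powr (- \<sigma>)) + indicator {1..} s * s powr (-1 - \<sigma>))"
    using \<sigma> by (intro Bochner_Integration.integrable_add integrable_mult_right integrable_powr_near_0 integrable_powr_at_top) auto
  show "AE s in lborel. norm (indicator {0<..} s * (s powr (-1 - \<sigma>) * (1 - exp (- (s * r)))))
     \<le> norm (r * (indicator {0..1} s * s powr (- \<sigma>)) + indicator {1..} s * s powr (-1 - \<sigma>))"
  proof (rule AE_I2)
    fix s :: real
    consider "s \<le> 0" | "0 < s" "s \<le> 1" | "1 < s" by linarith
    then show "norm (indicator {0<..} s * (s powr (-1 - \<sigma>) * (1 - exp (- (s * r)))))
     \<le> norm (r * (indicator {0..1} s * s powr (- \<sigma>)) + indicator {1..} s * s powr (-1 - \<sigma>))"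
    proof cases
      case 2
      have "1 - exp (- (s * r)) \<le> s * r" using exp_ge_add_one_self[of "- (s * r)"] by simp
      then have "s powr (-1 - \<sigma>) * (1 - exp (- (s * r))) \<le> s powr (-1 - \<sigma>) * (s * r)"
        by (intro mult_left_mono) auto
      also have "\<dots> = r * s powr (- \<sigma>)"
        using 2 powr_add[of s "-1 - \<sigma>" 1] by simp
      also have "\<dots> \<le> r * s powr (- \<sigma>) + indicator {1..} s * s powr (-1 - \<sigma>)" by simp
      finally show ?thesis using 2 r by (simp add: abs_of_nonneg)
    next
      case 3
      have "s powr (-1 - \<sigma>) * (1 - exp (- (s * r))) \<le> s powr (-1 - \<sigma>) * 1"
        by (intro mult_left_mono) auto
      then show ?thesis using 3 r by (simp add: abs_of_nonneg)
    qed simp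
  qed
qed measurable

text \<open>Replacing s by s / r pulls out the power r^\<sigma>. The value at 1 serves as a
  normalising constant of which only the positivity enters.\<close>

lemma levy_integral_scaling:
  assumes r: "r \<ge> 0"
  shows "levy_integral \<sigma> r = r powr \<sigma> * levy_integral \<sigma> 1"
proof (cases "r = 0")
  case False
  with r have r: "r > 0" by simp
  have "levy_integral \<sigma> r = (1 / r) * (LINT s|lborel. indicator {0<..} (s / r) * ((s / r) powr (-1 - \<sigma>) * (1 - exp (- s))))"
    unfolding levy_integral_def using r by (subst lborel_integral_real_affine[of "1 / r" _ 0]) auto
  also have "(LINT s|lborel. indicator {0<..} (s / r) * ((s / r) powr (-1 - \<sigma>) * (1 - exp (- s))))
     = (LINT s|lborel. r powr (1 + \<sigma>) * (indicator {0<..} s * (s powr (-1 - \<sigma>) * (1 - exp (- (s * 1))))))"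
  proof (rule Bochner_Integration.integral_cong[OF refl])
    fix s :: real
    have "(s / r) powr (-1 - \<sigma>) = s powr (-1 - \<sigma>) * r powr (1 + \<sigma>)" if "s > 0"
      using that r powr_minus_divide[of r "1 + \<sigma>"] by (simp add: powr_divide)
    then show "indicator {0<..} (s / r) * ((s / r) powr (-1 - \<sigma>) * (1 - exp (- s))) = r powr (1 + \<sigma>) * (indicator {0<..} s * (s powr (-1 - \<sigma>) * (1 - exp (- (s * 1)))))"
      using r by (auto simp: indicator_def zero_less_divide_iff)
  qed
  also have "(1 / r) * \<dots> = r powr \<sigma> * levy_integral \<sigma> 1"
    using r by (simp add: levy_integral_def powr_add)
  finally show ?thesis .
qed (simp add: levy_integral_def)

lemma levy_integral_pos:
  assumes \<sigma>: "0 < \<sigma>" "\<sigma> < 1"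
  shows "levy_integral \<sigma> 1 > 0"
proof -
  let ?f = "\<lambda>s::real. indicator {0<..} s * (s powr (-1 - \<sigma>) * (1 - exp (- (s * 1))))"
  have int: "integrable lborel ?f" by (rule integrable_levy) (use \<sigma> in auto)
  have nn: "0 \<le> ?f s" for s by (auto simp: indicator_def)
  have "levy_integral \<sigma> 1 \<noteq> 0"
  proof
    assume "levy_integral \<sigma> 1 = 0"
    then have "AE s in lborel. ?f s = 0"
      using integral_nonneg_eq_0_iff_AE[OF int] nn by (simp add: levy_integral_def)
    then have "AE s in lborel. s \<notin> {0<..<1::real}"
      by eventually_elim (auto simp: indicator_def)
    then have "emeasure lborel {s. \<not> s \<notin> {0<..<1::real}} = 0"
      by (subst (asm) AE_iff_measurable[OF _ refl]) auto
    then have "emeasure lborel {0<..<1::real} = 0" by (simp only: not_not Collect_mem_eq)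
    then show False by simp
  qed
  moreover have "levy_integral \<sigma> 1 \<ge> 0"
    unfolding levy_integral_def by (rule Bochner_Integration.integral_nonneg) (rule nn)
  ultimately show ?thesis by simp
qed

text \<open>Cutting the Levy density off below 1 / (n + 1) leaves a finite jump measure, hence a
  compound Poisson symbol. The exponents converge by domination, and dividing by
  \<open>levy_integral \<sigma> 1\<close> makes the limit exactly t |\<xi>|^(2\<sigma>).\<close>

lemma super_gaussian_stable_symbol:
  assumes \<sigma>: "0 < \<sigma>" "\<sigma> < 1" and t: "t \<ge> 0"
  shows "super_gaussian (stable_symbol \<sigma> t)"
proof -
  let ?c = "t / levy_integral \<sigma> 1"
  let ?\<kappa> = "\<lambda>n s. ?c * (indicator {inverse (real (Suc n))..} s * s powr (-1 - \<sigma>))"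
  have c: "?c \<ge> 0" using levy_integral_pos[OF \<sigma>] t by simp
  have \<kappa>i: "integrable lborel (?\<kappa> n)" for n
    using \<sigma> by (intro integrable_mult_right integrable_powr_at_top) auto
  have \<kappa>n: "0 \<le> ?\<kappa> n s" for n s by (rule mult_nonneg_nonneg[OF c]) simp
  have \<kappa>0: "?\<kappa> n s = 0" if "s < 0" for n s
  proof -
    have "s < inverse (real (Suc n))" using that by (meson less_trans inverse_positive_iff_positive of_nat_0_less_iff zero_less_Suc)
    then show ?thesis by simp
  qed
  let ?f = "\<lambda>n \<xi>. exp (- (LINT s|lborel. ?\<kappa> n s * (1 - gauss s \<xi>)))"
  have nn: "0 \<le> ?\<kappa> n s * (1 - gauss s \<xi>)" for n s and \<xi> :: 'a
  proof (cases "s < 0")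
    case True
    show ?thesis by (simp only: \<kappa>0[OF True] mult_zero_left)
  next
    case False
    then show ?thesis by (intro mult_nonneg_nonneg[OF \<kappa>n]) (simp add: gauss_le_1)
  qed
  show ?thesis
  proof (rule super_gaussian_limit[where f = ?f and B = 1])
    show "super_gaussian (?f n)" for n
      by (rule super_gaussian_compound_poisson[OF \<kappa>i \<kappa>n \<kappa>0])
    show "?f n \<xi> \<le> 1" for n and \<xi> :: 'a
      unfolding exp_le_one_iff neg_le_0_iff_le by (rule Bochner_Integration.integral_nonneg) (rule nn)
    fix \<xi> :: 'a
    let ?r = "(norm \<xi>)\<^sup>2"
    have "(\<lambda>n. LINT s|lborel. ?\<kappa> n s * (1 - gauss s \<xi>)) \<longlonglongrightarrow> (LINT s|lborel. ?c * (indicator {0<..} s * (s powr (-1 - \<sigma>) * (1 - exp (- (s * ?r))))))"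
    proof (rule integral_dominated_convergence)
      show "integrable lborel (\<lambda>s. ?c * (indicator {0<..} s * (s powr (-1 - \<sigma>) * (1 - exp (- (s * ?r))))))"
        by (intro integrable_mult_right integrable_levy \<sigma>) simp
      show "AE s in lborel. (\<lambda>n. ?\<kappa> n s * (1 - gauss s \<xi>)) \<longlonglongrightarrow> ?c * (indicator {0<..} s * (s powr (-1 - \<sigma>) * (1 - exp (- (s * ?r)))))"
      proof (rule AE_I2)
        fix s :: real
        show "(\<lambda>n. ?\<kappa> n s * (1 - gauss s \<xi>)) \<longlonglongrightarrow> ?c * (indicator {0<..} s * (s powr (-1 - \<sigma>) * (1 - exp (- (s * ?r)))))"
        proof (cases "s > 0")
          case True
          then have "eventually (\<lambda>n. inverse (real (Suc n)) < s) sequentially"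
            using LIMSEQ_inverse_real_of_nat by (auto dest: order_tendstoD)
          then show ?thesis
            by (intro tendsto_eventually, eventually_elim) (simp add: gauss_def True)
        next
          case False
          have "s < inverse (real (Suc n))" for n
            using False by (meson not_less le_less_trans inverse_positive_iff_positive of_nat_0_less_iff zero_less_Suc)
          then show ?thesis using False by (simp add: not_le)
        qed
      qed
      show "AE s in lborel. norm (?\<kappa> n s * (1 - gauss s \<xi>)) \<le> ?c * (indicator {0<..} s * (s powr (-1 - \<sigma>) * (1 - exp (- (s * ?r)))))" for n
      proof (rule AE_I2)
        fix s :: real
        show "norm (?\<kappa> n s * (1 - gauss s \<xi>)) \<le> ?c * (indicator {0<..} s * (s powr (-1 - \<sigma>) * (1 - exp (- (s * ?r)))))"
        proof (cases "inverse (real (Suc n)) \<le> s")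
          case True
          then have "s > 0" by (meson less_le_trans inverse_positive_iff_positive of_nat_0_less_iff zero_less_Suc)
          then show ?thesis
            unfolding real_norm_def abs_of_nonneg[OF nn] using True by (simp add: gauss_def mult.assoc)
        next
          case False
          have "0 \<le> ?c * (indicator {0<..} s * (s powr (-1 - \<sigma>) * (1 - exp (- (s * ?r)))))"
            by (intro mult_nonneg_nonneg[OF c]; cases "0 < s") auto
          then show ?thesis using False by simp
        qed
      qed
    qed measurable
    moreover have "(LINT s|lborel. ?c * (indicator {0<..} s * (s powr (-1 - \<sigma>) * (1 - exp (- (s * ?r)))))) = t * norm \<xi> powr (2 * \<sigma>)"
    proof -
      have "(LINT s|lborel. ?c * (indicator {0<..} s * (s powr (-1 - \<sigma>) * (1 - exp (- (s * ?r)))))) = ?c * levy_integral \<sigma> ?r"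
        by (simp add: levy_integral_def)
      also have "\<dots> = t * ?r powr \<sigma>"
        using levy_integral_pos[OF \<sigma>] by (subst levy_integral_scaling) auto
      also have "?r powr \<sigma> = norm \<xi> powr (2 * \<sigma>)" unfolding powr_powr[symmetric] by simp
      finally show ?thesis .
    qed
    ultimately show "(\<lambda>n. ?f n \<xi>) \<longlonglongrightarrow> stable_symbol \<sigma> t \<xi>"
      by (auto simp: stable_symbol_def intro!: tendsto_intros)
  qed
qed

section \<open>The heat kernel of the mixed operator\<close>

text \<open>The value 0 at times t \<le> 0 makes the kernel measurable, nonnegative and symmetric
  without a sign condition on t.\<close>

definition mixed_kernel :: "real \<Rightarrow> real \<Rightarrow> 'a::euclidean_space \<Rightarrow> real" where
  "mixed_kernel \<sigma> t x = (if 0 < t then inv_fourier (\<lambda>\<xi>. stable_symbol \<sigma> t \<xi> * gauss t \<xi>) x else 0)"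

text \<open>The value at 0 of the kernel convolved with \<open>gauss b\<close>, see
  \<open>kernel_gauss_eq_conv\<close>, written through the symbol so that it can be rescaled. The
  type argument carries the dimension.\<close>

definition kernel_gauss :: "'a::euclidean_space itself \<Rightarrow> real \<Rightarrow> real \<Rightarrow> real \<Rightarrow> real" where
  "kernel_gauss _ \<sigma> t b = sqrt (pi / b) ^ DIM('a) * inv_fourier (\<lambda>\<eta>::'a. stable_symbol \<sigma> t \<eta> * gauss (t + 1 / (4 * b)) \<eta>) 0"

locale mixed_order =
  fixes \<sigma> :: real
  assumes \<sigma>: "0 < \<sigma>" "\<sigma> < 1"
begin

lemma integrable_stable_gauss:
  "0 \<le> t \<Longrightarrow> 0 < a \<Longrightarrow> integrable lborel (\<lambda>\<xi>::'a::euclidean_space. stable_symbol \<sigma> t \<xi> * gauss a \<xi>)"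
  by (rule integrable_mult_gauss[of _ 1]) (auto simp: stable_symbol_le_1)

lemma stable_gauss_lower:
  fixes x :: "'a::euclidean_space"
  assumes "0 \<le> t" "0 < a"
  shows "gauss (1 / (4 * a)) x * inv_fourier (\<lambda>\<xi>. stable_symbol \<sigma> t \<xi> * gauss a \<xi>) (0::'a)
     \<le> inv_fourier (\<lambda>\<xi>. stable_symbol \<sigma> t \<xi> * gauss a \<xi>) x"
  by (rule super_gaussianD[OF super_gaussian_stable_symbol[OF \<sigma> assms(1)] assms(2)])

lemma stable_symbol_0: "stable_symbol \<sigma> t 0 = 1"
  using \<sigma> by (simp add: stable_symbol_def)

lemma positive_stable_gauss:
  assumes "0 \<le> t" "0 < a"
  shows "positive_inv_fourier (\<lambda>\<xi>::'a::euclidean_space. stable_symbol \<sigma> t \<xi> * gauss a \<xi>) 1"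
proof
  show "continuous_on UNIV (\<lambda>\<xi>::'a. stable_symbol \<sigma> t \<xi> * gauss a \<xi>)"
    using \<sigma> by (intro continuous_intros)
  show "integrable lborel (\<lambda>\<xi>::'a. stable_symbol \<sigma> t \<xi> * gauss a \<xi>)"
    by (rule integrable_stable_gauss[OF assms])
  show "\<bar>stable_symbol \<sigma> t \<xi> * gauss a \<xi>\<bar> \<le> 1" for \<xi> :: 'a
    using assms mult_mono[OF stable_symbol_le_1[of t \<sigma> \<xi>] gauss_le_1[of a \<xi>]] by (auto simp: abs_mult)
  show "0 \<le> inv_fourier (\<lambda>\<xi>. stable_symbol \<sigma> t \<xi> * gauss a \<xi>) x" for x :: 'a
    by (rule order_trans[OF _ stable_gauss_lower[OF assms]])
       (intro mult_nonneg_nonneg inv_fourier_0_nonneg, auto)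
qed simp

lemma borel_measurable_mixed_kernel [measurable]:
  assumes [measurable]: "f \<in> borel_measurable M" "g \<in> borel_measurable M"
  shows "(\<lambda>z. mixed_kernel \<sigma> (f z) (g z)) \<in> borel_measurable M"
  unfolding mixed_kernel_def inv_fourier_def by measurable

lemma mixed_kernel_nonneg [simp]: "0 \<le> mixed_kernel \<sigma> t x"
  unfolding mixed_kernel_def using positive_inv_fourier.pos[OF positive_stable_gauss[of t t]] by auto

lemma mixed_kernel_minus [simp]: "mixed_kernel \<sigma> t (- x) = mixed_kernel \<sigma> t x"
  by (simp add: mixed_kernel_def)

lemma integrable_mixed_kernel: "integrable lborel (mixed_kernel \<sigma> t :: 'a::euclidean_space \<Rightarrow> real)"
proof (cases "0 < t")
  case True
  then show ?thesis
    unfolding mixed_kernel_def[abs_def]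
    using positive_inv_fourier.inv_fourier_integrable[OF positive_stable_gauss[of t t]] by simp
next
  case False
  then show ?thesis by (simp add: mixed_kernel_def[abs_def])
qed

lemma mixed_kernel_mass: "0 < t \<Longrightarrow> (LINT x|lborel. mixed_kernel \<sigma> t (x::'a::euclidean_space)) = 1"
  using positive_inv_fourier.fourier_inv_fourier[OF positive_stable_gauss[of t t], of 0]
  by (simp add: mixed_kernel_def stable_symbol_0)

lemma nn_integral_mixed_kernel:
  "(\<integral>\<^sup>+x. ennreal (mixed_kernel \<sigma> t (x::'a::euclidean_space)) \<partial>lborel) = (if 0 < t then 1 else 0)"
proof (cases "0 < t")
  case True
  then show ?thesis
    by (subst nn_integral_eq_integral[OF integrable_mixed_kernel]) (simp_all add: mixed_kernel_mass)
qed (simp add: mixed_kernel_def)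

lemma mixed_kernel_convolution:
  assumes "0 < s" "0 < t"
  shows "(LINT y|lborel. mixed_kernel \<sigma> s y * mixed_kernel \<sigma> t (x - y)) = mixed_kernel \<sigma> (s + t) x"
proof -
  have "inv_fourier (\<lambda>\<eta>. stable_symbol \<sigma> s \<eta> * gauss s \<eta> * (stable_symbol \<sigma> t \<eta> * gauss t \<eta>)) x = mixed_kernel \<sigma> (s + t) x"
    unfolding mixed_kernel_def stable_symbol_add gauss_add using assms by (simp add: mult.assoc mult.left_commute)
  then show ?thesis
    using positive_inv_fourier.inv_fourier_convolution[OF positive_stable_gauss[of s s] integrable_stable_gauss[of t t], of x] assms
    by (simp add: mixed_kernel_def)
qed

lemma frac_heat_kernel_eq: "0 < t \<Longrightarrow> frac_heat_kernel \<sigma> t = inv_fourier (stable_symbol \<sigma> t)"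
proof
  fix x :: 'a
  assume t: "0 < t"
  have I: "integrable lborel (stable_symbol \<sigma> t :: 'a \<Rightarrow> real)" using integrable_stable_symbol[OF t \<sigma>(1)] .
  have "integrable lborel (\<lambda>\<xi>. cis (x \<bullet> \<xi>) * of_real (stable_symbol \<sigma> t \<xi>))"
    by (rule Bochner_Integration.integrable_bound[OF I]) (auto simp: norm_mult)
  from integral_Re[OF this]
  show "frac_heat_kernel \<sigma> t x = inv_fourier (stable_symbol \<sigma> t) x"
    unfolding frac_heat_kernel_def inv_fourier_def stable_symbol_def by simp
qed

text \<open>The Gaussian weight is, up to normalisation, the transform of \<open>gauss t\<close>,
  which is positive, so the convolution theorem applies with the stable symbol as the second
  factor.\<close>

lemma mixed_heat_kernel_eq:
  fixes x :: "'a::euclidean_space"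
  assumes t: "0 < t"
  shows "mixed_heat_kernel \<sigma> t x = mixed_kernel \<sigma> t x"
proof -
  let ?s = "sqrt (4 * pi * t)"
  have s: "?s > 0" using t by simp
  have I: "integrable lborel (stable_symbol \<sigma> t :: 'a \<Rightarrow> real)" using integrable_stable_symbol[OF t \<sigma>(1)] .
  have [measurable]: "inv_fourier (stable_symbol \<sigma> t :: 'a \<Rightarrow> real) \<in> borel_measurable borel"
    by measurable
  have "(4 * pi * t) powr (- (real DIM('a) / 2)) = inverse ((4 * pi * t) powr (1 / 2 * real DIM('a)))"
    by (simp add: powr_minus)
  also have "(4 * pi * t) powr (1 / 2 * real DIM('a)) = ?s ^ DIM('a)"
    using t unfolding powr_powr[symmetric] by (subst powr_realpow) (auto simp: powr_half_sqrt)
  finally have c: "(4 * pi * t) powr (- (real DIM('a) / 2)) = 1 / ?s ^ DIM('a)" by (simp only: inverse_eq_divide)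
  have "(LINT \<xi>|lborel. exp (- (norm (x - \<xi>))\<^sup>2 / (4 * t)) * frac_heat_kernel \<sigma> t \<xi>)
      = (LINT \<xi>|lborel. gauss (1 / (4 * t)) (x - \<xi>) * inv_fourier (stable_symbol \<sigma> t) \<xi>)"
    by (simp add: frac_heat_kernel_eq[OF t] gauss_def)
  also have "\<dots> = (LINT y|lborel. gauss (1 / (4 * t)) y * inv_fourier (stable_symbol \<sigma> t) (x - y))"
    using lborel_integral_affine[of "-1" "\<lambda>\<xi>. gauss (1 / (4 * t)) (x - \<xi>) * inv_fourier (stable_symbol \<sigma> t) \<xi>" x] by simp
  also have "\<dots> = (LINT y|lborel. ?s ^ DIM('a) * (inv_fourier (gauss t) y * inv_fourier (stable_symbol \<sigma> t) (x - y)))"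
    by (rule Bochner_Integration.integral_cong) (use s in \<open>auto simp: inv_fourier_gauss[OF t]\<close>)
  also have "\<dots> = ?s ^ DIM('a) * inv_fourier (\<lambda>\<eta>. gauss t \<eta> * stable_symbol \<sigma> t \<eta>) x"
    using positive_inv_fourier.inv_fourier_convolution[OF positive_inv_fourier_gauss[OF t] I] by simp
  finally show ?thesis
    unfolding mixed_heat_kernel_def c using s t by (simp add: mixed_kernel_def mult.commute)
qed

section \<open>Pointwise bounds for the kernel\<close>

lemma mixed_kernel_le_0: "mixed_kernel \<sigma> t (x::'a) \<le> mixed_kernel \<sigma> t (0::'a::euclidean_space)"
proof (cases "0 < t")
  case True
  then show ?thesis
    using abs_le_D1[OF inv_fourier_le_0[OF integrable_stable_gauss[of t t], of x]] by (simp add: mixed_kernel_def)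
qed (simp add: mixed_kernel_def)

lemma mixed_kernel_ge_gauss: "0 < t \<Longrightarrow> gauss (1 / (4 * t)) (x::'a) * mixed_kernel \<sigma> t (0::'a::euclidean_space) \<le> mixed_kernel \<sigma> t x"
  using stable_gauss_lower[of t t x] by (simp add: mixed_kernel_def)

lemma stable_scale:
  assumes "t > 0"
  shows "stable_symbol \<sigma> t (t powr (- (1 / (2 * \<sigma>))) *\<^sub>R \<xi>) = stable_symbol \<sigma> 1 \<xi>"
proof -
  have "(t powr (- (1 / (2 * \<sigma>)))) powr (2 * \<sigma>) = inverse t"
    using \<sigma> assms using powr_minus[of t 1] by (simp add: powr_powr)
  then show ?thesis using assms by (simp add: stable_symbol_scaleR)
qed

lemma powr_dim:
  assumes "t > 0"
  shows "(t powr (- (1 / (2 * \<sigma>)))) ^ DIM('a::euclidean_space) = t powr (- (real DIM('a) / (2 * \<sigma>)))"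
  using assms by (simp add: powr_powr powr_realpow[symmetric])

text \<open>Discarding the Gaussian factor leaves the stable symbol, whose integral scales as
  t^(-d/(2\<sigma>)).\<close>

lemma mixed_kernel_upper:
  "\<exists>C>0. \<forall>t>0. \<forall>x::'a::euclidean_space. mixed_kernel \<sigma> t x \<le> C * t powr (- (real DIM('a) / (2 * \<sigma>)))"
proof (intro exI conjI allI impI)
  let ?C = "inv_fourier (stable_symbol \<sigma> 1) (0::'a) + 1"
  have "inv_fourier (stable_symbol \<sigma> 1) (0::'a) \<ge> 0" by (rule inv_fourier_0_nonneg) simp
  then show "?C > 0" by simp
  fix t :: real and x :: 'a
  assume t: "t > 0"
  let ?c = "t powr (- (1 / (2 * \<sigma>)))"
  have "mixed_kernel \<sigma> t x \<le> inv_fourier (\<lambda>\<xi>::'a. stable_symbol \<sigma> t \<xi> * gauss t \<xi>) 0"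
    using mixed_kernel_le_0[of t x] t by (simp add: mixed_kernel_def)
  also have "\<dots> \<le> inv_fourier (stable_symbol \<sigma> t) (0::'a)"
    using t \<sigma> by (intro inv_fourier_0_mono integrable_stable_gauss integrable_stable_symbol) (auto intro!: mult_left_le gauss_le_1)
  also have "\<dots> = ?c ^ DIM('a) * inv_fourier (stable_symbol \<sigma> 1) (0::'a)"
    using t by (subst inv_fourier_0_scale[of _ ?c]) (auto simp: stable_scale)
  also have "\<dots> \<le> ?c ^ DIM('a) * ?C" by (intro mult_left_mono) auto
  finally show "mixed_kernel \<sigma> t x \<le> ?C * t powr (- (real DIM('a) / (2 * \<sigma>)))"
    using powr_dim[OF t, where 'a='a] by (simp add: mult.commute)
qed

text \<open>After rescaling by t^(-1/(2\<sigma>)) the Gaussian factor has a parameter of at most 1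
  for t \<ge> 1, so the value at 0 keeps the stable decay rate. The range |x| \<le> 2 covers all
  differences of points of the unit ball.\<close>

lemma mixed_kernel_lower:
  "\<exists>c>0. \<forall>t\<ge>1. \<forall>x::'a::euclidean_space. norm x \<le> 2 \<longrightarrow> c * t powr (- (real DIM('a) / (2 * \<sigma>))) \<le> mixed_kernel \<sigma> t x"
proof (intro exI conjI allI impI)
  let ?I = "inv_fourier (\<lambda>\<xi>. stable_symbol \<sigma> 1 \<xi> * gauss 1 \<xi>) (0::'a)"
  let ?C = "exp (- 1) * ?I"
  have I: "?I > 0" by (rule inv_fourier_0_pos) (auto intro!: integrable_stable_gauss)
  then show "?C > 0" by simp
  fix t :: real and x :: 'a
  assume t: "t \<ge> 1" and x: "norm x \<le> 2"
  let ?c = "t powr (- (1 / (2 * \<sigma>)))"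
  have c1: "t * ?c\<^sup>2 \<le> 1"
  proof -
    have "t * ?c\<^sup>2 = t powr (1 + - (1 / \<sigma>))"
      unfolding powr_add using t by (simp add: power2_eq_square flip: powr_add)
    also have "\<dots> \<le> t powr 0" using t \<sigma> by (intro powr_mono) (auto simp: field_simps)
    finally show ?thesis using t by simp
  qed
  have "?c ^ DIM('a) * ?I \<le> ?c ^ DIM('a) * inv_fourier (\<lambda>\<xi>. stable_symbol \<sigma> t (?c *\<^sub>R \<xi>) * gauss t (?c *\<^sub>R \<xi>)) (0::'a)"
    using t c1
    by (intro mult_left_mono inv_fourier_0_mono)
       (auto simp: stable_scale gauss_scaleR intro!: integrable_stable_gauss mult_left_mono gauss_antimono)
  also have "\<dots> = mixed_kernel \<sigma> t (0::'a)"
    unfolding mixed_kernel_def using t by (subst (2) inv_fourier_0_scale[of _ ?c]) auto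
  finally have K0: "?I * t powr (- (real DIM('a) / (2 * \<sigma>))) \<le> mixed_kernel \<sigma> t (0::'a)"
    using powr_dim[of t, where 'a='a] t by (simp add: mult.commute)
  have "(norm x)\<^sup>2 \<le> 2\<^sup>2" using x by (intro power_mono) auto
  \<comment> \<open>For |x| \<le> 2 and t \<ge> 1 the exponent |x|^2 / (4 t) is at most 1.\<close>
  then have "exp (- 1) \<le> gauss (1 / (4 * t)) x"
    using t by (simp add: gauss_def field_simps)
  then have "exp (- 1) * (?I * t powr (- (real DIM('a) / (2 * \<sigma>)))) \<le> gauss (1 / (4 * t)) x * mixed_kernel \<sigma> t (0::'a)"
    using K0 I by (intro mult_mono) auto
  also have "\<dots> \<le> mixed_kernel \<sigma> t x" by (rule mixed_kernel_ge_gauss) (use t in auto)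
  finally show "?C * t powr (- (real DIM('a) / (2 * \<sigma>))) \<le> mixed_kernel \<sigma> t x" by (simp add: mult.assoc)
qed

section \<open>The action of the kernel on Gaussians\<close>

lemma mixed_kernel_conv_gauss:
  fixes x :: "'a::euclidean_space"
  assumes t: "0 < t" and b: "0 < b"
  shows "(LINT y|lborel. mixed_kernel \<sigma> t y * gauss b (x - y))
    = sqrt (pi / b) ^ DIM('a) * inv_fourier (\<lambda>\<eta>. stable_symbol \<sigma> t \<eta> * gauss (t + 1 / (4 * b)) \<eta>) x"
proof -
  let ?a = "1 / (4 * b)"
  let ?s = "sqrt (pi / b) ^ DIM('a)"
  have a: "?a > 0" using b by simp
  have s: "?s > 0" using b by simp
  have g: "gauss b y = ?s * inv_fourier (gauss ?a) y" for y :: 'a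
    using b s by (simp add: inv_fourier_gauss[OF a])
  have "(LINT y|lborel. mixed_kernel \<sigma> t y * gauss b (x - y)) = ?s * (LINT y|lborel. mixed_kernel \<sigma> t y * inv_fourier (gauss ?a) (x - y))"
    by (subst integral_mult_right_zero[symmetric], rule Bochner_Integration.integral_cong)
       (auto simp: g mult.left_commute)
  also have "(LINT y|lborel. mixed_kernel \<sigma> t y * inv_fourier (gauss ?a) (x - y))
     = inv_fourier (\<lambda>\<eta>. stable_symbol \<sigma> t \<eta> * gauss t \<eta> * gauss ?a \<eta>) x"
    using positive_inv_fourier.inv_fourier_convolution[OF positive_stable_gauss[of t t] gauss_fourier(1)[OF a], of x] t
    by (simp add: mixed_kernel_def)
  finally show ?thesis by (simp add: gauss_add mult.assoc)
qed

text \<open>Convolution raises the Gaussian parameter of the symbol from 1 / (4 b) to t + 1 / (4 b).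
  Relative to its value at 0, the transform then decays no faster than
  \<open>gauss b\<close>.\<close>

lemma mixed_kernel_conv_gauss_ge:
  fixes x :: "'a::euclidean_space"
  assumes t: "0 < t" and b: "0 < b"
  shows "gauss b x * kernel_gauss TYPE('a) \<sigma> t b \<le> (LINT y|lborel. mixed_kernel \<sigma> t y * gauss b (x - y))"
proof -
  let ?a = "t + 1 / (4 * b)"
  let ?I = "\<lambda>x::'a. inv_fourier (\<lambda>\<eta>. stable_symbol \<sigma> t \<eta> * gauss ?a \<eta>) x"
  have a: "?a > 0" using t b by (simp add: add_pos_pos)
  have "1 / (4 * ?a) \<le> b" using t b a by (simp add: field_simps)
  then have "gauss b x * ?I 0 \<le> gauss (1 / (4 * ?a)) x * ?I 0"
    by (intro mult_right_mono gauss_antimono inv_fourier_0_nonneg) auto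
  also have "\<dots> \<le> ?I x" by (rule stable_gauss_lower) (use t a in auto)
  finally have "gauss b x * ?I 0 * sqrt (pi / b) ^ DIM('a) \<le> ?I x * sqrt (pi / b) ^ DIM('a)"
    using b by (intro mult_right_mono) auto
  then show ?thesis unfolding mixed_kernel_conv_gauss[OF t b] kernel_gauss_def by (simp add: ac_simps)
qed

lemma kernel_gauss_eq_conv:
  assumes t: "0 < t" and b: "0 < b"
  shows "kernel_gauss TYPE('a::euclidean_space) \<sigma> t b = (LINT y::'a|lborel. mixed_kernel \<sigma> t y * gauss b y)"
  using mixed_kernel_conv_gauss[OF t b, of "0::'a"] by (simp add: kernel_gauss_def)

text \<open>Rescaling frequencies by sqrt b shows that t and b enter only through t b^\<sigma> and t
  b, the time measured in units of the stable and of the Gaussian flow at width 1 / sqrt b.\<close>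

lemma kernel_gauss_scale:
  assumes t: "0 \<le> t" and b: "0 < b"
  shows "kernel_gauss TYPE('a::euclidean_space) \<sigma> t b = sqrt pi ^ DIM('a) * inv_fourier (\<lambda>\<zeta>. stable_symbol \<sigma> (t * b powr \<sigma>) \<zeta> * gauss (t * b + 1 / 4) \<zeta>) (0::'a)"
proof -
  have 1: "(t + 1 / (4 * b)) * b = t * b + 1 / 4" using b by (simp add: field_simps)
  have 2: "sqrt b powr (2 * \<sigma>) = b powr \<sigma>" using b by (simp add: powr_half_sqrt[symmetric] powr_powr)
  have 3: "sqrt (pi / b) ^ DIM('a) * sqrt b ^ DIM('a) = sqrt pi ^ DIM('a)"
    using b by (simp add: power_mult_distrib[symmetric] real_sqrt_mult[symmetric])
  show ?thesis
    unfolding kernel_gauss_def using b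
    by (subst inv_fourier_0_scale[of _ "sqrt b"])
       (auto simp: stable_symbol_scaleR gauss_scaleR 1 2 3 mult.assoc[symmetric])
qed

text \<open>For b \<le> 1 and \<sigma> < 1 the bound on t b^\<sigma> also bounds t b. The symbol is
  smallest at the extreme values 1 and 1 + 1 / 4 = 5 / 4 of its two parameters, whence the
  constant.\<close>

lemma kernel_gauss_lower:
  "\<exists>c>0. \<forall>t b. 0 \<le> t \<longrightarrow> 0 < b \<longrightarrow> b \<le> 1 \<longrightarrow> t * b powr \<sigma> \<le> 1 \<longrightarrow> c \<le> kernel_gauss TYPE('a::euclidean_space) \<sigma> t b"
proof (intro exI conjI allI impI)
  let ?I = "inv_fourier (\<lambda>\<zeta>. stable_symbol \<sigma> 1 \<zeta> * gauss (5 / 4) \<zeta>) (0::'a)"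
  have "?I > 0" by (rule inv_fourier_0_pos) (auto intro!: integrable_stable_gauss)
  then show "sqrt pi ^ DIM('a) * ?I > 0" by simp
  fix t b :: real
  assume t: "0 \<le> t" and b: "0 < b" "b \<le> 1" and tb: "t * b powr \<sigma> \<le> 1"
  have "b powr 1 \<le> b powr \<sigma>" using b \<sigma> by (intro powr_mono') auto
  then have "t * b \<le> t * b powr \<sigma>" using t b by (intro mult_left_mono) auto
  then have tb': "t * b \<le> 1" using tb by simp
  show "sqrt pi ^ DIM('a) * ?I \<le> kernel_gauss TYPE('a) \<sigma> t b"
    unfolding kernel_gauss_scale[OF t b(1)] using t b tb tb'
    by (intro mult_left_mono inv_fourier_0_mono integrable_stable_gauss mult_mono stable_symbol_antimono gauss_antimono)
       (auto simp: add_nonneg_pos)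
qed

text \<open>The input for the concentration of the kernel at the origin as time tends to 0.\<close>

lemma kernel_gauss_tendsto:
  assumes b: "0 < b" and X: "X \<longlonglongrightarrow> 0" "\<And>n. 0 \<le> X n"
  shows "(\<lambda>n. kernel_gauss TYPE('a::euclidean_space) \<sigma> (X n) b) \<longlonglongrightarrow> 1"
proof -
  let ?f = "\<lambda>t (\<zeta>::'a). stable_symbol \<sigma> (t * b powr \<sigma>) \<zeta> * gauss (t * b + 1 / 4) \<zeta>"
  have "(\<lambda>n. inv_fourier (?f (X n)) 0) \<longlonglongrightarrow> inv_fourier (?f 0) 0"
    unfolding inv_fourier_def
  proof (intro tendsto_divide tendsto_const integral_dominated_convergence)
    show "integrable lborel (\<lambda>\<zeta>::'a. gauss (1 / 4) \<zeta>)" by (intro gauss_fourier) simp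
    show "AE \<zeta> in lborel. (\<lambda>n. cos (0 \<bullet> \<zeta>) * ?f (X n) \<zeta>) \<longlonglongrightarrow> cos (0 \<bullet> \<zeta>) * ?f 0 \<zeta>"
    proof (rule AE_I2)
      fix \<zeta>
      show "(\<lambda>n. cos (0 \<bullet> \<zeta>) * ?f (X n) \<zeta>) \<longlonglongrightarrow> cos (0 \<bullet> \<zeta>) * ?f 0 \<zeta>"
        unfolding stable_symbol_def gauss_def by (intro tendsto_intros X)
    qed
    show "AE \<zeta> in lborel. norm (cos (0 \<bullet> \<zeta>) * ?f (X n) \<zeta>) \<le> gauss (1 / 4) \<zeta>" for n
    proof (rule AE_I2)
      fix \<zeta> :: 'a
      have "?f (X n) \<zeta> \<le> 1 * gauss (1 / 4) \<zeta>"
        using X(2)[of n] b by (intro mult_mono stable_symbol_le_1 gauss_antimono) auto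
      then show "norm (cos (0 \<bullet> \<zeta>) * ?f (X n) \<zeta>) \<le> gauss (1 / 4) \<zeta>" by (simp add: abs_mult)
    qed
  qed auto
  then have "(\<lambda>n. kernel_gauss TYPE('a) \<sigma> (X n) b) \<longlonglongrightarrow> sqrt pi ^ DIM('a) * inv_fourier (?f 0) 0"
    unfolding kernel_gauss_scale[OF X(2) b] by (intro tendsto_intros)
  also have "sqrt pi ^ DIM('a) * inv_fourier (?f 0) 0 = 1"
  proof -
    have "inv_fourier (?f 0) 0 = inv_fourier (gauss (1 / 4)) (0::'a)" by (simp add: stable_symbol_def)
    then show ?thesis by (simp add: inv_fourier_gauss)
  qed
  finally show ?thesis .
qed

section \<open>Continuity of the kernel in time\<close>

lemma mixed_kernel_tendsto:
  fixes x :: "'a::euclidean_space"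
  assumes t: "0 < t" and X: "X \<longlonglongrightarrow> t"
  shows "(\<lambda>n. mixed_kernel \<sigma> (X n) x) \<longlonglongrightarrow> mixed_kernel \<sigma> t x"
proof -
  have ev: "eventually (\<lambda>n. t / 2 < X n) sequentially" using order_tendstoD(1)[OF X, of "t / 2"] t by simp
  \<comment> \<open>Keeping the sequence away from 0 makes \<open>gauss (t / 2)\<close> a dominating
    function for every n; only finitely many terms change.\<close>
  define Y where "Y n = max (t / 2) (X n)" for n
  have Y: "Y \<longlonglongrightarrow> t"
  proof -
    have "Y \<longlonglongrightarrow> max (t / 2) t" unfolding Y_def by (intro tendsto_intros X)
    then show ?thesis using t by simp
  qed
  have Yge: "Y n \<ge> t / 2" for n by (simp add: Y_def)
  then have Ypos: "Y n > 0" for n using t by (meson half_gt_zero less_le_trans)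
  have "(\<lambda>n. inv_fourier (\<lambda>\<xi>. stable_symbol \<sigma> (Y n) \<xi> * gauss (Y n) \<xi>) x) \<longlonglongrightarrow> inv_fourier (\<lambda>\<xi>. stable_symbol \<sigma> t \<xi> * gauss t \<xi>) x"
    unfolding inv_fourier_def
  proof (intro tendsto_divide tendsto_const integral_dominated_convergence)
    show "integrable lborel (\<lambda>\<zeta>::'a. gauss (t / 2) \<zeta>)" by (intro gauss_fourier) (use t in simp)
    show "AE \<xi> in lborel. (\<lambda>n. cos (x \<bullet> \<xi>) * (stable_symbol \<sigma> (Y n) \<xi> * gauss (Y n) \<xi>)) \<longlonglongrightarrow> cos (x \<bullet> \<xi>) * (stable_symbol \<sigma> t \<xi> * gauss t \<xi>)"
      unfolding stable_symbol_def gauss_def by (intro AE_I2 tendsto_intros Y)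
    show "AE \<xi> in lborel. norm (cos (x \<bullet> \<xi>) * (stable_symbol \<sigma> (Y n) \<xi> * gauss (Y n) \<xi>)) \<le> gauss (t / 2) \<xi>" for n
    proof (rule AE_I2)
      fix \<xi> :: 'a
      have "stable_symbol \<sigma> (Y n) \<xi> * gauss (Y n) \<xi> \<le> 1 * gauss (t / 2) \<xi>"
        using Yge[of n] Ypos[of n] by (intro mult_mono stable_symbol_le_1 gauss_antimono) auto
      then have "\<bar>cos (x \<bullet> \<xi>)\<bar> * (stable_symbol \<sigma> (Y n) \<xi> * gauss (Y n) \<xi>) \<le> 1 * (1 * gauss (t / 2) \<xi>)"
        by (intro mult_mono[of "\<bar>cos (x \<bullet> \<xi>)\<bar>" 1]) auto
      then show "norm (cos (x \<bullet> \<xi>) * (stable_symbol \<sigma> (Y n) \<xi> * gauss (Y n) \<xi>)) \<le> gauss (t / 2) \<xi>" by (simp add: abs_mult)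
    qed
  qed auto
  then have "(\<lambda>n. mixed_kernel \<sigma> (Y n) x) \<longlonglongrightarrow> mixed_kernel \<sigma> t x"
    using Ypos t by (simp add: mixed_kernel_def)
  moreover have "eventually (\<lambda>n. mixed_kernel \<sigma> (Y n) x = mixed_kernel \<sigma> (X n) x) sequentially"
    using ev by eventually_elim (simp add: Y_def)
  ultimately show ?thesis by (rule Lim_transform_eventually)
qed

text \<open>Scheffe's lemma: pointwise convergence together with masses that do not exceed the mass
  1 of the limit. At times X n \<le> 0 the mass is 0, which is still admissible.\<close>

lemma mixed_kernel_L1_tendsto:
  assumes t: "0 < t" and X: "X \<longlonglongrightarrow> t"
  shows "(\<lambda>n. (\<integral>\<^sup>+x. ennreal \<bar>mixed_kernel \<sigma> (X n) (x::'a::euclidean_space) - mixed_kernel \<sigma> t x\<bar> \<partial>lborel)) \<longlonglongrightarrow> 0"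
proof -
  have "(\<lambda>n. (\<integral>\<^sup>+x. ennreal (norm (mixed_kernel \<sigma> (X n) (x::'a) - mixed_kernel \<sigma> t x)) \<partial>lborel)) \<longlonglongrightarrow> 0"
    by (rule Scheffe_lemma2) (auto simp: t nn_integral_mixed_kernel intro!: integrable_mixed_kernel mixed_kernel_tendsto X)
  then show ?thesis by simp
qed

end

section \<open>The heat semigroup\<close>

lemma measurable_curried:
  assumes "(\<lambda>(t, x). g t x) \<in> borel_measurable (borel \<Otimes>\<^sub>M borel)"
    and [measurable]: "a \<in> borel_measurable M" "b \<in> borel_measurable M"
  shows "(\<lambda>z. g (a z) (b z)) \<in> borel_measurable M"
proof -
  have "(\<lambda>z. (a z, b z)) \<in> M \<rightarrow>\<^sub>M borel \<Otimes>\<^sub>M borel" by measurable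
  from measurable_compose[OF this assms(1)] show ?thesis by simp
qed

text \<open>What the evolution equation uses of the kernel. Continuity in L^1 and concentration are
  stated along sequences, the form in which dominated convergence and Scheffe's lemma deliver
  them.\<close>

locale convolution_semigroup =
  fixes K :: "real \<Rightarrow> 'a::euclidean_space \<Rightarrow> real"
  assumes K_joint_measurable: "(\<lambda>(t, x). K t x) \<in> borel_measurable (borel \<Otimes>\<^sub>M borel)"
    and K_nonneg [simp]: "\<And>t x. 0 \<le> K t x"
    and K_minus [simp]: "\<And>t x. K t (- x) = K t x"
    and K_mass: "\<And>t. 0 < t \<Longrightarrow> (\<integral>\<^sup>+x. ennreal (K t x) \<partial>lborel) = 1"
    and K_semigroup: "\<And>s t x. 0 < s \<Longrightarrow> 0 < t \<Longrightarrow>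
          (\<integral>\<^sup>+y. ennreal (K s y) * ennreal (K t (x - y)) \<partial>lborel) = ennreal (K (s + t) x)"
    and K_continuous: "\<And>t X. 0 < t \<Longrightarrow> X \<longlonglongrightarrow> t \<Longrightarrow>
          (\<lambda>n. (\<integral>\<^sup>+x. ennreal \<bar>K (X n) x - K t x\<bar> \<partial>lborel)) \<longlonglongrightarrow> 0"
    and K_concentration: "\<And>\<delta> X. 0 < \<delta> \<Longrightarrow> X \<longlonglongrightarrow> 0 \<Longrightarrow> (\<And>n. 0 < X n) \<Longrightarrow>
          (\<lambda>n. (\<integral>\<^sup>+x. ennreal (K (X n) x) * indicator {x. \<delta> \<le> norm x} x \<partial>lborel)) \<longlonglongrightarrow> 0"
begin

lemmas borel_measurable_K [measurable (raw)] = measurable_curried[OF K_joint_measurable]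

text \<open>With values in [0,\<infinity>] the theorems of Tonelli and monotone convergence apply
  without integrability conditions. For t \<le> 0 the operator is the identity, which is the right
  value at 0.\<close>

definition P :: "real \<Rightarrow> ('a \<Rightarrow> ennreal) \<Rightarrow> 'a \<Rightarrow> ennreal" where
  "P t g x = (if 0 < t then \<integral>\<^sup>+y. ennreal (K t (x - y)) * g y \<partial>lborel else g x)"

lemma P_0 [simp]: "P 0 g = g"
  by (simp add: P_def fun_eq_iff)

lemma borel_measurable_P [measurable (raw)]:
  assumes [measurable]: "f \<in> borel_measurable M" "\<xi> \<in> borel_measurable M"
    and G [measurable]: "case_prod G \<in> borel_measurable (M \<Otimes>\<^sub>M borel)"
  shows "(\<lambda>z. P (f z) (G z) (\<xi> z)) \<in> borel_measurable M"
proof -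
  have "(\<lambda>z. (z, \<xi> z)) \<in> M \<rightarrow>\<^sub>M M \<Otimes>\<^sub>M borel" by measurable
  from measurable_compose[OF this G] have [measurable]: "(\<lambda>z. G z (\<xi> z)) \<in> borel_measurable M" by simp
  have [measurable]: "case_prod G \<in> borel_measurable (M \<Otimes>\<^sub>M lborel)" using G by simp
  show ?thesis unfolding P_def by measurable
qed

lemma P_mono: "(\<And>y. g y \<le> g' y) \<Longrightarrow> P t g x \<le> P t g' x"
  unfolding P_def by (auto intro!: nn_integral_mono mult_left_mono)

lemma P_mono_AE: "0 < t \<Longrightarrow> AE y in lborel. g y \<le> g' y \<Longrightarrow> P t g x \<le> P t g' x"
  unfolding P_def by (auto intro!: nn_integral_mono_AE mult_left_mono elim!: eventually_mono)

lemma nn_integral_reflect: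
  fixes g :: "'a \<Rightarrow> ennreal"
  assumes [measurable]: "g \<in> borel_measurable borel"
  shows "(\<integral>\<^sup>+y. g (x - y) \<partial>lborel) = (\<integral>\<^sup>+y. g y \<partial>lborel)"
  using lborel_nn_integral_affine[of "-1" g x] by simp

lemma K_mass_shift: "0 < t \<Longrightarrow> (\<integral>\<^sup>+y. ennreal (K t (x - y)) \<partial>lborel) = 1"
  using nn_integral_reflect[of "\<lambda>y. ennreal (K t y)" x] K_mass[of t] by simp

lemma P_const [simp]: "P t (\<lambda>_. c) x = c"
  unfolding P_def by (auto simp: nn_integral_multc K_mass_shift)

lemma P_le_const: "(\<And>y. g y \<le> c) \<Longrightarrow> P t g x \<le> c"
  using P_mono[of g "\<lambda>_. c" t x] by simp

lemma P_le_const_AE: "0 < t \<Longrightarrow> AE y in lborel. g y \<le> c \<Longrightarrow> P t g x \<le> c"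
  using P_mono_AE[of t g "\<lambda>_. c" x] by simp

lemma P_add:
  assumes [measurable]: "g \<in> borel_measurable borel" "g' \<in> borel_measurable borel"
  shows "P t (\<lambda>y. g y + g' y) x = P t g x + P t g' x"
  unfolding P_def by (auto simp: distrib_left nn_integral_add)

lemma P_cmult:
  assumes [measurable]: "g \<in> borel_measurable borel"
  shows "P t (\<lambda>y. c * g y) x = c * P t g x"
  unfolding P_def by (auto simp: mult.left_commute nn_integral_cmult)

lemma P_nn_integral:
  assumes [measurable]: "case_prod G \<in> borel_measurable ((borel::real measure) \<Otimes>\<^sub>M (borel::'a measure))"
  shows "P t (\<lambda>y. (\<integral>\<^sup>+s. G s y \<partial>lborel)) x = (\<integral>\<^sup>+s. P t (G s) x \<partial>lborel)"
proof (cases "0 < t")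
  case True
  have "(\<integral>\<^sup>+y. ennreal (K t (x - y)) * (\<integral>\<^sup>+s. G s y \<partial>lborel) \<partial>lborel)
    = (\<integral>\<^sup>+y. (\<integral>\<^sup>+s. ennreal (K t (x - y)) * G s y \<partial>lborel) \<partial>lborel)"
    by (simp add: nn_integral_cmult)
  also have "\<dots> = (\<integral>\<^sup>+s. (\<integral>\<^sup>+y. ennreal (K t (x - y)) * G s y \<partial>lborel) \<partial>lborel)"
    by (rule lborel_pair.Fubini') measurable
  finally show ?thesis using True by (simp add: P_def)
qed (simp add: P_def)

text \<open>Symmetry of the kernel makes the semigroup self-adjoint; this is how a test function
  absorbs the heat flow.\<close>

lemma P_dual:
  assumes [measurable]: "g \<in> borel_measurable borel" "\<phi> \<in> borel_measurable borel"
  shows "(\<integral>\<^sup>+x. \<phi> x * P t g x \<partial>lborel) = (\<integral>\<^sup>+x. P t \<phi> x * g x \<partial>lborel)"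
proof (cases "0 < t")
  case True
  have "(\<integral>\<^sup>+x. \<phi> x * P t g x \<partial>lborel) = (\<integral>\<^sup>+x. (\<integral>\<^sup>+y. \<phi> x * (ennreal (K t (x - y)) * g y) \<partial>lborel) \<partial>lborel)"
    using True by (simp add: P_def nn_integral_cmult)
  also have "\<dots> = (\<integral>\<^sup>+y. (\<integral>\<^sup>+x. \<phi> x * (ennreal (K t (x - y)) * g y) \<partial>lborel) \<partial>lborel)"
    by (rule lborel_pair.Fubini') measurable
  also have "\<dots> = (\<integral>\<^sup>+y. (\<integral>\<^sup>+x. (ennreal (K t (y - x)) * \<phi> x) * g y \<partial>lborel) \<partial>lborel)"
  proof (intro nn_integral_cong)
    fix x y
    have "K t (x - y) = K t (y - x)" using K_minus[of t "x - y"] by simp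
    then show "\<phi> x * (ennreal (K t (x - y)) * g y) = ennreal (K t (y - x)) * \<phi> x * g y"
      by (simp only: ac_simps)
  qed
  also have "\<dots> = (\<integral>\<^sup>+y. P t \<phi> y * g y \<partial>lborel)"
    using True by (simp add: P_def nn_integral_multc)
  finally show ?thesis .
qed (simp add: P_def)

lemma P_P:
  assumes [measurable]: "g \<in> borel_measurable borel" and "0 \<le> s" "0 \<le> t"
  shows "P s (P t g) x = P (s + t) g x"
proof -
  consider "s = 0" | "t = 0" | "0 < s" "0 < t" using assms by linarith
  then show ?thesis
  proof cases
    case 3
    have "P s (P t g) x = (\<integral>\<^sup>+y. (\<integral>\<^sup>+z. ennreal (K s (x - y)) * (ennreal (K t (y - z)) * g z) \<partial>lborel) \<partial>lborel)"
      using 3 by (simp add: P_def nn_integral_cmult)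
    also have "\<dots> = (\<integral>\<^sup>+z. (\<integral>\<^sup>+y. ennreal (K s (x - y)) * (ennreal (K t (y - z)) * g z) \<partial>lborel) \<partial>lborel)"
      by (rule lborel_pair.Fubini') measurable
    also have "\<dots> = (\<integral>\<^sup>+z. (\<integral>\<^sup>+y. ennreal (K s (x - y)) * ennreal (K t (y - z)) \<partial>lborel) * g z \<partial>lborel)"
      by (simp add: nn_integral_multc mult.assoc[symmetric])
    also have "\<dots> = (\<integral>\<^sup>+z. ennreal (K (s + t) (x - z)) * g z \<partial>lborel)"
    proof (rule nn_integral_cong)
      fix z
      have "(\<integral>\<^sup>+y. ennreal (K s (x - y)) * ennreal (K t (y - z)) \<partial>lborel)
         = (\<integral>\<^sup>+y. ennreal (K s y) * ennreal (K t ((x - z) - y)) \<partial>lborel)"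
        using nn_integral_reflect[of "\<lambda>y. ennreal (K s y) * ennreal (K t ((x - z) - y))" x]
        by (simp add: algebra_simps)
      then show "(\<integral>\<^sup>+y. ennreal (K s (x - y)) * ennreal (K t (y - z)) \<partial>lborel) * g z = ennreal (K (s + t) (x - z)) * g z"
        using K_semigroup[OF 3, of "x - z"] by simp
    qed
    finally show ?thesis using 3 by (simp add: P_def)
  qed auto
qed

lemma P_SUP:
  assumes [measurable]: "\<And>k. g k \<in> borel_measurable borel" and inc: "incseq g"
  shows "P t (\<lambda>y. (SUP k. g k y)) x = (SUP k. P t (g k) x)"
proof (cases "0 < t")
  case True
  have "(\<integral>\<^sup>+y. ennreal (K t (x - y)) * (SUP k. g k y) \<partial>lborel) = (\<integral>\<^sup>+y. (SUP k. ennreal (K t (x - y)) * g k y) \<partial>lborel)"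
    by (simp add: SUP_mult_left_ennreal)
  also have "\<dots> = (SUP k. (\<integral>\<^sup>+y. ennreal (K t (x - y)) * g k y \<partial>lborel))"
    by (rule nn_integral_monotone_convergence_SUP)
       (use inc in \<open>auto simp: incseq_def le_fun_def intro!: mult_left_mono\<close>)
  finally show ?thesis using True by (simp add: P_def)
qed (simp add: P_def)

section \<open>The modulus of continuity of the semigroup in time\<close>

definition D :: "real \<Rightarrow> real \<Rightarrow> ennreal" where
  "D s t = (\<integral>\<^sup>+x. ennreal \<bar>K s x - K t x\<bar> \<partial>lborel)"

lemma D_commute: "D s t = D t s"
  by (simp add: D_def abs_minus_commute)

lemma borel_measurable_D [measurable (raw)]:
  assumes [measurable]: "f \<in> borel_measurable M" "g \<in> borel_measurable M"
  shows "(\<lambda>z. D (f z) (g z)) \<in> borel_measurable M"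
  unfolding D_def by measurable

lemma D_le_2: "0 < s \<Longrightarrow> 0 < t \<Longrightarrow> D s t \<le> 2"
proof -
  assume st: "0 < s" "0 < t"
  have "D s t \<le> (\<integral>\<^sup>+x. ennreal (K s x) + ennreal (K t x) \<partial>lborel)"
    unfolding D_def
  proof (rule nn_integral_mono)
    fix x
    have "\<bar>K s x - K t x\<bar> \<le> K s x + K t x" using K_nonneg[of s x] K_nonneg[of t x] by linarith
    then show "ennreal \<bar>K s x - K t x\<bar> \<le> ennreal (K s x) + ennreal (K t x)"
      by (simp add: ennreal_plus[symmetric] ennreal_leI del: ennreal_plus)
  qed
  also have "\<dots> = 2" using st by (simp add: nn_integral_add K_mass)
  finally show ?thesis .
qed

text \<open>Stated with a sum on the right because subtraction in [0,\<infinity>] truncates. The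
  error does not depend on x, so it controls the supremum norm.\<close>

lemma P_le_P_D:
  assumes [measurable]: "g \<in> borel_measurable borel" and "0 < s" "0 < t" and M: "\<And>y. g y \<le> M"
  shows "P s g x \<le> P t g x + M * D s t"
proof -
  have "P s g x \<le> (\<integral>\<^sup>+y. ennreal (K t (x - y)) * g y + ennreal \<bar>K s (x - y) - K t (x - y)\<bar> * M \<partial>lborel)"
    using assms(2) unfolding P_def
  proof (simp, intro nn_integral_mono)
    fix y
    have "ennreal (K s (x - y)) \<le> ennreal (K t (x - y)) + ennreal \<bar>K s (x - y) - K t (x - y)\<bar>"
      by (subst ennreal_plus[symmetric]) (auto intro!: ennreal_leI simp del: ennreal_plus)
    then have "ennreal (K s (x - y)) * g y \<le> (ennreal (K t (x - y)) + ennreal \<bar>K s (x - y) - K t (x - y)\<bar>) * g y"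
      by (rule mult_right_mono) simp
    also have "\<dots> \<le> ennreal (K t (x - y)) * g y + ennreal \<bar>K s (x - y) - K t (x - y)\<bar> * M"
      unfolding distrib_right by (intro add_left_mono mult_left_mono M) simp
    finally show "ennreal (K s (x - y)) * g y \<le> ennreal (K t (x - y)) * g y + ennreal \<bar>K s (x - y) - K t (x - y)\<bar> * M" .
  qed
  also have "\<dots> = P t g x + (\<integral>\<^sup>+y. ennreal \<bar>K s (x - y) - K t (x - y)\<bar> \<partial>lborel) * M"
    using assms(3) by (simp add: P_def nn_integral_add nn_integral_multc)
  also have "(\<integral>\<^sup>+y. ennreal \<bar>K s (x - y) - K t (x - y)\<bar> \<partial>lborel) = D s t"
    using nn_integral_reflect[of "\<lambda>y. ennreal \<bar>K s y - K t y\<bar>" x] by (simp add: D_def)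
  finally show ?thesis by (simp add: mult.commute)
qed

lemma D_tendsto: "0 < t \<Longrightarrow> X \<longlonglongrightarrow> t \<Longrightarrow> (\<lambda>n. D (X n) t) \<longlonglongrightarrow> 0"
  unfolding D_def by (rule K_continuous)

text \<open>The modulus of continuity in time of the Duhamel term on \<open>[0, T]\<close>.\<close>

definition DT :: "real \<Rightarrow> real \<Rightarrow> ennreal" where
  "DT T \<delta> = (\<integral>\<^sup>+r. indicator {0<..T} r * D (r + \<delta>) r \<partial>lborel)"

text \<open>The integrand tends to 0 for each fixed r > 0, with no uniformity claimed near r = 0;
  the bound 2, the total mass of two kernels, dominates it.\<close>

lemma DT_tendsto:
  assumes X: "X \<longlonglongrightarrow> 0" "\<And>n. 0 \<le> X n" and T: "0 \<le> T"
  shows "(\<lambda>n. DT T (X n)) \<longlonglongrightarrow> 0"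
proof -
  have "(\<lambda>n. (\<integral>\<^sup>+r. indicator {0<..T} r * D (r + X n) r \<partial>lborel)) \<longlonglongrightarrow> (\<integral>\<^sup>+r. 0 \<partial>(lborel::real measure))"
  proof (rule nn_integral_dominated_convergence[where w = "\<lambda>r. 2 * indicator {0<..T} r"])
    show "(\<integral>\<^sup>+r. 2 * indicator {0<..T} r \<partial>lborel) < \<infinity>"
      using T by (simp add: nn_integral_cmult ennreal_mult_less_top)
    show "AE r in lborel. indicator {0<..T} r * D (r + X n) r \<le> 2 * indicator {0<..T} r" for n
      using X(2)[of n] by (auto intro!: AE_I2 simp: indicator_def D_le_2)
    show "AE r in lborel. (\<lambda>n. indicator {0<..T} r * D (r + X n) r) \<longlonglongrightarrow> 0"
    proof (rule AE_I2)
      fix r :: real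
      show "(\<lambda>n. indicator {0<..T} r * D (r + X n) r) \<longlonglongrightarrow> 0"
      proof (cases "r \<in> {0<..T}")
        case True
        have "(\<lambda>n. r + X n) \<longlonglongrightarrow> r + 0" by (intro tendsto_intros X)
        then show ?thesis using D_tendsto[of r "\<lambda>n. r + X n"] True by simp
      qed simp
    qed
  qed measurable
  then show ?thesis by (simp add: DT_def)
qed

text \<open>An approximate identity: displacements below \<delta> change \<phi> by at most
  \<epsilon> / 2, and larger ones cost at most M times a mass that tends to 0.\<close>

lemma P_uniformly_tendsto_0:
  assumes uc: "uniformly_continuous_on UNIV \<phi>" and \<phi>: "\<And>x. 0 \<le> \<phi> x" "\<And>x. \<phi> x \<le> M"
    and X: "X \<longlonglongrightarrow> 0" "\<And>n. 0 < X n" and \<epsilon>: "0 < \<epsilon>"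
  shows "eventually (\<lambda>n. \<forall>x. P (X n) (\<lambda>y. ennreal (\<phi> y)) x \<le> ennreal (\<phi> x) + ennreal \<epsilon> \<and>
     ennreal (\<phi> x) \<le> P (X n) (\<lambda>y. ennreal (\<phi> y)) x + ennreal \<epsilon>) sequentially"
proof -
  have [measurable]: "\<phi> \<in> borel_measurable borel"
    by (rule borel_measurable_continuous_onI[OF uniformly_continuous_imp_continuous[OF uc]])
  have M0: "0 \<le> M" using \<phi>[of 0] by linarith
  obtain \<delta> where \<delta>: "\<delta> > 0" "\<And>x y. dist x y < \<delta> \<Longrightarrow> dist (\<phi> x) (\<phi> y) < \<epsilon> / 2"
    using uc \<epsilon> unfolding uniformly_continuous_on_def by (metis UNIV_I half_gt_zero)
  define Q where "Q n = (\<integral>\<^sup>+x. ennreal (K (X n) x) * indicator {x. \<delta> \<le> norm x} x \<partial>lborel)" for n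
  have "(\<lambda>n. ennreal M * Q n) \<longlonglongrightarrow> ennreal M * 0"
    unfolding Q_def by (intro ennreal_tendsto_cmult K_concentration \<delta>(1) X) simp
  then have "eventually (\<lambda>n. ennreal M * Q n < ennreal (\<epsilon> / 2)) sequentially"
    using \<epsilon> by (intro order_tendstoD(2)) auto
  then show ?thesis
  proof eventually_elim
    case (elim n)
    \<comment> \<open>One estimate for both directions: (a, b) is (\<phi> x, \<phi> y) or the
      reverse.\<close>
    have bnd: "ennreal a \<le> ennreal b + ennreal (\<epsilon> / 2) + ennreal M * indicator {x. \<delta> \<le> norm x} (x - y)"
      if "a = \<phi> x \<and> b = \<phi> y \<or> a = \<phi> y \<and> b = \<phi> x" for a b x y
    proof (cases "\<delta> \<le> norm (x - y)")
      case True
      have "ennreal a \<le> ennreal M" using that \<phi> by (auto intro!: ennreal_leI)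
      also have "\<dots> \<le> (ennreal b + ennreal (\<epsilon> / 2)) + ennreal M" by (rule add_increasing) simp_all
      finally show ?thesis using True by simp
    next
      case False
      then have "dist (\<phi> x) (\<phi> y) < \<epsilon> / 2" by (intro \<delta>) (simp add: dist_norm)
      then have "a \<le> b + \<epsilon> / 2" using that unfolding dist_real_def by (elim disjE; clarify; linarith)
      then have "ennreal a \<le> ennreal (b + \<epsilon> / 2)" by (rule ennreal_leI)
      also have "\<dots> = ennreal b + ennreal (\<epsilon> / 2)" using that \<phi> \<epsilon> by (intro ennreal_plus) auto
      finally show ?thesis using False by simp
    qed
    have I: "(\<integral>\<^sup>+y. ennreal (K (X n) (x - y)) * (ennreal M * indicator {x. \<delta> \<le> norm x} (x - y)) \<partial>lborel) = ennreal M * Q n" for x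
      using nn_integral_reflect[of "\<lambda>y. ennreal (K (X n) y) * (ennreal M * indicator {x. \<delta> \<le> norm x} y)" x]
      by (simp add: Q_def mult.left_commute nn_integral_cmult)
    have half: "ennreal (\<epsilon> / 2) + ennreal M * Q n \<le> ennreal \<epsilon>"
    proof -
      have "ennreal (\<epsilon> / 2) + ennreal M * Q n \<le> ennreal (\<epsilon> / 2) + ennreal (\<epsilon> / 2)"
        using elim by (intro add_left_mono) auto
      also have "\<dots> = ennreal \<epsilon>" using \<epsilon> by (subst ennreal_plus[symmetric]) auto
      finally show ?thesis .
    qed
    have PM: "P (X n) (\<lambda>y. ennreal M * indicator {x. \<delta> \<le> norm x} (x - y)) x = ennreal M * Q n" for x
      using I[of x] X(2)[of n] by (simp add: P_def)
    show ?case
    proof (intro allI conjI)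
      fix x
      have "P (X n) (\<lambda>y. ennreal (\<phi> y)) x \<le> P (X n) (\<lambda>y. (ennreal (\<phi> x) + ennreal (\<epsilon> / 2)) + ennreal M * indicator {x. \<delta> \<le> norm x} (x - y)) x"
        by (intro P_mono bnd) auto
      also have "\<dots> = ennreal (\<phi> x) + (ennreal (\<epsilon> / 2) + ennreal M * Q n)"
        by (subst P_add) (auto simp: PM add.assoc)
      also have "\<dots> \<le> ennreal (\<phi> x) + ennreal \<epsilon>" by (intro add_left_mono half)
      finally show "P (X n) (\<lambda>y. ennreal (\<phi> y)) x \<le> ennreal (\<phi> x) + ennreal \<epsilon>" .
      have "ennreal (\<phi> x) = P (X n) (\<lambda>y. ennreal (\<phi> x)) x" by simp
      also have "\<dots> \<le> P (X n) (\<lambda>y. (ennreal (\<phi> y) + ennreal (\<epsilon> / 2)) + ennreal M * indicator {x. \<delta> \<le> norm x} (x - y)) x"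
        by (intro P_mono bnd) auto
      also have "\<dots> = P (X n) (\<lambda>y. ennreal (\<phi> y)) x + (ennreal (\<epsilon> / 2) + ennreal M * Q n)"
        by (subst P_add; (subst P_add)?) (auto simp: PM add.assoc)
      also have "\<dots> \<le> P (X n) (\<lambda>y. ennreal (\<phi> y)) x + ennreal \<epsilon>" by (intro add_left_mono half)
      finally show "ennreal (\<phi> x) \<le> P (X n) (\<lambda>y. ennreal (\<phi> y)) x + ennreal \<epsilon>" .
    qed
  qed
qed

end

section \<open>The minimal solution\<close>

locale convex_source =
  fixes f :: "real \<Rightarrow> real"
  assumes f_continuous: "continuous_on {0..} f" and f_nonneg: "\<And>u. 0 \<le> u \<Longrightarrow> 0 \<le> f u"
    and f_convex: "convex_on {0..} f" and f_0 [simp]: "f 0 = 0" and f_pos: "\<And>u. 0 < u \<Longrightarrow> 0 < f u"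
begin

lemma f_ratio_mono:
  assumes "0 < a" "a \<le> b"
  shows "f a / a \<le> f b / b"
proof -
  have "f ((1 - a / b) *\<^sub>R 0 + (a / b) *\<^sub>R b) \<le> (1 - a / b) * f 0 + (a / b) * f b"
    by (rule convex_onD[OF f_convex]) (use assms in auto)
  then show ?thesis using assms by (simp add: field_simps)
qed

text \<open>Division by 0 gives 0, so monotonicity of the quotient extends to a = 0. This matters
  for (i), where no positivity of the real-valued norm is assumed.\<close>

lemma f_ratio_mono0: "0 \<le> a \<Longrightarrow> a \<le> b \<Longrightarrow> f a / a \<le> f b / b"
  using f_ratio_mono[of a b] f_nonneg[of b] by (cases "a = 0") auto

lemma f_mono:
  assumes "0 \<le> a" "a \<le> b"
  shows "f a \<le> f b"
proof (cases "a = 0")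
  case False
  then have "f a / a \<le> f b / b" using assms by (intro f_ratio_mono) auto
  also have "\<dots> \<le> f b / a" using assms False f_nonneg[of b] by (intro divide_left_mono) auto
  finally show ?thesis using assms False by (simp add: divide_le_cancel)
qed (use assms f_nonneg in auto)

lemma f_tangent:
  assumes "0 < a"
  shows "\<exists>k. \<forall>y\<ge>0. f a + k * (y - a) \<le> f y"
  using convex_le_Inf_differential[OF f_convex, of a] assms by (auto simp: interior_real_atLeast)

text \<open>A supporting line at b has slope at most f (M + 1), since M + 1 lies at distance at
  least 1 to the right of b and f b \<ge> 0.\<close>

lemma f_lipschitz:
  assumes "0 \<le> a" "a \<le> b" "b \<le> M"
  shows "f b - f a \<le> f (M + 1) * (b - a)"
proof (cases "b = 0")
  case False
  then have b: "b > 0" using assms by simp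
  obtain k where k: "\<And>y. 0 \<le> y \<Longrightarrow> f b + k * (y - b) \<le> f y"
    using f_tangent[OF b] by blast
  have "f b - f a \<le> k * (b - a)" using k[OF assms(1)] by (simp add: algebra_simps)
  moreover have "k \<le> f (M + 1)"
  proof (cases "k \<le> 0")
    case False
    then have "k * 1 \<le> k * (M + 1 - b)" using assms by (intro mult_left_mono) auto
    then show ?thesis using k[of "M + 1"] f_nonneg[of b] assms by auto
  qed (use f_nonneg[of "M + 1"] assms in auto)
  ultimately show ?thesis using assms by (meson diff_ge_0_iff_ge mult_right_mono order_trans)
qed (use assms in auto)

text \<open>The extension to [0,\<infinity>] lets the iteration be formed before anything is known
  to be finite; the value at \<top> keeps it monotone.\<close>

definition F :: "ennreal \<Rightarrow> ennreal" where
  "F y = (if y = \<top> then \<top> else ennreal (f (enn2real y)))"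

lemma F_ennreal: "0 \<le> r \<Longrightarrow> F (ennreal r) = ennreal (f r)"
  by (simp add: F_def)

lemma F_mono: "a \<le> b \<Longrightarrow> F a \<le> F b"
proof (cases "b = \<top>")
  case False
  assume ab: "a \<le> b"
  then have "a \<noteq> \<top>" using False by (auto simp: top_unique)
  then show ?thesis using ab False
    by (auto simp: F_def intro!: ennreal_leI f_mono enn2real_mono simp: less_top)
qed (simp add: F_def)

lemma F_le: "0 \<le> M \<Longrightarrow> y \<le> ennreal M \<Longrightarrow> F y \<le> ennreal (f M)"
  using F_mono[of y "ennreal M"] by (simp add: F_ennreal)

lemma continuous_f_max: "continuous_on UNIV (\<lambda>x. f (max 0 x))"
  by (rule continuous_on_compose2[OF f_continuous]) (auto intro!: continuous_intros)

lemma borel_measurable_f_max [measurable]: "(\<lambda>x. f (max 0 x)) \<in> borel_measurable borel"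
  by (rule borel_measurable_continuous_onI[OF continuous_f_max])

lemma borel_measurable_F [measurable]: "F \<in> borel_measurable borel"
proof -
  have "F = (\<lambda>y. if y = \<top> then \<top> else ennreal ((\<lambda>x. f (max 0 x)) (enn2real y)))"
    by (auto simp: F_def fun_eq_iff max_def)
  then show ?thesis by simp
qed

lemma F_SUP:
  assumes inc: "incseq y" and fin: "(SUP k. y k) < \<top>"
  shows "F (SUP k. y k) = (SUP k. F (y k))"
proof -
  have lim: "y \<longlonglongrightarrow> (SUP k. y k)" by (rule LIMSEQ_SUP[OF inc])
  have ytop: "y k < \<top>" for k by (rule le_less_trans[OF SUP_upper fin]) simp
  have "(\<lambda>k. f (max 0 (enn2real (y k)))) \<longlonglongrightarrow> f (max 0 (enn2real (SUP k. y k)))"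
    using continuous_f_max lim fin
    by (intro continuous_on_tendsto_compose[OF continuous_f_max] tendsto_enn2real) auto
  then have "(\<lambda>k. ennreal (f (enn2real (y k)))) \<longlonglongrightarrow> ennreal (f (enn2real (SUP k. y k)))"
    by (intro tendsto_ennrealI) (simp add: max_def)
  moreover have "F (y k) = ennreal (f (enn2real (y k)))" for k
    using ytop[of k] by (simp add: F_def)
  moreover have "F (SUP k. y k) = ennreal (f (enn2real (SUP k. y k)))"
    using fin unfolding F_def by (simp only: less_top[symmetric] if_False)
  ultimately have "(\<lambda>k. F (y k)) \<longlonglongrightarrow> F (SUP k. y k)" by (simp only:)
  moreover have "(\<lambda>k. F (y k)) \<longlonglongrightarrow> (SUP k. F (y k))"
    using inc by (intro LIMSEQ_SUP) (auto simp: incseq_def intro: F_mono)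
  ultimately show ?thesis by (rule LIMSEQ_unique)
qed

end

text \<open>Uniform continuity of the data is what makes their heat flow continuous at time 0 in the
  supremum norm.\<close>

locale semilinear = convolution_semigroup K + convex_source f
  for K :: "real \<Rightarrow> 'a::euclidean_space \<Rightarrow> real" and f :: "real \<Rightarrow> real" +
  fixes h :: "real \<Rightarrow> real" and u0 :: "'a \<Rightarrow> real" and U0 :: real
  assumes h_continuous: "continuous_on {0..} h" and h_nonneg: "\<And>t. 0 \<le> t \<Longrightarrow> 0 \<le> h t"
    and u0_continuous: "uniformly_continuous_on UNIV u0"
    and u0_nonneg: "\<And>x. 0 \<le> u0 x" and u0_le: "\<And>x. u0 x \<le> U0"
begin

lemma u0_measurable [measurable]: "u0 \<in> borel_measurable borel"
  by (rule borel_measurable_continuous_onI[OF uniformly_continuous_imp_continuous[OF u0_continuous]])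

lemma continuous_h_max: "continuous_on UNIV (\<lambda>x. h (max 0 x))"
  by (rule continuous_on_compose2[OF h_continuous]) (auto intro!: continuous_intros)

lemma borel_measurable_h_max [measurable]: "(\<lambda>x. h (max 0 x)) \<in> borel_measurable borel"
  by (rule borel_measurable_continuous_onI[OF continuous_h_max])

lemma h_bounded: "\<exists>B>0. \<forall>t. 0 \<le> t \<and> t \<le> T \<longrightarrow> h t \<le> B"
proof -
  have "compact ((\<lambda>x. h (max 0 x)) ` {0..T})"
    by (intro compact_continuous_image continuous_on_subset[OF continuous_h_max]) auto
  from compact_imp_bounded[OF this] obtain B where B: "\<forall>x\<in>(\<lambda>x. h (max 0 x)) ` {0..T}. norm x \<le> B"
    unfolding bounded_iff by (elim exE)
  have "h t \<le> max B 1" if t: "0 \<le> t" "t \<le> T" for t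
  proof -
    have "norm (h (max 0 t)) \<le> B" using t by (intro bspec[OF B] imageI) simp
    then show ?thesis using t by (simp add: max_absorb2)
  qed
  then show ?thesis by (intro exI[of _ "max B 1"]) auto
qed

text \<open>Since \<open>h\<close> is continuous on [0,\<infinity>) only, composing it with max 0
  ensures measurability on the whole line.\<close>

definition H :: "real \<Rightarrow> ennreal" where "H s = ennreal (h (max 0 s))"

lemma borel_measurable_H [measurable]: "H \<in> borel_measurable borel"
  unfolding H_def by measurable

text \<open>Picard iteration started from 0. Every operation in it is monotone, so the iterates
  increase, whether or not a solution exists up to time t.\<close>

primrec w :: "nat \<Rightarrow> real \<Rightarrow> 'a \<Rightarrow> ennreal" where
  "w 0 t x = 0"
| "w (Suc k) t x = P t (\<lambda>y. ennreal (u0 y)) x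
     + (\<integral>\<^sup>+s. indicator {0..t} s * P (t - s) (\<lambda>y. H s * F (w k s y)) x \<partial>lborel)"

lemma borel_measurable_w_pair: "(\<lambda>(t, x). w k t x) \<in> borel_measurable (borel \<Otimes>\<^sub>M borel)"
proof (induction k)
  case (Suc k)
  note [measurable (raw)] = measurable_curried[OF Suc]
  have [measurable]: "Measurable.pred ((borel \<Otimes>\<^sub>M borel) \<Otimes>\<^sub>M lborel) (\<lambda>x::(real \<times> 'a) \<times> real. snd x \<in> {0..fst (fst x)})"
    by (simp only: atLeastAtMost_iff) measurable
  show ?case by simp measurable
qed simp

lemmas borel_measurable_w [measurable (raw)] = measurable_curried[OF borel_measurable_w_pair]

lemma w_Suc_ge: "w k t x \<le> w (Suc k) t x"
proof (induction k arbitrary: t x)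
  case (Suc k)
  show ?case
    unfolding w.simps(2)[of "Suc k" t x] w.simps(2)[of k t x]
    by (intro add_left_mono nn_integral_mono mult_left_mono P_mono F_mono Suc) auto
qed simp

lemma w_incseq: "incseq (\<lambda>k. w k t x)"
  by (rule incseq_SucI) (rule w_Suc_ge)

definition W :: "real \<Rightarrow> 'a \<Rightarrow> ennreal" where "W t x = (SUP k. w k t x)"

lemma w_le_W: "w k t x \<le> W t x"
  unfolding W_def by (rule SUP_upper) simp

lemma borel_measurable_W [measurable (raw)]:
  assumes [measurable]: "a \<in> borel_measurable M" "b \<in> borel_measurable M"
  shows "(\<lambda>z. W (a z) (b z)) \<in> borel_measurable M"
  unfolding W_def by measurable

lemma W_eq_SUP_Suc: "W t x = (SUP k. w (Suc k) t x)"
  unfolding W_def by (rule antisym; rule SUP_mono) (use w_Suc_ge in blast)+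

text \<open>Monotone convergence in Duhamel's formula. Finiteness up to time t serves to exchange F
  with the supremum.\<close>

lemma W_eq:
  assumes fin: "\<And>s y. 0 \<le> s \<Longrightarrow> s \<le> t \<Longrightarrow> W s y < \<top>"
  shows "W t x = P t (\<lambda>y. ennreal (u0 y)) x + (\<integral>\<^sup>+s. indicator {0..t} s * P (t - s) (\<lambda>y. H s * F (W s y)) x \<partial>lborel)"
proof -
  have "W t x = P t (\<lambda>y. ennreal (u0 y)) x + (SUP k. (\<integral>\<^sup>+s. indicator {0..t} s * P (t - s) (\<lambda>y. H s * F (w k s y)) x \<partial>lborel))"
    unfolding W_eq_SUP_Suc w.simps add.commute[of "P t (\<lambda>y. ennreal (u0 y)) x"]
    by (rule ennreal_SUP_add_left) simp
  also have "(SUP k. (\<integral>\<^sup>+s. indicator {0..t} s * P (t - s) (\<lambda>y. H s * F (w k s y)) x \<partial>lborel))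
     = (\<integral>\<^sup>+s. (SUP k. indicator {0..t} s * P (t - s) (\<lambda>y. H s * F (w k s y)) x) \<partial>lborel)"
    by (rule nn_integral_monotone_convergence_SUP[symmetric])
       (auto intro!: incseq_SucI le_funI mult_left_mono P_mono F_mono w_Suc_ge simp del: w.simps)
  also have "\<dots> = (\<integral>\<^sup>+s. indicator {0..t} s * P (t - s) (\<lambda>y. H s * F (W s y)) x \<partial>lborel)"
  proof (rule nn_integral_cong)
    fix s
    show "(SUP k. indicator {0..t} s * P (t - s) (\<lambda>y. H s * F (w k s y)) x) = indicator {0..t} s * P (t - s) (\<lambda>y. H s * F (W s y)) x"
    proof (cases "s \<in> {0..t}")
      case True
      have "H s * F (W s y) = (SUP k. H s * F (w k s y))" for y
        unfolding W_def using fin[of s y] True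
        by (subst F_SUP[OF w_incseq]) (auto simp: W_def SUP_mult_left_ennreal)
      then have "P (t - s) (\<lambda>y. H s * F (W s y)) x = (SUP k. P (t - s) (\<lambda>y. H s * F (w k s y)) x)"
        by (subst P_SUP[symmetric]) (auto intro!: incseq_SucI le_funI mult_left_mono F_mono w_Suc_ge simp del: w.simps)
      then show ?thesis using True by simp
    qed simp
  qed
  finally show ?thesis .
qed

lemma w_0: "w k 0 x \<le> ennreal (u0 x)"
proof (cases k)
  case (Suc n)
  \<comment> \<open>At time 0 the Duhamel term is an integral over a single point.\<close>
  have "(\<integral>\<^sup>+s. indicator {0..0} s * P (0 - s) (\<lambda>y. H s * F (w n s y)) x \<partial>lborel) = (\<integral>\<^sup>+s. 0 \<partial>(lborel::real measure))"
    by (rule nn_integral_cong_AE, rule AE_mp[OF AE_lborel_singleton[of "0::real"]]) auto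
  then show ?thesis using Suc by simp
qed simp

lemma W_0: "W 0 x \<le> ennreal U0"
  unfolding W_def by (intro SUP_least order_trans[OF w_0] ennreal_leI u0_le)

text \<open>This semigroup property of the iteration replaces the uniqueness theory for the Cauchy problem.\<close>

lemma w_restart:
  assumes "0 \<le> t" "0 \<le> \<tau>"
  shows "w (Suc k) (t + \<tau>) x = P \<tau> (w (Suc k) t) x
     + (\<integral>\<^sup>+s. indicator {t<..t + \<tau>} s * P (t + \<tau> - s) (\<lambda>y. H s * F (w k s y)) x \<partial>lborel)"
proof -
  let ?G = "\<lambda>s y. H s * F (w k s y)"
  have split: "indicator {0..t + \<tau>} s * P (t + \<tau> - s) (?G s) x
     = indicator {0..t} s * P (t + \<tau> - s) (?G s) x + indicator {t<..t + \<tau>} s * P (t + \<tau> - s) (?G s) x" for s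
    using assms by (auto simp: indicator_def)
  have "P \<tau> (w (Suc k) t) x = P \<tau> (P t (\<lambda>y. ennreal (u0 y))) x
     + P \<tau> (\<lambda>y. (\<integral>\<^sup>+s. indicator {0..t} s * P (t - s) (?G s) y \<partial>lborel)) x"
    unfolding w.simps by (rule P_add) measurable
  also have "P \<tau> (P t (\<lambda>y. ennreal (u0 y))) x = P (t + \<tau>) (\<lambda>y. ennreal (u0 y)) x"
    using assms by (subst P_P) (auto simp: add.commute)
  also have "P \<tau> (\<lambda>y. (\<integral>\<^sup>+s. indicator {0..t} s * P (t - s) (?G s) y \<partial>lborel)) x
    = (\<integral>\<^sup>+s. P \<tau> (\<lambda>y. indicator {0..t} s * P (t - s) (?G s) y) x \<partial>lborel)"
    by (rule P_nn_integral) measurable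
  also have "\<dots> = (\<integral>\<^sup>+s. indicator {0..t} s * P (t + \<tau> - s) (?G s) x \<partial>lborel)"
  proof (rule nn_integral_cong)
    fix s
    show "P \<tau> (\<lambda>y. indicator {0..t} s * P (t - s) (?G s) y) x = indicator {0..t} s * P (t + \<tau> - s) (?G s) x"
      using assms by (cases "s \<in> {0..t}") (auto simp: P_P algebra_simps)
  qed
  finally show ?thesis
    unfolding w.simps split by (subst nn_integral_add) (auto simp: add.assoc)
qed

text \<open>The times \<open>c s\<close> are arbitrary because P preserves constant upper bounds at
  any time.\<close>

lemma duhamel_le:
  assumes "0 \<le> a" "a \<le> b" "b \<le> T" and h: "\<And>s. 0 \<le> s \<Longrightarrow> s \<le> T \<Longrightarrow> h s \<le> B" and M: "0 \<le> M" "\<And>s y. a < s \<Longrightarrow> s \<le> b \<Longrightarrow> v s y \<le> ennreal M"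
  shows "(\<integral>\<^sup>+s. indicator {a<..b} s * P (c s) (\<lambda>y. H s * F (v s y)) x \<partial>lborel) \<le> ennreal ((b - a) * (B * f M))"
proof -
  have B: "0 \<le> B" using h[of 0] h_nonneg[of 0] assms(1-3) by linarith
  have "(\<integral>\<^sup>+s. indicator {a<..b} s * P (c s) (\<lambda>y. H s * F (v s y)) x \<partial>lborel)
     \<le> (\<integral>\<^sup>+s. ennreal (B * f M) * indicator {a<..b} s \<partial>lborel)"
  proof (rule nn_integral_mono)
    fix s
    show "indicator {a<..b} s * P (c s) (\<lambda>y. H s * F (v s y)) x \<le> ennreal (B * f M) * indicator {a<..b} s"
    proof (cases "s \<in> {a<..b}")
      case True
      have "H s \<le> ennreal B" unfolding H_def using True assms(1-3) h[of s] by (intro ennreal_leI) auto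
      then have "P (c s) (\<lambda>y. H s * F (v s y)) x \<le> ennreal B * ennreal (f M)"
        using True M by (intro P_le_const mult_mono F_le) auto
      then show ?thesis using True B f_nonneg[OF M(1)] by (simp add: ennreal_mult)
    qed simp
  qed
  also have "\<dots> = ennreal (B * f M) * ennreal (b - a)"
    using assms by (simp add: nn_integral_cmult)
  finally show ?thesis using B f_nonneg[OF M(1)] assms by (simp add: ennreal_mult[symmetric] mult.commute)
qed

text \<open>The step \<tau>0 is chosen before t, so a bound M at a time shortly before T extends
  past T. An almost everywhere bound at time t yields a bound everywhere at later times, because the
  kernel does not see null sets at positive times.\<close>

lemma W_restart_bound:
  assumes M: "0 < M"
  shows "\<exists>\<tau>0>0. \<forall>t. 0 \<le> t \<and> t \<le> R \<and> (AE x in lborel. W t x \<le> ennreal M) \<longrightarrow>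
     (\<forall>\<tau> x. 0 < \<tau> \<and> \<tau> \<le> \<tau>0 \<longrightarrow> W (t + \<tau>) x \<le> ennreal (2 * M))"
proof -
  obtain B where B: "B > 0" "\<And>t. 0 \<le> t \<Longrightarrow> t \<le> R + 1 \<Longrightarrow> h t \<le> B" using h_bounded[of "R + 1"] by blast
  have f2: "f (2 * M) > 0" using M by (intro f_pos) simp
  \<comment> \<open>Within time \<tau>0 the source adds at most \<tau>0 B f(2 M) \<le> M to the
    initial bound M, so the bound 2 M is reproduced by the iteration. The cap 1 keeps all times in
    [0, R + 1], where h \<le> B.\<close>
  define \<tau>0 where "\<tau>0 = min 1 (M / (B * f (2 * M)))"
  have \<tau>0: "\<tau>0 > 0" "\<tau>0 \<le> 1" using M B f2 by (auto simp: \<tau>0_def)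
  have \<tau>0': "\<tau>0 * (B * f (2 * M)) \<le> M"
  proof -
    have "\<tau>0 * (B * f (2 * M)) \<le> M / (B * f (2 * M)) * (B * f (2 * M))"
      unfolding \<tau>0_def using B f2 by (intro mult_right_mono) auto
    then show ?thesis using B f2 by simp
  qed
  have main: "w k (t + \<tau>) x \<le> ennreal (2 * M)"
    if t: "0 \<le> t" "t \<le> R" "AE x in lborel. W t x \<le> ennreal M" and \<tau>: "0 < \<tau>" "\<tau> \<le> \<tau>0" for k t \<tau> x
    using \<tau>
  proof (induction k arbitrary: \<tau> x)
    case (Suc k)
    have 1: "P \<tau> (w (Suc k) t) x \<le> ennreal M"
    proof (rule P_le_const_AE)
      show "AE y in lborel. w (Suc k) t y \<le> ennreal M"
        using t(3) by eventually_elim (rule order_trans[OF w_le_W])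
    qed (use Suc in simp)
    have "(\<integral>\<^sup>+s. indicator {t<..t + \<tau>} s * P (t + \<tau> - s) (\<lambda>y. H s * F (w k s y)) x \<partial>lborel) \<le> ennreal ((t + \<tau> - t) * (B * f (2 * M)))"
    proof (rule duhamel_le[where T = "R + 1"])
      show "w k s y \<le> ennreal (2 * M)" if "t < s" "s \<le> t + \<tau>" for s y
        using Suc.IH[of "s - t" y] that Suc.prems by simp
    qed (use t Suc.prems \<tau>0 B M in auto)
    also have "\<dots> \<le> ennreal M"
    proof (rule ennreal_leI)
      have "(t + \<tau> - t) * (B * f (2 * M)) \<le> \<tau>0 * (B * f (2 * M))"
        using Suc.prems B f2 by (intro mult_right_mono) auto
      then show "(t + \<tau> - t) * (B * f (2 * M)) \<le> M" using \<tau>0' by simp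
    qed
    finally have "w (Suc k) (t + \<tau>) x \<le> ennreal M + ennreal M"
      using 1 t Suc.prems by (subst w_restart) (auto intro!: add_mono simp del: w.simps)
    then show ?case using M by (subst (asm) ennreal_plus[symmetric]) (auto simp del: ennreal_plus w.simps)
  qed simp
  show ?thesis
    by (intro exI[of _ \<tau>0] conjI \<tau>0 allI impI; unfold W_def) (intro SUP_least main[unfolded W_def]; auto)
qed

definition bounded_until :: "real \<Rightarrow> bool" where
  "bounded_until T \<longleftrightarrow> 0 \<le> T \<and> (\<exists>M>0. \<forall>t x. 0 \<le> t \<and> t \<le> T \<longrightarrow> W t x \<le> ennreal M)"

lemma bounded_until_mono: "bounded_until T \<Longrightarrow> 0 \<le> S \<Longrightarrow> S \<le> T \<Longrightarrow> bounded_until S"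
  unfolding bounded_until_def by (meson order_trans)

lemma bounded_until_extend:
  assumes T: "bounded_until T" and M: "0 < M" "AE x in lborel. W T x \<le> ennreal M"
    and \<tau>: "0 < \<tau>" "\<And>s x. 0 < s \<Longrightarrow> s \<le> \<tau> \<Longrightarrow> W (T + s) x \<le> ennreal (2 * M)"
  shows "bounded_until (T + \<tau>)"
proof -
  obtain M' where M': "M' > 0" "\<And>t x. 0 \<le> t \<Longrightarrow> t \<le> T \<Longrightarrow> W t x \<le> ennreal M'"
    using T unfolding bounded_until_def by blast
  have "W t x \<le> ennreal (max M' (2 * M))" if "0 \<le> t" "t \<le> T + \<tau>" for t x
  proof (cases "t \<le> T")
    case True
    then show ?thesis using order_trans[OF M'(2)[of t x] ennreal_leI[of M' "max M' (2 * M)"]] that by simp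
  next
    case False
    then show ?thesis using order_trans[OF \<tau>(2)[of "t - T" x] ennreal_leI[of "2 * M" "max M' (2 * M)"]] that by simp
  qed
  then show ?thesis using T \<tau> M'(1) unfolding bounded_until_def by (intro conjI exI[of _ "max M' (2 * M)"]) auto
qed

lemma bounded_until_small: "\<exists>T>0. bounded_until T"
proof -
  let ?M = "max U0 1"
  have W0: "W 0 x \<le> ennreal ?M" for x by (rule order_trans[OF W_0]) (simp add: ennreal_leI)
  have "bounded_until 0"
    unfolding bounded_until_def using W0 by (intro conjI exI[of _ ?M]) (auto dest: antisym)
  obtain \<tau>0 where \<tau>0: "\<tau>0 > 0" "\<forall>t. 0 \<le> t \<and> t \<le> 0 \<and> (AE x in lborel. W t x \<le> ennreal ?M) \<longrightarrow>
     (\<forall>\<tau> x. 0 < \<tau> \<and> \<tau> \<le> \<tau>0 \<longrightarrow> W (t + \<tau>) x \<le> ennreal (2 * ?M))"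
    using W_restart_bound[of ?M 0] by (metis max.strict_coboundedI2 zero_less_one)
  have "bounded_until (0 + \<tau>0)"
    by (rule bounded_until_extend[OF \<open>bounded_until 0\<close>, of ?M]) (use \<tau>0 W0 in auto)
  then show ?thesis using \<tau>0(1) by auto
qed

text \<open>T is the supremum of the bounded times. If W were essentially below M at a time closer
  to T than the restart step for M, it would be bounded past T; hence divergence holds for the full
  left limit and not merely along a sequence.\<close>

lemma blow_up_time:
  assumes "\<exists>T\<ge>0. \<not> bounded_until T"
  obtains (time) T where "0 < T" "\<And>t. 0 \<le> t \<Longrightarrow> t < T \<Longrightarrow> bounded_until t"
    "\<And>M. eventually (\<lambda>t. \<not> (AE x in lborel. W t x \<le> ennreal M)) (at_left T)"
proof -
  obtain T1 where T1: "T1 \<ge> 0" "\<not> bounded_until T1" using assms by blast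
  define T where "T = Sup {t. bounded_until t}"
  obtain t0 where t0: "t0 > 0" "bounded_until t0" using bounded_until_small by blast
  have bdd: "bdd_above {t. bounded_until t}"
    using T1 bounded_until_mono by (intro bdd_aboveI[of _ T1]) (metis linorder_le_cases mem_Collect_eq)
  have le: "t \<le> T" if "bounded_until t" for t unfolding T_def using that bdd by (intro cSup_upper) auto
  have Tpos: "0 < T" using le[OF t0(2)] t0(1) by simp
  have below: "bounded_until t" if t: "0 \<le> t" "t < T" for t
  proof -
    obtain s where "bounded_until s" "t < s"
      using t(2) t0 less_cSup_iff[OF _ bdd, of t] unfolding T_def by auto
    then show ?thesis using t(1) bounded_until_mono by (meson less_imp_le)
  qed
  have blow: "eventually (\<lambda>t. \<not> (AE x in lborel. W t x \<le> ennreal M)) (at_left T)" for M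
  proof -
    let ?M = "max M 1"
    have M1: "0 < ?M" by simp
    obtain \<tau>0 where \<tau>0: "\<tau>0 > 0" "\<And>t \<tau> x. 0 \<le> t \<Longrightarrow> t \<le> T \<Longrightarrow> (AE x in lborel. W t x \<le> ennreal ?M) \<Longrightarrow>
       0 < \<tau> \<Longrightarrow> \<tau> \<le> \<tau>0 \<Longrightarrow> W (t + \<tau>) x \<le> ennreal (2 * ?M)"
      using W_restart_bound[OF M1, of T] by blast
    have "\<not> (AE x in lborel. W t x \<le> ennreal M)" if t: "max 0 (T - \<tau>0) < t" "t < T" for t
    proof
      assume "AE x in lborel. W t x \<le> ennreal M"
      then have AE: "AE x in lborel. W t x \<le> ennreal ?M"
        by eventually_elim (auto intro: order_trans ennreal_leI)
      have "bounded_until (t + \<tau>0)"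
        by (rule bounded_until_extend[OF below _ AE]) (use t \<tau>0 AE in auto)
      from le[OF this] show False using t by simp
    qed
    then show ?thesis
      using Tpos \<tau>0(1) by (intro eventually_at_leftI[of "max 0 (T - \<tau>0)"]) auto
  qed
  show ?thesis by (rule time[OF Tpos below blow])
qed

end

section \<open>The minimal solution as a mild solution, continuous in time\<close>

context semilinear
begin

definition u :: "real \<Rightarrow> 'a \<Rightarrow> real" where "u t x = enn2real (W t x)"

lemma u_nonneg [simp]: "0 \<le> u t x"
  by (simp add: u_def)

lemma borel_measurable_u [measurable (raw)]:
  assumes [measurable]: "a \<in> borel_measurable M" "b \<in> borel_measurable M"
  shows "(\<lambda>z. u (a z) (b z)) \<in> borel_measurable M"
  unfolding u_def by measurable

definition J :: "real \<Rightarrow> 'a \<Rightarrow> ennreal" where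
  "J t x = (\<integral>\<^sup>+s. indicator {0..t} s * P (t - s) (\<lambda>y. H s * F (W s y)) x \<partial>lborel)"

context
  fixes T M B :: real
  assumes T: "0 \<le> T" and M: "0 < M" and W_le: "\<And>t x. 0 \<le> t \<Longrightarrow> t \<le> T \<Longrightarrow> W t x \<le> ennreal M"
    and B: "0 < B" and h_le: "\<And>t. 0 \<le> t \<Longrightarrow> t \<le> T \<Longrightarrow> h t \<le> B"
begin

lemma W_u: "0 \<le> t \<Longrightarrow> t \<le> T \<Longrightarrow> W t x = ennreal (u t x)"
  unfolding u_def using le_less_trans[OF W_le[of t x] ennreal_less_top] by simp

lemma u_le: "0 \<le> t \<Longrightarrow> t \<le> T \<Longrightarrow> u t x \<le> M"
  using W_le[of t x] M by (simp add: W_u)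

lemma source_eq: "0 \<le> s \<Longrightarrow> s \<le> T \<Longrightarrow> H s * F (W s y) = ennreal (h s * f (u s y))"
  by (simp add: H_def W_u F_ennreal ennreal_mult h_nonneg f_nonneg)

lemma source_le: "0 \<le> s \<Longrightarrow> s \<le> T \<Longrightarrow> H s * F (W s y) \<le> ennreal (B * f M)"
  using h_le[of s] h_nonneg[of s] u_le[of s y] B M
  by (auto simp: source_eq intro!: ennreal_leI mult_mono f_mono f_nonneg)

lemma J_finite:
  assumes "0 \<le> t" "t \<le> T"
  shows "J t x < \<top>"
proof -
  have "J t x \<le> (\<integral>\<^sup>+s. ennreal (B * f M) * indicator {0..t} s \<partial>lborel)"
    unfolding J_def
  proof (rule nn_integral_mono)
    fix s
    show "indicator {0..t} s * P (t - s) (\<lambda>y. H s * F (W s y)) x \<le> ennreal (B * f M) * indicator {0..t} s"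
      using assms by (cases "s \<in> {0..t}") (auto intro!: P_le_const source_le)
  qed
  also have "\<dots> < \<top>" using assms by (simp add: nn_integral_cmult ennreal_mult_less_top)
  finally show ?thesis .
qed

lemma W_eq_J: "0 \<le> t \<Longrightarrow> t \<le> T \<Longrightarrow> W t x = P t (\<lambda>y. ennreal (u0 y)) x + J t x"
  unfolding J_def by (rule W_eq) (auto intro: le_less_trans[OF W_le])

text \<open>Transfers the equation for W to real integrals. Finiteness on [0, T] guarantees that
  \<open>enn2real\<close> loses nothing.\<close>

lemma mild_equation:
  assumes t: "0 \<le> t" "t \<le> T"
  shows "u t x = enn2real (P t (\<lambda>y. ennreal (u0 y)) x)
     + (LINT s:{0..t}|lborel. enn2real (P (t - s) (\<lambda>y. ennreal (h s * f (u s y))) x))"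
proof -
  let ?g = "\<lambda>s. indicator {0..t} s * P (t - s) (\<lambda>y. H s * F (W s y)) x"
  have gle: "?g s < \<top>" for s
  proof (cases "s \<in> {0..t}")
    case True
    then have "?g s \<le> ennreal (B * f M)" using t by (auto intro!: P_le_const source_le)
    then show ?thesis by (rule le_less_trans) simp
  qed simp
  have eq: "indicator {0..t} s *\<^sub>R enn2real (P (t - s) (\<lambda>y. ennreal (h s * f (u s y))) x) = enn2real (?g s)" for s
    using t by (cases "s \<in> {0..t}") (auto simp: source_eq)
  have "(LINT s:{0..t}|lborel. enn2real (P (t - s) (\<lambda>y. ennreal (h s * f (u s y))) x)) = (LINT s|lborel. enn2real (?g s))"
    unfolding set_lebesgue_integral_def eq ..
  also have "\<dots> = enn2real (\<integral>\<^sup>+s. ennreal (enn2real (?g s)) \<partial>lborel)"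
    by (rule integral_eq_nn_integral) auto
  also have "(\<integral>\<^sup>+s. ennreal (enn2real (?g s)) \<partial>lborel) = J t x"
    unfolding J_def using gle by (intro nn_integral_cong) simp
  finally have "(LINT s:{0..t}|lborel. enn2real (P (t - s) (\<lambda>y. ennreal (h s * f (u s y))) x)) = enn2real (J t x)" .
  moreover have "P t (\<lambda>y. ennreal (u0 y)) x < \<top>"
    by (rule le_less_trans[OF P_le_const[of _ "ennreal U0"]]) (simp_all add: u0_le ennreal_leI)
  ultimately show ?thesis
    unfolding u_def W_eq_J[OF t] using J_finite[OF t, of x] by (simp add: enn2real_plus)
qed

text \<open>The names p and q stand for a and b in either order, which gives both halves of the
  comparison. The difference of the kernels at times b - s and a - s is measured in L^1 and then
  integrated over s.\<close>

lemma duhamel_D_le: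
  assumes ab: "0 \<le> a" "a \<le> b" "b \<le> T" and p: "p = a \<and> q = b \<or> p = b \<and> q = a"
  shows "(\<integral>\<^sup>+s. indicator {0..a} s * P (p - s) (\<lambda>y. H s * F (W s y)) x \<partial>lborel)
    \<le> (\<integral>\<^sup>+s. indicator {0..a} s * P (q - s) (\<lambda>y. H s * F (W s y)) x \<partial>lborel) + ennreal (B * f M) * DT T (b - a)"
proof -
  let ?C = "ennreal (B * f M)"
  have "(\<integral>\<^sup>+s. indicator {0..a} s * P (p - s) (\<lambda>y. H s * F (W s y)) x \<partial>lborel)
     \<le> (\<integral>\<^sup>+s. indicator {0..a} s * P (q - s) (\<lambda>y. H s * F (W s y)) x + ?C * (indicator {0..<a} s * D (b - s) (a - s)) \<partial>lborel)"
  \<comment> \<open>The instant s = a is a null set. There the time a - s is 0, P is the identity,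
    and the L^1 distance of kernels gives no control.\<close>
  proof (rule nn_integral_mono_AE, rule AE_mp[OF AE_lborel_singleton[of a]], rule AE_I2, rule impI)
    fix s assume "s \<noteq> a"
    show "indicator {0..a} s * P (p - s) (\<lambda>y. H s * F (W s y)) x
      \<le> indicator {0..a} s * P (q - s) (\<lambda>y. H s * F (W s y)) x + ?C * (indicator {0..<a} s * D (b - s) (a - s))"
    proof (cases "s \<in> {0..a}")
      case True
      have "P (p - s) (\<lambda>y. H s * F (W s y)) x \<le> P (q - s) (\<lambda>y. H s * F (W s y)) x + ?C * D (p - s) (q - s)"
        using True \<open>s \<noteq> a\<close> ab p by (intro P_le_P_D source_le) auto
      moreover have "D (p - s) (q - s) = D (b - s) (a - s)" using p D_commute by auto
      ultimately show ?thesis using True \<open>s \<noteq> a\<close> by simp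
    qed simp
  qed
  also have "\<dots> = (\<integral>\<^sup>+s. indicator {0..a} s * P (q - s) (\<lambda>y. H s * F (W s y)) x \<partial>lborel)
     + ?C * (\<integral>\<^sup>+s. indicator {0..<a} s * D (b - s) (a - s) \<partial>lborel)"
    by (simp add: nn_integral_add nn_integral_cmult)
  also have "(\<integral>\<^sup>+s. indicator {0..<a} s * D (b - s) (a - s) \<partial>lborel) = (\<integral>\<^sup>+r. indicator {0<..a} r * D (r + (b - a)) r \<partial>lborel)"
  proof -
    have "indicator {0..<a} (a - r) * D (b - (a - r)) (a - (a - r)) = indicator {0<..a} r * D (r + (b - a)) r" for r
      by (auto simp: indicator_def algebra_simps)
    then show ?thesis
      using lborel_nn_integral_affine[of "-1" "\<lambda>s. indicator {0..<a} s * D (b - s) (a - s)" a] by simp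
  qed
  also have "\<dots> \<le> DT T (b - a)"
    unfolding DT_def using ab by (intro nn_integral_mono mult_right_mono) (auto simp: indicator_def)
  finally show ?thesis by (simp add: mult_left_mono add_left_mono)
qed

text \<open>After a the source is bounded by B f(M); before a only the change of the kernel counts.
  The error is the same for all x.\<close>

lemma J_modulus:
  assumes ab: "0 \<le> a" "a \<le> b" "b \<le> T"
  defines "e \<equiv> ennreal (B * f M) * (DT T (b - a) + ennreal (b - a))"
  shows "J b x \<le> J a x + e" "J a x \<le> J b x + e"
proof -
  let ?G = "\<lambda>s y. H s * F (W s y)"
  let ?C = "ennreal (B * f M)"
  have split: "indicator {0..b} s * P (b - s) (?G s) x
     = indicator {0..a} s * P (b - s) (?G s) x + indicator {a<..b} s * P (b - s) (?G s) x" for s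
    using ab by (auto simp: indicator_def)
  have Jb: "J b x = (\<integral>\<^sup>+s. indicator {0..a} s * P (b - s) (?G s) x \<partial>lborel) + (\<integral>\<^sup>+s. indicator {a<..b} s * P (b - s) (?G s) x \<partial>lborel)"
    unfolding J_def split by (rule nn_integral_add) measurable
  have "(\<integral>\<^sup>+s. indicator {a<..b} s * P (b - s) (?G s) x \<partial>lborel) \<le> ennreal ((b - a) * (B * f M))"
    by (rule duhamel_le[where T = T]) (use ab M W_le h_le in auto)
  also have "\<dots> = ?C * ennreal (b - a)"
    using ab B M f_nonneg[of M] by (simp add: ennreal_mult[symmetric] mult.commute)
  finally have tail: "(\<integral>\<^sup>+s. indicator {a<..b} s * P (b - s) (?G s) x \<partial>lborel) \<le> ?C * ennreal (b - a)" .
  have "J b x \<le> (J a x + ?C * DT T (b - a)) + ?C * ennreal (b - a)"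
    unfolding Jb by (intro add_mono tail) (use duhamel_D_le[OF ab, of b a] in \<open>simp add: J_def\<close>)
  then show "J b x \<le> J a x + e" by (simp add: e_def distrib_left add.assoc)
  have "J a x \<le> (\<integral>\<^sup>+s. indicator {0..a} s * P (b - s) (?G s) x \<partial>lborel) + ?C * DT T (b - a)"
    using duhamel_D_le[OF ab, of a b] by (simp add: J_def)
  also have "\<dots> \<le> J b x + e"
    unfolding Jb e_def distrib_left by (intro add_mono) auto
  finally show "J a x \<le> J b x + e" .
qed

lemma P_u0_tendsto:
  assumes t: "0 \<le> t" and X: "X \<longlonglongrightarrow> t" "\<And>n. 0 \<le> X n" and \<epsilon>: "0 < \<epsilon>"
  shows "eventually (\<lambda>n. \<forall>x. P (X n) (\<lambda>y. ennreal (u0 y)) x \<le> P t (\<lambda>y. ennreal (u0 y)) x + ennreal \<epsilon>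
    \<and> P t (\<lambda>y. ennreal (u0 y)) x \<le> P (X n) (\<lambda>y. ennreal (u0 y)) x + ennreal \<epsilon>) sequentially"
proof (cases "t = 0")
  case True
  \<comment> \<open>Zero entries are replaced by positive times, for which concentration is stated;
    where X n = 0 the claim is immediate.\<close>
  define Y where "Y n = (if X n = 0 then inverse (real (Suc n)) else X n)" for n
  have Ypos: "0 < Y n" for n using X(2)[of n] by (simp add: Y_def)
  have "Y \<longlonglongrightarrow> 0"
  proof (rule tendsto_sandwich[OF always_eventually always_eventually tendsto_const])
    show "(\<lambda>n. X n + inverse (real (Suc n))) \<longlonglongrightarrow> 0"
      using tendsto_add[OF X(1) LIMSEQ_inverse_real_of_nat] True by simp
  qed (use X(2) Ypos in \<open>auto simp: Y_def less_imp_le\<close>)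
  from P_uniformly_tendsto_0[OF u0_continuous u0_nonneg u0_le this Ypos \<epsilon>]
  show ?thesis
  proof eventually_elim
    case (elim n)
    then show ?case using True by (cases "X n = 0") (auto simp: Y_def)
  qed
next
  case False
  then have t: "0 < t" using t by simp
  have "(\<lambda>n. ennreal U0 * D (X n) t) \<longlonglongrightarrow> ennreal U0 * 0"
    by (intro ennreal_tendsto_cmult D_tendsto t X) simp
  then have "eventually (\<lambda>n. ennreal U0 * D (X n) t < ennreal \<epsilon>) sequentially"
    using \<epsilon> by (intro order_tendstoD(2)) auto
  with order_tendstoD(1)[OF X(1) t] show ?thesis
  proof eventually_elim
    case (elim n)
    have "P (X n) (\<lambda>y. ennreal (u0 y)) x \<le> P t (\<lambda>y. ennreal (u0 y)) x + ennreal U0 * D (X n) t" for x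
      by (rule P_le_P_D) (use elim t u0_le in \<open>auto intro: ennreal_leI\<close>)
    moreover have "P t (\<lambda>y. ennreal (u0 y)) x \<le> P (X n) (\<lambda>y. ennreal (u0 y)) x + ennreal U0 * D (X n) t" for x
      unfolding D_commute[of "X n"] by (rule P_le_P_D) (use elim t u0_le in \<open>auto intro: ennreal_leI\<close>)
    moreover have "a + ennreal U0 * D (X n) t \<le> a + ennreal \<epsilon>" for a
      using elim(2) by (intro add_left_mono) simp
    ultimately show ?case by (meson order_trans)
  qed
qed

lemma u_tendsto:
  assumes t: "0 \<le> t" "t \<le> T" and X: "X \<longlonglongrightarrow> t" "\<And>n. 0 \<le> X n" "\<And>n. X n \<le> T" and \<epsilon>: "0 < \<epsilon>"
  shows "eventually (\<lambda>n. \<forall>x. \<bar>u (X n) x - u t x\<bar> \<le> \<epsilon>) sequentially"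
proof -
  define e where "e n = ennreal (B * f M) * (DT T \<bar>X n - t\<bar> + ennreal \<bar>X n - t\<bar>)" for n
  have X0: "(\<lambda>n. \<bar>X n - t\<bar>) \<longlonglongrightarrow> 0" using X(1) by (simp add: LIM_zero_iff tendsto_rabs_zero_iff)
  have "(\<lambda>n. DT T \<bar>X n - t\<bar> + ennreal \<bar>X n - t\<bar>) \<longlonglongrightarrow> 0 + ennreal 0"
    by (intro tendsto_add DT_tendsto T X0 tendsto_ennrealI) simp
  then have "e \<longlonglongrightarrow> ennreal (B * f M) * (0 + ennreal 0)"
    unfolding e_def by (intro ennreal_tendsto_cmult) auto
  then have "eventually (\<lambda>n. e n < ennreal (\<epsilon> / 2)) sequentially"
    using \<epsilon> by (intro order_tendstoD(2)) auto
  moreover have "eventually (\<lambda>n. \<forall>x. P (X n) (\<lambda>y. ennreal (u0 y)) x \<le> P t (\<lambda>y. ennreal (u0 y)) x + ennreal (\<epsilon> / 2)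
    \<and> P t (\<lambda>y. ennreal (u0 y)) x \<le> P (X n) (\<lambda>y. ennreal (u0 y)) x + ennreal (\<epsilon> / 2)) sequentially"
    using \<epsilon> by (intro P_u0_tendsto t X) simp
  ultimately show ?thesis
  proof eventually_elim
    case (elim n)
    show ?case
    proof
      fix x
      have J: "J (X n) x \<le> J t x + e n \<and> J t x \<le> J (X n) x + e n"
        using J_modulus[of "X n" t x] J_modulus[of t "X n" x] t X(2,3)[of n]
        by (cases "X n \<le> t") (auto simp: e_def abs_minus_commute)
      have half: "ennreal (\<epsilon> / 2) + ennreal (\<epsilon> / 2) = ennreal \<epsilon>" using \<epsilon> by (subst ennreal_plus[symmetric]) auto
      have "W (X n) x \<le> (P t (\<lambda>y. ennreal (u0 y)) x + ennreal (\<epsilon> / 2)) + (J t x + ennreal (\<epsilon> / 2))"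
        unfolding W_eq_J[OF X(2,3)] using J elim(1) elim(2)[rule_format, of x]
        by (intro add_mono) (auto intro: order_trans add_left_mono less_imp_le)
      also have "\<dots> = W t x + ennreal \<epsilon>" unfolding W_eq_J[OF t] half[symmetric] by (simp only: ac_simps)
      finally have 1: "u (X n) x \<le> u t x + \<epsilon>"
        using \<epsilon> by (simp add: W_u t X(2,3) ennreal_plus[symmetric] del: ennreal_plus)
      have "W t x \<le> (P (X n) (\<lambda>y. ennreal (u0 y)) x + ennreal (\<epsilon> / 2)) + (J (X n) x + ennreal (\<epsilon> / 2))"
        unfolding W_eq_J[OF t] using J elim(1) elim(2)[rule_format, of x]
        by (intro add_mono) (auto intro: order_trans add_left_mono less_imp_le)
      also have "\<dots> = W (X n) x + ennreal \<epsilon>" unfolding W_eq_J[OF X(2,3)] half[symmetric] by (simp only: ac_simps)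
      finally have 2: "u t x \<le> u (X n) x + \<epsilon>"
        using \<epsilon> by (simp add: W_u t X(2,3) ennreal_plus[symmetric] del: ennreal_plus)
      show "\<bar>u (X n) x - u t x\<bar> \<le> \<epsilon>" using 1 2 by linarith
    qed
  qed
qed

end

end

section \<open>Blow-up\<close>

lemma minorant_mult_le:
  assumes nn: "\<And>u. 0 \<le> u \<Longrightarrow> 0 \<le> f u" and pos: "\<And>u. 0 < u \<Longrightarrow> 0 < f u" and \<alpha>: "0 < \<alpha>" "\<alpha> < 1" and u: "0 \<le> u"
  shows "f \<alpha> * minorant f u \<le> f (\<alpha> * u)"
proof -
  have "minorant f u \<le> f (\<alpha> * u) / f \<alpha>"
    unfolding minorant_def
  proof (rule cINF_lower)
    show "bdd_below ((\<lambda>\<alpha>. f (\<alpha> * u) / f \<alpha>) ` {0<..<1})"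
      by (rule bdd_belowI2[of _ 0]) (use nn pos u in \<open>auto intro!: divide_nonneg_nonneg simp: less_imp_le\<close>)
  qed (use \<alpha> in auto)
  then show ?thesis using pos[OF \<alpha>(1)] by (simp add: field_simps)
qed

lemma (in convex_source) minorant_ge_1: "1 \<le> u \<Longrightarrow> 1 \<le> minorant f u"
  unfolding minorant_def
  by (rule cINF_greatest) (auto simp: f_pos intro!: f_mono)

lemma (in convex_source) minorant_mono: "0 \<le> a \<Longrightarrow> a \<le> b \<Longrightarrow> minorant f a \<le> minorant f b"
  unfolding minorant_def
  by (rule cINF_mono)
     (auto intro!: bdd_belowI[of _ 0] divide_nonneg_nonneg f_nonneg divide_right_mono f_mono bexI mult_left_mono)

text \<open>For u \<le> 1 monotonicity of f bounds the quotients by 1, so the supremum is a genuine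
  one.\<close>

lemma (in convex_source) majorant_mult_ge:
  assumes \<alpha>: "0 < \<alpha>" "\<alpha> < 1" and u: "0 \<le> u" "u \<le> 1"
  shows "f (\<alpha> * u) \<le> majorant f u * f \<alpha>"
proof -
  have "f (\<alpha> * u) / f \<alpha> \<le> majorant f u"
    unfolding majorant_def
  proof (rule cSUP_upper)
    show "bdd_above ((\<lambda>\<alpha>. f (\<alpha> * u) / f \<alpha>) ` {0<..<1})"
    proof (rule bdd_aboveI2)
      fix \<beta> :: real assume \<beta>: "\<beta> \<in> {0<..<1}"
      then have "f (\<beta> * u) \<le> f \<beta>" using u by (intro f_mono) (auto intro: mult_left_le)
      then show "f (\<beta> * u) / f \<beta> \<le> 1" using \<beta> f_pos[of \<beta>] by simp
    qed
  qed (use \<alpha> in auto)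
  then show ?thesis using f_pos[OF \<alpha>(1)] by (simp add: field_simps)
qed

text \<open>Osgood-type estimate for \<open>z' \<ge> g(z) b\<close> with \<open>g\<close> merely monotone: \<open>b\<close> is summed over the
  times at which \<open>z\<close> doubles, so that no change of variables is needed.\<close>

lemma osgood_bound:
  fixes g z :: "real \<Rightarrow> real" and b :: "real \<Rightarrow> ennreal"
  assumes b [measurable]: "b \<in> borel_measurable borel"
    and g1: "\<And>x. 1 \<le> x \<Longrightarrow> 0 < g x" and gmono: "\<And>x y. 1 \<le> x \<Longrightarrow> x \<le> y \<Longrightarrow> g x \<le> g y"
    and z: "\<And>T. continuous_on {1..T} z" "z 1 = 1"
    and step: "\<And>s t. 1 \<le> s \<Longrightarrow> s \<le> t \<Longrightarrow> ennreal (g (z s)) * (\<integral>\<^sup>+r. indicator {s..t} r * b r \<partial>lborel) \<le> ennreal (z t - z s)"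
    and T: "1 \<le> T"
  shows "(\<integral>\<^sup>+r. indicator {1..T} r * b r \<partial>lborel)
    \<le> ennreal (1 / g 1) + 2 * (\<integral>\<^sup>+x. ennreal (1 / g x) * indicator {1..} x \<partial>lborel)"
proof -
  \<comment> \<open>Bounds the integral of b while z grows from 2^k to at most 2^(k+1): the
    increment of z is at most 2^k, and g is taken at the starting value 2^k.\<close>
  define c where "c k = ennreal (2 ^ k / g (2 ^ k))" for k :: nat
  have div: "A \<le> ennreal (a / x)" if "ennreal x * A \<le> ennreal a" "0 < x" "0 \<le> a" for A a x
  proof -
    have "A = ennreal (1 / x) * (ennreal x * A)"
      using that by (simp add: mult.assoc[symmetric] ennreal_mult[symmetric])
    also have "\<dots> \<le> ennreal (1 / x) * ennreal a" by (intro mult_left_mono that) simp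
    also have "\<dots> = ennreal (a / x)" using that by (simp add: ennreal_mult[symmetric])
    finally show ?thesis .
  qed
  have claim: "(\<integral>\<^sup>+r. indicator {1..T} r * b r \<partial>lborel) \<le> (\<Sum>k<n. c k)" if "1 \<le> T" "z T \<le> 2 ^ n" for n T
    using that
  proof (induction n arbitrary: T)
    case 0
    then have "ennreal (g 1) * (\<integral>\<^sup>+r. indicator {1..T} r * b r \<partial>lborel) \<le> 0"
      using step[of 1 T] z(2) by (simp add: ennreal_neg)
    then show ?case using g1[of 1] by (simp add: ennreal_neg not_le)
  next
    case (Suc n)
    show ?case
    proof (cases "z T \<le> 2 ^ n")
      case True
      then show ?thesis using Suc.IH[of T] Suc.prems by (simp add: add_increasing2)
    next
      case False
      \<comment> \<open>A time at which z equals 2^n: the induction hypothesis covers [1, S] and one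
        use of \<open>step\<close> covers [S, T].\<close>
      have "\<exists>S. 1 \<le> S \<and> S \<le> T \<and> z S = 2 ^ n"
        using False Suc.prems z by (intro IVT') auto
      then obtain S where S: "1 \<le> S" "S \<le> T" "z S = 2 ^ n" by blast
      have "(\<integral>\<^sup>+r. indicator {1..T} r * b r \<partial>lborel)
         \<le> (\<integral>\<^sup>+r. indicator {1..S} r * b r + indicator {S..T} r * b r \<partial>lborel)"
        using S by (intro nn_integral_mono) (auto simp: indicator_def)
      also have "\<dots> = (\<integral>\<^sup>+r. indicator {1..S} r * b r \<partial>lborel) + (\<integral>\<^sup>+r. indicator {S..T} r * b r \<partial>lborel)"
        by (rule nn_integral_add) measurable
      also have "\<dots> \<le> (\<Sum>k<n. c k) + c n"
      proof (intro add_mono)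
        show "(\<integral>\<^sup>+r. indicator {1..S} r * b r \<partial>lborel) \<le> (\<Sum>k<n. c k)" using Suc.IH[of S] S by simp
        have "ennreal (g (2 ^ n)) * (\<integral>\<^sup>+r. indicator {S..T} r * b r \<partial>lborel) \<le> ennreal (z T - z S)"
          using step[of S T] S by simp
        also have "\<dots> \<le> ennreal (2 ^ n)" using Suc.prems S by (intro ennreal_leI) simp
        finally show "(\<integral>\<^sup>+r. indicator {S..T} r * b r \<partial>lborel) \<le> c n"
          unfolding c_def by (rule div) (auto intro: g1)
      qed
      finally show ?thesis by simp
    qed
  qed
  \<comment> \<open>Continued constantly to the left of 1, the function 1 / g is monotone on the
    whole line and therefore measurable.\<close>
  define q where "q x = ennreal (1 / g (max 1 x))" for x
  have "antimono (\<lambda>x. 1 / g (max 1 x))"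
    by (intro antimonoI divide_left_mono gmono mult_pos_pos g1) auto
  then have "mono (\<lambda>x. - (1 / g (max 1 x)))" by (auto simp: monotone_def)
  from borel_measurable_mono[OF this] have "(\<lambda>x. - (- (1 / g (max 1 x)))) \<in> borel_measurable borel"
    by (rule borel_measurable_uminus)
  then have [measurable]: "(\<lambda>x. 1 / g (max 1 x)) \<in> borel_measurable borel" by simp
  have [measurable]: "q \<in> borel_measurable borel" unfolding q_def by measurable
  \<comment> \<open>The term 2^(n+1) / g(2^(n+1)) is at most twice the integral of 1 / g over
    [2^n, 2^(n+1)], since g is nondecreasing. The term c 0 would require an interval to the left of
    1 and is therefore kept apart.\<close>
  have csum: "(\<Sum>k<n. c (Suc k)) \<le> 2 * (\<integral>\<^sup>+x. indicator {1..<2 ^ n} x * q x \<partial>lborel)" for n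
  proof (induction n)
    case (Suc n)
    have q: "ennreal (1 / g (2 ^ Suc n)) \<le> q x" if "2 ^ n \<le> x" "x < 2 ^ Suc n" for x
    proof -
      have "1 \<le> x" using that(1) by (meson one_le_power one_le_numeral order_trans)
      then show ?thesis unfolding q_def using that
        by (intro ennreal_leI divide_left_mono mult_pos_pos g1 gmono) auto
    qed
    have "c (Suc n) = 2 * (ennreal (1 / g (2 ^ Suc n)) * ennreal (2 ^ n))"
    proof -
      have "0 < g (2 ^ Suc n)" by (rule g1) (rule one_le_power, simp)
      then have "2 * (ennreal (1 / g (2 ^ Suc n)) * ennreal (2 ^ n)) = ennreal (2 * (1 / g (2 ^ Suc n) * 2 ^ n))"
        unfolding ennreal_numeral[of "num.Bit0 num.One", symmetric] by (simp only: ennreal_mult zero_le_numeral zero_le_power zero_le_divide_1_iff less_imp_le mult_nonneg_nonneg)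
      then show ?thesis by (simp add: c_def)
    qed
    also have "ennreal (1 / g (2 ^ Suc n)) * ennreal (2 ^ n) = (\<integral>\<^sup>+x. ennreal (1 / g (2 ^ Suc n)) * indicator {2 ^ n..<2 ^ Suc n} x \<partial>(lborel::real measure))"
      by (simp add: nn_integral_cmult)
    also have "\<dots> \<le> (\<integral>\<^sup>+x. indicator {2 ^ n..<2 ^ Suc n} x * q x \<partial>lborel)"
      by (intro nn_integral_mono) (auto simp: indicator_def intro: q[simplified])
    finally have "c (Suc n) \<le> 2 * (\<integral>\<^sup>+x. indicator {2 ^ n..<2 ^ Suc n} x * q x \<partial>lborel)"
      by (simp add: mult_left_mono)
    then have "(\<Sum>k<Suc n. c (Suc k)) \<le> 2 * (\<integral>\<^sup>+x. indicator {1..<2 ^ n} x * q x \<partial>lborel) + 2 * (\<integral>\<^sup>+x. indicator {2 ^ n..<2 ^ Suc n} x * q x \<partial>lborel)"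
      using Suc by (simp add: add_mono)
    also have "\<dots> = 2 * (\<integral>\<^sup>+x. indicator {1..<2 ^ n} x * q x + indicator {2 ^ n..<2 ^ Suc n} x * q x \<partial>lborel)"
      by (subst nn_integral_add) (auto simp: distrib_left)
    also have "\<dots> = 2 * (\<integral>\<^sup>+x. indicator {1..<2 ^ Suc n} x * q x \<partial>lborel)"
    proof -
      have "indicator {1..<a} x * q x + indicator {a..<b} x * q x = indicator {1..<b} x * q x" if "1 \<le> a" "a \<le> b" for a b x
        using that by (auto simp: indicator_def)
      from this[of "2 ^ n" "2 ^ Suc n"] have "indicator {1..<2 ^ n} x * q x + indicator {2 ^ n..<2 ^ Suc n} x * q x = indicator {1..<2 ^ Suc n} x * q x" for x
        by simp
      then show ?thesis by simp
    qed
    finally show ?case .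
  qed simp
  obtain n :: nat where n: "z T \<le> 2 ^ n"
    using real_arch_pow[of 2 "z T"] by (auto intro: less_imp_le)
  have "(\<integral>\<^sup>+r. indicator {1..T} r * b r \<partial>lborel) \<le> (\<Sum>k<Suc n. c k)"
    using claim[OF T n] by (simp add: add_increasing2)
  also have "\<dots> = c 0 + (\<Sum>k<n. c (Suc k))" by (rule sum.lessThan_Suc_shift)
  also have "\<dots> \<le> c 0 + 2 * (\<integral>\<^sup>+x. indicator {1..<2 ^ n} x * q x \<partial>lborel)" by (intro add_left_mono csum)
  also have "\<dots> \<le> c 0 + 2 * (\<integral>\<^sup>+x. ennreal (1 / g x) * indicator {1..} x \<partial>lborel)"
    by (intro add_left_mono mult_left_mono nn_integral_mono) (auto simp: indicator_def q_def max_absorb2)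
  finally show ?thesis by (simp add: c_def)
qed

context semilinear
begin

text \<open>\<open>\<psi> t\<close> is a test function of width \<open>t\<^bsup>1/2\<sigma>\<^esup>\<close>. The constant \<open>c\<close> lost when \<open>\<psi> t\<close> is moved back
  to an earlier time does not accumulate, because Duhamel's formula always starts at time \<open>0\<close>.\<close>

lemma global_solution_impossible:
  fixes \<psi> :: "real \<Rightarrow> 'a \<Rightarrow> real" and \<gamma> \<zeta> c :: real
  assumes glob: "\<And>T. 0 \<le> T \<Longrightarrow> bounded_until T"
    and \<psi>_meas: "(\<lambda>(t, x). \<psi> t x) \<in> borel_measurable (borel \<Otimes>\<^sub>M borel)"
    and \<psi>_nonneg: "\<And>t x. 0 \<le> \<psi> t x"
    and \<psi>_mass: "\<And>t. 1 \<le> t \<Longrightarrow> (\<integral>\<^sup>+x. ennreal (\<psi> t x) \<partial>lborel) = ennreal (\<zeta> * t powr \<gamma>)" and \<zeta>: "0 < \<zeta>" and \<gamma>: "0 < \<gamma>"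
    and c: "0 < c" and \<psi>_super: "\<And>r t \<tau> x. 1 \<le> r \<Longrightarrow> r \<le> t \<Longrightarrow> 0 \<le> \<tau> \<Longrightarrow> \<tau> \<le> t \<Longrightarrow>
        ennreal c * ennreal (\<psi> r x) \<le> P \<tau> (\<lambda>y. ennreal (\<psi> t y)) x"
    and m0: "0 < (\<integral>\<^sup>+x. ennreal (\<psi> 1 x) * ennreal (u0 x) \<partial>lborel)"
    and fm: "(\<integral>\<^sup>+x. ennreal (1 / minorant f x) * indicator {1..} x \<partial>lborel) < \<infinity>"
  shows "\<exists>\<epsilon>>0. (\<integral>\<^sup>+t. ennreal (h t * t powr \<gamma> * f (\<epsilon> * t powr (- \<gamma>))) * indicator {1..} t \<partial>lborel) < \<infinity>"
proof -
  note [measurable (raw)] = measurable_curried[OF \<psi>_meas]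
  \<comment> \<open>The mass of the test function, by which integrals against it become
    averages.\<close>
  define Z where "Z t = \<zeta> * t powr \<gamma>" for t
  have Zpos: "0 < Z t" if "1 \<le> t" for t using that \<zeta> by (simp add: Z_def)
  have Zmono: "Z s \<le> Z t" if "1 \<le> s" "s \<le> t" for s t
    unfolding Z_def using that \<zeta> \<gamma> by (intro mult_left_mono powr_mono2) auto
  have [measurable]: "Z \<in> borel_measurable borel" unfolding Z_def by measurable
  have WM: "\<exists>M>0. \<forall>t x. 0 \<le> t \<and> t \<le> T \<longrightarrow> W t x \<le> ennreal M" if "0 \<le> T" for T
    using glob[OF that] by (simp add: bounded_until_def)
  have fin: "W s y < \<top>" if "0 \<le> s" for s y
    using glob[OF that] that le_less_trans[OF _ ennreal_less_top] unfolding bounded_until_def by blast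
  have Wu: "W s y = ennreal (u s y)" if "0 \<le> s" for s y
    unfolding u_def using fin[OF that, of y] by simp
  define m where "m t = (\<integral>\<^sup>+x. ennreal (\<psi> t x) * W t x \<partial>lborel)" for t
  have [measurable]: "m \<in> borel_measurable borel" unfolding m_def by measurable
  define \<mu> where "\<mu> t = enn2real (m t)" for t
  have [measurable]: "\<mu> \<in> borel_measurable borel" unfolding \<mu>_def by measurable
  have \<mu>_nonneg: "0 \<le> \<mu> t" for t by (simp add: \<mu>_def)
  have m_le: "m t \<le> ennreal (M * Z t)" if "1 \<le> t" "0 \<le> M" "\<And>x. W t x \<le> ennreal M" for t M
  proof -
    have "m t \<le> (\<integral>\<^sup>+x. ennreal M * ennreal (\<psi> t x) \<partial>lborel)"
      unfolding m_def mult.commute[of "ennreal M"] using that by (intro nn_integral_mono mult_left_mono) auto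
    also have "\<dots> = ennreal (M * Z t)"
      using that Zpos[of t] \<psi>_mass[of t] by (simp add: nn_integral_cmult Z_def ennreal_mult)
    finally show ?thesis .
  qed
  have m_fin: "m t < \<top>" if t: "1 \<le> t" for t
  proof -
    obtain M where "M > 0" "\<And>x. W t x \<le> ennreal M"
      using WM[of t] t by auto
    then show ?thesis using m_le[OF t, of M] by (auto intro: le_less_trans)
  qed
  have m_\<mu>: "m t = ennreal (\<mu> t)" if "1 \<le> t" for t using m_fin[OF that] by (simp add: \<mu>_def)
  \<comment> \<open>Jensen's inequality for the density \<open>\<psi> r\<close> of mass Z r: a
    supporting line of f at the mean is integrated, and its linear term cancels.\<close>
  have jensen: "ennreal (Z r * f (\<mu> r / Z r)) \<le> (\<integral>\<^sup>+x. ennreal (\<psi> r x) * F (W r x) \<partial>lborel)" if r: "1 \<le> r" for r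
  proof (cases "\<mu> r = 0")
    case False
    define a where "a = \<mu> r / Z r"
    have a: "0 < a" using False \<mu>_nonneg[of r] Zpos[OF r] by (simp add: a_def less_le)
    obtain k where k: "\<And>y. 0 \<le> y \<Longrightarrow> f a + k * (y - a) \<le> f y" using f_tangent[OF a] by blast
    obtain M where M: "M > 0" "\<And>x. W r x \<le> ennreal M"
      using WM[of r] r by auto
    have uM: "u r x \<le> M" for x using M(2)[of x] M(1) r by (simp add: Wu)
    have i1: "integrable lborel (\<lambda>x. \<psi> r x)" and I1: "(LINT x|lborel. \<psi> r x) = Z r"
      using \<psi>_mass[OF r] \<psi>_nonneg Zpos[OF r]
      by (auto intro!: integrableI_nn_integral_finite[where x = "Z r"] simp: Z_def integral_eq_nn_integral)
    have i2: "integrable lborel (\<lambda>x. \<psi> r x * u r x)" and I2: "(LINT x|lborel. \<psi> r x * u r x) = \<mu> r"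
      using m_\<mu>[OF r] \<psi>_nonneg \<mu>_nonneg[of r] r unfolding m_def
      by (auto intro!: integrableI_nn_integral_finite[where x = "\<mu> r"] simp: Wu integral_eq_nn_integral ennreal_mult)
    have i3: "integrable lborel (\<lambda>x. \<psi> r x * f (u r x))"
    proof (rule Bochner_Integration.integrable_bound[OF integrable_mult_right[OF i1, of "f M"]])
      have "(\<lambda>x. \<psi> r x * f (max 0 (u r x))) \<in> borel_measurable lborel" by measurable
      then show "(\<lambda>x. \<psi> r x * f (u r x)) \<in> borel_measurable lborel" by (simp add: max_absorb2)
      show "AE x in lborel. norm (\<psi> r x * f (u r x)) \<le> norm (f M * \<psi> r x)"
      proof (rule AE_I2)
        fix x
        have "\<psi> r x * f (u r x) \<le> \<psi> r x * f M" by (intro mult_left_mono f_mono uM \<psi>_nonneg) simp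
        then show "norm (\<psi> r x * f (u r x)) \<le> norm (f M * \<psi> r x)"
          using \<psi>_nonneg[of r x] f_nonneg[of M] f_nonneg[OF u_nonneg, of r x] M(1) by (simp add: abs_mult mult.commute)
      qed
    qed
    have "Z r * f a = (LINT x|lborel. \<psi> r x * f a + k * (\<psi> r x * u r x) - k * a * \<psi> r x)"
      using i1 i2 I1 I2 Zpos[OF r] by (simp add: a_def)
    also have "\<dots> \<le> (LINT x|lborel. \<psi> r x * f (u r x))"
    proof (rule integral_mono)
      fix x
      have "\<psi> r x * (f a + k * (u r x - a)) \<le> \<psi> r x * f (u r x)"
        by (intro mult_left_mono k \<psi>_nonneg) simp
      then show "\<psi> r x * f a + k * (\<psi> r x * u r x) - k * a * \<psi> r x \<le> \<psi> r x * f (u r x)"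
        by (simp add: algebra_simps)
    qed (use i1 i2 i3 in auto)
    finally have "ennreal (Z r * f a) \<le> ennreal (LINT x|lborel. \<psi> r x * f (u r x))" by (rule ennreal_leI)
    also have "\<dots> = (\<integral>\<^sup>+x. ennreal (\<psi> r x * f (u r x)) \<partial>lborel)"
      using i3 \<psi>_nonneg by (intro nn_integral_eq_integral[symmetric]) (auto intro!: mult_nonneg_nonneg f_nonneg)
    also have "\<dots> = (\<integral>\<^sup>+x. ennreal (\<psi> r x) * F (W r x) \<partial>lborel)"
      using r \<psi>_nonneg by (intro nn_integral_cong) (simp add: Wu F_ennreal ennreal_mult f_nonneg)
    finally show ?thesis by (simp add: a_def)
  qed simp
  define m1 where "m1 = (\<integral>\<^sup>+x. ennreal (\<psi> 1 x) * ennreal (u0 x) \<partial>lborel)"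
  \<comment> \<open>Duality moves P onto \<open>\<psi> t\<close>, and the result is bounded below by
    c times the test function of the earlier time, which is 1 for the data. The nonnegative source
    term before time 1 is dropped.\<close>
  have m_ge: "m t \<ge> ennreal c * m1 + ennreal c * (\<integral>\<^sup>+r. indicator {1..t} r * (H r * ennreal (Z r * f (\<mu> r / Z r))) \<partial>lborel)" if t: "1 \<le> t" for t
  proof -
    have WJ: "W t x = P t (\<lambda>y. ennreal (u0 y)) x + J t x" for x
      unfolding J_def by (rule W_eq) (rule fin)
    have "m t = (\<integral>\<^sup>+x. ennreal (\<psi> t x) * P t (\<lambda>y. ennreal (u0 y)) x + ennreal (\<psi> t x) * J t x \<partial>lborel)"
      unfolding m_def WJ distrib_left ..
    also have "\<dots> = (\<integral>\<^sup>+x. ennreal (\<psi> t x) * P t (\<lambda>y. ennreal (u0 y)) x \<partial>lborel) + (\<integral>\<^sup>+x. ennreal (\<psi> t x) * J t x \<partial>lborel)"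
      unfolding J_def by (rule nn_integral_add) measurable
    finally have m_split: "m t = \<dots>" .
    have init: "ennreal c * m1 \<le> (\<integral>\<^sup>+x. ennreal (\<psi> t x) * P t (\<lambda>y. ennreal (u0 y)) x \<partial>lborel)"
    proof -
      have "ennreal c * m1 = (\<integral>\<^sup>+x. ennreal c * ennreal (\<psi> 1 x) * ennreal (u0 x) \<partial>lborel)"
        unfolding m1_def by (simp add: nn_integral_cmult mult.assoc)
      also have "\<dots> \<le> (\<integral>\<^sup>+x. P t (\<lambda>y. ennreal (\<psi> t y)) x * ennreal (u0 x) \<partial>lborel)"
        using t by (intro nn_integral_mono mult_right_mono \<psi>_super) auto
      also have "\<dots> = (\<integral>\<^sup>+x. ennreal (\<psi> t x) * P t (\<lambda>y. ennreal (u0 y)) x \<partial>lborel)"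
        by (rule P_dual[symmetric]) measurable
      finally show ?thesis .
    qed
    have "(\<integral>\<^sup>+x. ennreal (\<psi> t x) * J t x \<partial>lborel)
       = (\<integral>\<^sup>+x. (\<integral>\<^sup>+s. ennreal (\<psi> t x) * (indicator {0..t} s * P (t - s) (\<lambda>y. H s * F (W s y)) x) \<partial>lborel) \<partial>lborel)"
      unfolding J_def by (intro nn_integral_cong nn_integral_cmult[symmetric]) measurable
    also have "\<dots> = (\<integral>\<^sup>+s. (\<integral>\<^sup>+x. ennreal (\<psi> t x) * (indicator {0..t} s * P (t - s) (\<lambda>y. H s * F (W s y)) x) \<partial>lborel) \<partial>lborel)"
      by (rule lborel_pair.Fubini') measurable
    finally have J_eq: "(\<integral>\<^sup>+x. ennreal (\<psi> t x) * J t x \<partial>lborel) = \<dots>" .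
    have "ennreal c * (\<integral>\<^sup>+r. indicator {1..t} r * (H r * ennreal (Z r * f (\<mu> r / Z r))) \<partial>lborel)
      = (\<integral>\<^sup>+r. ennreal c * (indicator {1..t} r * (H r * ennreal (Z r * f (\<mu> r / Z r)))) \<partial>lborel)"
    proof (rule nn_integral_cmult[symmetric])
      have "(\<lambda>r. indicator {1..t} r * (H r * ennreal (Z r * f (max 0 (\<mu> r / Z r))))) \<in> borel_measurable lborel" by measurable
      moreover have "(\<lambda>r. indicator {1..t} r * (H r * ennreal (Z r * f (max 0 (\<mu> r / Z r))))) = (\<lambda>r. indicator {1..t} r * (H r * ennreal (Z r * f (\<mu> r / Z r))))"
        using \<mu>_nonneg Zpos by (auto simp: fun_eq_iff indicator_def max_absorb2 less_imp_le)
      ultimately show "(\<lambda>r. indicator {1..t} r * (H r * ennreal (Z r * f (\<mu> r / Z r)))) \<in> borel_measurable lborel" by simp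
    qed
    also have "\<dots> \<le> (\<integral>\<^sup>+s. (\<integral>\<^sup>+x. ennreal (\<psi> t x) * (indicator {0..t} s * P (t - s) (\<lambda>y. H s * F (W s y)) x) \<partial>lborel) \<partial>lborel)"
    proof (rule nn_integral_mono)
      fix r
      show "ennreal c * (indicator {1..t} r * (H r * ennreal (Z r * f (\<mu> r / Z r))))
        \<le> (\<integral>\<^sup>+x. ennreal (\<psi> t x) * (indicator {0..t} r * P (t - r) (\<lambda>y. H r * F (W r y)) x) \<partial>lborel)"
      proof (cases "r \<in> {1..t}")
        case True
        have "ennreal c * (H r * ennreal (Z r * f (\<mu> r / Z r))) \<le> ennreal c * (H r * (\<integral>\<^sup>+x. ennreal (\<psi> r x) * F (W r x) \<partial>lborel))"
          using True by (intro mult_left_mono jensen) auto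
        also have "\<dots> = (\<integral>\<^sup>+x. ennreal c * ennreal (\<psi> r x) * (H r * F (W r x)) \<partial>lborel)"
        proof -
          have "(\<integral>\<^sup>+x. (ennreal c * H r) * (ennreal (\<psi> r x) * F (W r x)) \<partial>lborel) = (ennreal c * H r) * (\<integral>\<^sup>+x. ennreal (\<psi> r x) * F (W r x) \<partial>lborel)"
            by (rule nn_integral_cmult) measurable
          then show ?thesis by (simp only: ac_simps)
        qed
        also have "\<dots> \<le> (\<integral>\<^sup>+x. P (t - r) (\<lambda>y. ennreal (\<psi> t y)) x * (H r * F (W r x)) \<partial>lborel)"
          using True t by (intro nn_integral_mono mult_right_mono \<psi>_super) auto
        also have "\<dots> = (\<integral>\<^sup>+x. ennreal (\<psi> t x) * P (t - r) (\<lambda>y. H r * F (W r y)) x \<partial>lborel)"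
          by (rule P_dual[symmetric]) measurable
        finally show ?thesis using True by simp
      qed simp
    qed
    finally show ?thesis unfolding m_split J_eq by (intro add_mono init)
  qed
  have m1_pos: "0 < ennreal c * m1"
    using c m0 by (simp add: m1_def ennreal_zero_less_mult_iff)
  \<comment> \<open>The minimum with \<zeta> / 2 forces A / \<zeta> < 1, so that the numbers
    \<epsilon> r^(-\<gamma>) below stay in (0, 1), the range of the infimum in
    \<open>minorant\<close>.\<close>
  define A where "A = enn2real (min (ennreal c * m1) (ennreal (\<zeta> / 2)))"
  have EA: "ennreal A = min (ennreal c * m1) (ennreal (\<zeta> / 2))"
    unfolding A_def by (rule ennreal_enn2real) (auto simp: min_less_iff_disj)
  have A: "0 < A" "A < \<zeta>"
  proof -
    have "0 < ennreal A" using m1_pos \<zeta> by (simp add: EA)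
    then show "0 < A" by (simp add: ennreal_less_zero_iff)
    have "ennreal A \<le> ennreal (\<zeta> / 2)" by (simp add: EA)
    then show "A < \<zeta>" using \<zeta> by (subst (asm) ennreal_le_iff) auto
  qed
  define v where "v r = h (max 0 r) * (Z r * f (max 0 (\<mu> r / Z r)))" for r
  have [measurable]: "v \<in> borel_measurable borel" unfolding v_def by measurable
  have v_nonneg: "0 \<le> v r" if "1 \<le> r" for r
    unfolding v_def using Zpos[OF that] by (intro mult_nonneg_nonneg h_nonneg f_nonneg) auto
  have v_bdd: "\<exists>C\<ge>0. \<forall>r. 1 \<le> r \<and> r \<le> T \<longrightarrow> v r \<le> C" if T: "1 \<le> T" for T
  proof -
    obtain M where M: "M > 0" "\<And>t x. 0 \<le> t \<Longrightarrow> t \<le> T \<Longrightarrow> W t x \<le> ennreal M"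
      using WM[of T] T by auto
    obtain B where B: "B > 0" "\<And>t. 0 \<le> t \<Longrightarrow> t \<le> T \<Longrightarrow> h t \<le> B" using h_bounded[of T] by blast
    have "v r \<le> B * (Z T * f M)" if r: "1 \<le> r" "r \<le> T" for r
    proof -
      have "ennreal (\<mu> r) \<le> ennreal (M * Z r)" using m_le[of r M] m_\<mu>[OF r(1)] M r by simp
      then have "\<mu> r / Z r \<le> M" using M Zpos[OF r(1)] by (simp add: field_simps)
      then show ?thesis
        unfolding v_def using r B M Zpos[OF r(1)] Zmono[OF r]
        by (intro mult_mono f_mono mult_nonneg_nonneg f_nonneg) auto
    qed
    then show ?thesis using B M Zpos[OF T] f_nonneg[of M] by (intro exI[of _ "B * (Z T * f M)"]) auto
  qed
  define V where "V t = (LINT r|lborel. indicator {1<..t} r * v r)" for t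
  have v_int: "integrable lborel (\<lambda>r. indicator {s<..t} r * v r)" if st: "1 \<le> s" for s t
  proof (cases "s \<le> t")
    case True
    obtain C where C: "C \<ge> 0" "\<And>r. 1 \<le> r \<Longrightarrow> r \<le> t \<Longrightarrow> v r \<le> C" using v_bdd[of t] st True by auto
    have "integrable lborel (\<lambda>r::real. C * indicator {s<..t} r)" by (intro integrable_mult_right integrable_real_indicator) (use True in auto)
    then show ?thesis
      by (rule Bochner_Integration.integrable_bound)
         (use C st v_nonneg in \<open>auto intro!: AE_I2 simp: indicator_def\<close>)
  qed simp
  have V_diff: "V t - V s = (LINT r|lborel. indicator {s<..t} r * v r)" if st: "1 \<le> s" "s \<le> t" for s t
  proof -
    have "indicator {1<..t} r * v r = indicator {1<..s} r * v r + indicator {s<..t} r * v r" for r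
      using st by (auto simp: indicator_def)
    then show ?thesis unfolding V_def using v_int st by simp
  qed
  have V_ennreal: "ennreal (V t - V s) = (\<integral>\<^sup>+r. indicator {s<..t} r * ennreal (v r) \<partial>lborel)" if st: "1 \<le> s" "s \<le> t" for s t
  proof -
    have "(\<integral>\<^sup>+r. ennreal (indicator {s<..t} r * v r) \<partial>lborel) = ennreal (V t - V s)"
      unfolding V_diff[OF st] using st by (intro nn_integral_eq_integral v_int) (auto simp: indicator_def v_nonneg)
    moreover have "ennreal (indicator {s<..t} r * v r) = indicator {s<..t} r * ennreal (v r)" for r
      by (simp add: indicator_def)
    ultimately show ?thesis by simp
  qed
  have V_nonneg: "0 \<le> V t - V s" if st: "1 \<le> s" "s \<le> t" for s t
    unfolding V_diff[OF st] using st by (intro Bochner_Integration.integral_nonneg) (auto simp: indicator_def v_nonneg)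
  have V1: "V 1 = 0" by (simp add: V_def)
  have V_cont: "continuous_on {1..T} V" for T
  proof (cases "1 \<le> T")
    case True
    obtain C where C: "C \<ge> 0" "\<And>r. 1 \<le> r \<Longrightarrow> r \<le> T \<Longrightarrow> v r \<le> C" using v_bdd[OF True] by auto
    have le: "V t - V s \<le> C * (t - s)" if st: "1 \<le> s" "s \<le> t" "t \<le> T" for s t
    proof -
      have "V t - V s \<le> (LINT r|lborel. C * indicator {s<..t} r)"
        unfolding V_diff[OF st(1,2)] using st C
        by (intro integral_mono v_int integrable_mult_right integrable_real_indicator) (auto simp: indicator_def)
      then show ?thesis using st by simp
    qed
    have "C-lipschitz_on {1..T} V"
    proof (rule lipschitz_onI)
      fix s t assume "s \<in> {1..T}" "t \<in> {1..T}"
      then show "dist (V s) (V t) \<le> C * dist s t"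
        using le[of s t] le[of t s] V_nonneg[of s t] V_nonneg[of t s]
        by (cases "s \<le> t") (auto simp: dist_real_def)
    qed (rule C)
    then show ?thesis by (rule lipschitz_on_continuous_on)
  qed simp
  \<comment> \<open>The real-valued right-hand side of the integral inequality, with A in place of
    the data term. It lies below \<mu> and is by construction continuous and nondecreasing, which is
    not known of \<mu>.\<close>
  define N where "N t = A + c * V t" for t
  have N_mono: "N s \<le> N t" if "1 \<le> s" "s \<le> t" for s t
    using V_nonneg[OF that] c unfolding N_def by simp
  have N_ge: "A \<le> N t" if "1 \<le> t" for t using N_mono[of 1 t] that V1 by (simp add: N_def)
  have N_le: "N t \<le> \<mu> t" if t: "1 \<le> t" for t
  proof -
    have "ennreal (N t) = ennreal A + ennreal c * ennreal (V t - V 1)"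
      using A c V_nonneg[of 1 t] t V1 by (simp add: N_def ennreal_mult)
    also have "ennreal (V t - V 1) \<le> (\<integral>\<^sup>+r. indicator {1..t} r * (H r * ennreal (Z r * f (\<mu> r / Z r))) \<partial>lborel)"
      unfolding V_ennreal[OF order_refl t]
    proof (rule nn_integral_mono)
      fix r
      show "indicator {1<..t} r * ennreal (v r) \<le> indicator {1..t} r * (H r * ennreal (Z r * f (\<mu> r / Z r)))"
      proof (cases "r \<in> {1<..t}")
        case True
        then have "v r = h (max 0 r) * (Z r * f (\<mu> r / Z r))" using \<mu>_nonneg[of r] Zpos[of r] by (simp add: v_def max_absorb2)
        then show ?thesis using True \<mu>_nonneg[of r] Zpos[of r]
          by (simp add: H_def ennreal_mult h_nonneg f_nonneg)
      qed simp
    qed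
    also have "ennreal A + ennreal c * (\<integral>\<^sup>+r. indicator {1..t} r * (H r * ennreal (Z r * f (\<mu> r / Z r))) \<partial>lborel) \<le> m t"
      by (rule order_trans[OF add_right_mono m_ge[OF t]]) (simp add: EA)
    finally have "ennreal (N t) \<le> ennreal (\<mu> t)"
      unfolding m_\<mu>[OF t] by (simp add: add_left_mono mult_left_mono)
    then show ?thesis using \<mu>_nonneg by simp
  qed
  \<comment> \<open>With this value the product of \<epsilon> r^(-\<gamma>) and N r / A is N r / Z
    r, so the minorant inequality separates the time weight from the unknown.\<close>
  define \<epsilon> where "\<epsilon> = A / \<zeta>"
  have \<epsilon>: "0 < \<epsilon>" "\<epsilon> < 1" using A \<zeta> by (auto simp: \<epsilon>_def)
  have \<alpha>: "0 < \<epsilon> * r powr (- \<gamma>)" "\<epsilon> * r powr (- \<gamma>) < 1" if "1 \<le> r" for r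
  proof -
    show "0 < \<epsilon> * r powr (- \<gamma>)" using that \<epsilon> by simp
    have "r powr (- \<gamma>) \<le> r powr 0" using that \<gamma> by (intro powr_mono) auto
    then have "\<epsilon> * r powr (- \<gamma>) \<le> \<epsilon> * 1" using \<epsilon> that by (intro mult_left_mono) auto
    then show "\<epsilon> * r powr (- \<gamma>) < 1" using \<epsilon> by linarith
  qed
  define b where "b r = h (max 0 r) * (Z r * f (max 0 (\<epsilon> * r powr (- \<gamma>))))" for r
  have [measurable]: "b \<in> borel_measurable borel" unfolding b_def by measurable
  \<comment> \<open>N is frozen at the earlier time s because the doubling argument compares the
    growth on [s, t] with g at the left end.\<close>
  have b_v: "minorant f (N s / A) * b r \<le> v r" if s: "1 \<le> s" "s \<le> r" for s r
  proof -
    have r: "1 \<le> r" using s by simp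
    have "minorant f (N s / A) * f (\<epsilon> * r powr (- \<gamma>)) \<le> minorant f (N r / A) * f (\<epsilon> * r powr (- \<gamma>))"
      using N_ge[OF s(1)] N_mono[OF s] A \<alpha>[OF r] by (intro mult_right_mono minorant_mono f_nonneg) (auto intro: divide_right_mono)
    also have "\<dots> \<le> f ((\<epsilon> * r powr (- \<gamma>)) * (N r / A))"
      using minorant_mult_le[where f = f and \<alpha> = "\<epsilon> * r powr (- \<gamma>)" and u = "N r / A"] f_nonneg f_pos \<alpha>[OF r] N_ge[OF r] A by (simp add: mult.commute)
    also have "(\<epsilon> * r powr (- \<gamma>)) * (N r / A) = N r / Z r"
      using A \<zeta> r by (simp add: \<epsilon>_def Z_def powr_minus field_simps)
    also have "f (N r / Z r) \<le> f (\<mu> r / Z r)"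
      using N_ge[OF r] N_le[OF r] Zpos[OF r] A by (intro f_mono divide_right_mono divide_nonneg_nonneg) auto
    finally have "(h (max 0 r) * Z r) * (minorant f (N s / A) * f (\<epsilon> * r powr (- \<gamma>))) \<le> (h (max 0 r) * Z r) * f (\<mu> r / Z r)"
      using Zpos[OF r] h_nonneg[of "max 0 r"] by (intro mult_left_mono) auto
    then show ?thesis
      using \<mu>_nonneg[of r] Zpos[OF r] \<alpha>[OF r] by (simp add: b_def v_def max_absorb2 ac_simps)
  qed
  have b_nonneg: "0 \<le> b r" if "1 \<le> r" for r
    unfolding b_def using Zpos[OF that] by (intro mult_nonneg_nonneg h_nonneg f_nonneg) auto
  have minorant_pos: "0 < minorant f x" if "1 \<le> x" for x using minorant_ge_1[OF that] by linarith
  have bound: "(\<integral>\<^sup>+r. indicator {1..T} r * ennreal (c / A * b r) \<partial>lborel)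
    \<le> ennreal (1 / minorant f 1) + 2 * (\<integral>\<^sup>+x. ennreal (1 / minorant f x) * indicator {1..} x \<partial>lborel)" if T: "1 \<le> T" for T
  proof (rule osgood_bound[where z = "\<lambda>t. N t / A"])
    show "continuous_on {1..T} (\<lambda>t. N t / A)" for T
      unfolding N_def using A by (intro continuous_intros V_cont) auto
    show "N 1 / A = 1" using A V1 by (simp add: N_def)
    show "minorant f x \<le> minorant f y" if "1 \<le> x" "x \<le> y" for x y using that by (intro minorant_mono) auto
    fix s t :: real
    assume st: "1 \<le> s" "s \<le> t"
    have g0: "0 < minorant f (N s / A)" using N_ge[OF st(1)] A by (intro minorant_pos) simp
    have "ennreal (minorant f (N s / A)) * (\<integral>\<^sup>+r. indicator {s..t} r * ennreal (c / A * b r) \<partial>lborel)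
      = (\<integral>\<^sup>+r. ennreal (minorant f (N s / A)) * (indicator {s..t} r * ennreal (c / A * b r)) \<partial>lborel)"
      by (rule nn_integral_cmult[symmetric]) measurable
    also have "\<dots> \<le> (\<integral>\<^sup>+r. ennreal (c / A) * (indicator {s<..t} r * ennreal (v r)) \<partial>lborel)"
    proof (rule nn_integral_mono_AE, rule AE_mp[OF AE_lborel_singleton[of s]], rule AE_I2, rule impI)
      fix r assume "r \<noteq> s"
      show "ennreal (minorant f (N s / A)) * (indicator {s..t} r * ennreal (c / A * b r)) \<le> ennreal (c / A) * (indicator {s<..t} r * ennreal (v r))"
      proof (cases "r \<in> {s..t}")
        case True
        have "minorant f (N s / A) * (c / A * b r) = c / A * (minorant f (N s / A) * b r)" by simp
        also have "\<dots> \<le> c / A * v r" using b_v[of s r] True st c A by (intro mult_left_mono) auto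
        finally have "ennreal (minorant f (N s / A) * (c / A * b r)) \<le> ennreal (c / A * v r)" by (rule ennreal_leI)
        moreover have "ennreal (minorant f (N s / A) * (c / A * b r)) = ennreal (minorant f (N s / A)) * ennreal (c / A * b r)"
          using g0 True st c A b_nonneg[of r] by (intro ennreal_mult) auto
        moreover have "ennreal (c / A * v r) = ennreal (c / A) * ennreal (v r)"
          using True st c A v_nonneg[of r] by (intro ennreal_mult) auto
        ultimately show ?thesis using True \<open>r \<noteq> s\<close> by simp
      qed simp
    qed
    also have "\<dots> = ennreal (c / A) * ennreal (V t - V s)"
      by (subst nn_integral_cmult) (auto simp: V_ennreal[OF st])
    also have "\<dots> = ennreal (N t / A - N s / A)"
      using c A V_nonneg[OF st] by (subst ennreal_mult[symmetric]) (auto simp: N_def field_simps)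
    finally show "ennreal (minorant f (N s / A)) * (\<integral>\<^sup>+r. indicator {s..t} r * ennreal (c / A * b r) \<partial>lborel) \<le> ennreal (N t / A - N s / A)" .
  qed (use T minorant_pos in auto)
  define I where "I = ennreal (1 / minorant f 1) + 2 * (\<integral>\<^sup>+x. ennreal (1 / minorant f x) * indicator {1..} x \<partial>lborel)"
  have I: "I < \<infinity>" using fm by (simp add: I_def ennreal_mult_less_top)
  have total: "(\<integral>\<^sup>+r. indicator {1..} r * ennreal (c / A * b r) \<partial>lborel) \<le> I"
  proof -
    have "indicator {1..} r * ennreal (c / A * b r) = (SUP n::nat. indicator {1..real (Suc n)} r * ennreal (c / A * b r))" for r
    proof (rule antisym)
      obtain n :: nat where "r \<le> real n" using real_arch_simple by blast
      then show "indicator {1..} r * ennreal (c / A * b r) \<le> (SUP n::nat. indicator {1..real (Suc n)} r * ennreal (c / A * b r))"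
        by (intro SUP_upper2[of n]) (auto simp: indicator_def)
    qed (auto intro!: SUP_least simp: indicator_def)
    then have "(\<integral>\<^sup>+r. indicator {1..} r * ennreal (c / A * b r) \<partial>lborel) = (SUP n::nat. (\<integral>\<^sup>+r. indicator {1..real (Suc n)} r * ennreal (c / A * b r) \<partial>lborel))"
      by (simp only:) (rule nn_integral_monotone_convergence_SUP; auto simp: incseq_def le_fun_def indicator_def)
    also have "\<dots> \<le> I" unfolding I_def by (intro SUP_least bound) simp
    finally show ?thesis .
  qed
  \<comment> \<open>Z contributes the factor \<zeta>, and the doubling argument was applied to N / A
    with weight c / A; the constant collects these.\<close>
  have "ennreal (c * \<zeta> / A) * (\<integral>\<^sup>+t. ennreal (h t * t powr \<gamma> * f (\<epsilon> * t powr (- \<gamma>))) * indicator {1..} t \<partial>lborel)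
     = (\<integral>\<^sup>+r. indicator {1..} r * ennreal (c / A * b r) \<partial>lborel)"
  proof -
    have eq: "ennreal (h t * t powr \<gamma> * f (\<epsilon> * t powr (- \<gamma>))) * indicator {1..} t = indicator {1..} t * ennreal (b t / \<zeta>)" for t
      using \<alpha>[of t] \<zeta> by (cases "1 \<le> t") (auto simp: b_def Z_def max_absorb2 mult.assoc)
    have "ennreal (c * \<zeta> / A) * (indicator {1..} t * ennreal (b t / \<zeta>)) = indicator {1..} t * ennreal (c / A * b t)" for t
    proof (cases "1 \<le> t")
      case True
      have "ennreal (c * \<zeta> / A) * ennreal (b t / \<zeta>) = ennreal (c * \<zeta> / A * (b t / \<zeta>))"
        using c \<zeta> A b_nonneg[OF True] by (intro ennreal_mult[symmetric]) auto
      also have "c * \<zeta> / A * (b t / \<zeta>) = c / A * b t" using \<zeta> by simp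
      finally show ?thesis using True by simp
    qed simp
    then show ?thesis
      unfolding eq by (subst nn_integral_cmult[symmetric]) auto
  qed
  also have "\<dots> < \<infinity>" using total I by (rule le_less_trans)
  finally have "(\<integral>\<^sup>+t. ennreal (h t * t powr \<gamma> * f (\<epsilon> * t powr (- \<gamma>))) * indicator {1..} t \<partial>lborel) < \<infinity>"
    using c \<zeta> A by (auto simp: ennreal_mult_less_top)
  then show ?thesis using \<epsilon>(1) by blast
qed

end

section \<open>Comparison for mild solutions\<close>

context mixed_order
begin

text \<open>A Chebyshev inequality with the weight 1 - \<open>gauss 1\<close>. Outside radius
  \<delta> the weight is at least \<eta>, and its mean under the kernel tends to 0 because the mean
  of \<open>gauss 1\<close> tends to 1.\<close>

lemma mixed_kernel_concentration:
  assumes \<delta>: "0 < \<delta>" and X: "X \<longlonglongrightarrow> 0" "\<And>n. 0 < X n"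
  shows "(\<lambda>n. (\<integral>\<^sup>+x. ennreal (mixed_kernel \<sigma> (X n) x) * indicator {x::'a::euclidean_space. \<delta> \<le> norm x} x \<partial>lborel)) \<longlonglongrightarrow> 0"
proof -
  define \<eta> where "\<eta> = 1 - exp (- \<delta>\<^sup>2)"
  have \<eta>: "0 < \<eta>" using \<delta> by (simp add: \<eta>_def)
  let ?g = "\<lambda>n. 1 / \<eta> * (1 - kernel_gauss TYPE('a) \<sigma> (X n) 1)"
  have le: "(\<integral>\<^sup>+x. ennreal (mixed_kernel \<sigma> (X n) x) * indicator {x::'a. \<delta> \<le> norm x} x \<partial>lborel) \<le> ennreal (?g n)" for n
  proof -
    have i1: "integrable lborel (\<lambda>x::'a. mixed_kernel \<sigma> (X n) x)" by (rule integrable_mixed_kernel)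
    have i2: "integrable lborel (\<lambda>x::'a. mixed_kernel \<sigma> (X n) x * gauss 1 x)"
      by (rule Bochner_Integration.integrable_bound[OF i1])
         (auto simp: abs_mult gauss_le_1 intro!: AE_I2 mult_left_le)
    have nn: "0 \<le> 1 / \<eta> * (mixed_kernel \<sigma> (X n) x - mixed_kernel \<sigma> (X n) x * gauss 1 x)" for x :: 'a
      using \<eta> mult_left_mono[OF gauss_le_1[of 1 x] mixed_kernel_nonneg[of "X n" x]] by (intro mult_nonneg_nonneg) auto
    have "(\<integral>\<^sup>+x. ennreal (mixed_kernel \<sigma> (X n) x) * indicator {x::'a. \<delta> \<le> norm x} x \<partial>lborel)
      \<le> (\<integral>\<^sup>+x. ennreal (1 / \<eta> * (mixed_kernel \<sigma> (X n) (x::'a) - mixed_kernel \<sigma> (X n) x * gauss 1 x)) \<partial>lborel)"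
    proof (rule nn_integral_mono)
      fix x :: 'a
      show "ennreal (mixed_kernel \<sigma> (X n) x) * indicator {x. \<delta> \<le> norm x} x \<le> ennreal (1 / \<eta> * (mixed_kernel \<sigma> (X n) x - mixed_kernel \<sigma> (X n) x * gauss 1 x))"
      proof (cases "\<delta> \<le> norm x")
        case True
        have "\<delta>\<^sup>2 \<le> (norm x)\<^sup>2" using True \<delta> by (intro power_mono) auto
        then have "\<eta> \<le> 1 - gauss 1 x" by (simp add: \<eta>_def gauss_def)
        then have "\<eta> * mixed_kernel \<sigma> (X n) x \<le> (1 - gauss 1 x) * mixed_kernel \<sigma> (X n) x"
          by (intro mult_right_mono) auto
        then have "mixed_kernel \<sigma> (X n) x \<le> 1 / \<eta> * (mixed_kernel \<sigma> (X n) x - mixed_kernel \<sigma> (X n) x * gauss 1 x)"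
          using \<eta> by (simp add: field_simps)
        then show ?thesis using True by (simp add: ennreal_leI)
      qed simp
    qed
    also have "\<dots> = ennreal (LINT x|lborel. 1 / \<eta> * (mixed_kernel \<sigma> (X n) (x::'a) - mixed_kernel \<sigma> (X n) x * gauss 1 x))"
      by (rule nn_integral_eq_integral) (use i1 i2 nn in \<open>auto intro!: integrable_mult_right\<close>)
    also have "(LINT x|lborel. 1 / \<eta> * (mixed_kernel \<sigma> (X n) (x::'a) - mixed_kernel \<sigma> (X n) x * gauss 1 x)) = ?g n"
      using i1 i2 by (subst integral_mult_right_zero) (simp add: mixed_kernel_mass X(2) kernel_gauss_eq_conv[OF X(2)])
    finally show ?thesis .
  qed
  have "(\<lambda>n. ennreal (?g n)) \<longlonglongrightarrow> ennreal (1 / \<eta> * (1 - 1))"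
    by (intro tendsto_ennrealI tendsto_intros kernel_gauss_tendsto X less_imp_le) simp
  then have lim: "(\<lambda>n. ennreal (?g n)) \<longlonglongrightarrow> 0" by simp
  show ?thesis
    by (rule tendsto_sandwich[OF always_eventually always_eventually tendsto_const lim]) (use le in auto)
qed

lemma convolution_semigroup_mixed_kernel:
  "convolution_semigroup (mixed_kernel \<sigma> :: real \<Rightarrow> 'a::euclidean_space \<Rightarrow> real)"
proof
  show "(\<lambda>(t, x). mixed_kernel \<sigma> t (x::'a)) \<in> borel_measurable (borel \<Otimes>\<^sub>M borel)" by measurable
  show "(\<integral>\<^sup>+x. ennreal (mixed_kernel \<sigma> t (x::'a)) \<partial>lborel) = 1" if "0 < t" for t
    using that by (simp add: nn_integral_mixed_kernel)
  show "(\<integral>\<^sup>+y. ennreal (mixed_kernel \<sigma> s y) * ennreal (mixed_kernel \<sigma> t (x - y)) \<partial>lborel) = ennreal (mixed_kernel \<sigma> (s + t) x)"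
    if st: "0 < s" "0 < t" for s t and x :: 'a
  proof -
    have i: "integrable lborel (\<lambda>y. mixed_kernel \<sigma> s y * mixed_kernel \<sigma> t (x - y))"
    proof (rule Bochner_Integration.integrable_bound[OF integrable_mult_left[OF integrable_mixed_kernel[of s], of "mixed_kernel \<sigma> t (0::'a)"]])
      show "AE y in lborel. norm (mixed_kernel \<sigma> s y * mixed_kernel \<sigma> t (x - y)) \<le> norm (mixed_kernel \<sigma> s y * mixed_kernel \<sigma> t (0::'a))"
        by (auto simp: abs_mult intro!: AE_I2 mult_left_mono mixed_kernel_le_0)
    qed measurable
    have "(\<integral>\<^sup>+y. ennreal (mixed_kernel \<sigma> s y) * ennreal (mixed_kernel \<sigma> t (x - y)) \<partial>lborel)
      = (\<integral>\<^sup>+y. ennreal (mixed_kernel \<sigma> s y * mixed_kernel \<sigma> t (x - y)) \<partial>lborel)"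
      by (simp add: ennreal_mult)
    also have "\<dots> = ennreal (mixed_kernel \<sigma> (s + t) x)"
      using i by (subst nn_integral_eq_integral) (auto simp: mixed_kernel_convolution[OF st])
    finally show ?thesis .
  qed
qed (auto intro!: mixed_kernel_L1_tendsto mixed_kernel_concentration)

text \<open>Both sides agree even if the integral diverges, since the Bochner integral and
  \<open>enn2real \<top>\<close> are then 0. So the identity is available for every nonnegative
  measurable \<phi>.\<close>

lemma heat_semigroup_eq:
  fixes \<phi> :: "'a::euclidean_space \<Rightarrow> real"
  assumes [measurable]: "\<phi> \<in> borel_measurable borel" and nn: "\<And>y. 0 \<le> \<phi> y" and t: "0 \<le> t"
  shows "heat_semigroup \<sigma> t \<phi> x = enn2real (convolution_semigroup.P (mixed_kernel \<sigma>) t (\<lambda>y. ennreal (\<phi> y)) x)"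
proof (cases "t = 0")
  case False
  then have t: "0 < t" using t by simp
  have "heat_semigroup \<sigma> t \<phi> x = (LINT y|lborel. mixed_kernel \<sigma> t (x - y) * \<phi> y)"
    using t by (simp add: heat_semigroup_def mixed_heat_kernel_eq)
  also have "\<dots> = enn2real (\<integral>\<^sup>+y. ennreal (mixed_kernel \<sigma> t (x - y) * \<phi> y) \<partial>lborel)"
    by (rule integral_eq_nn_integral) (auto intro!: mult_nonneg_nonneg nn)
  finally show ?thesis
    using t by (simp add: convolution_semigroup.P_def[OF convolution_semigroup_mixed_kernel] ennreal_mult nn)
qed (simp add: heat_semigroup_def nn convolution_semigroup.P_0[OF convolution_semigroup_mixed_kernel])

end

section \<open>Estimates in the essential supremum norm\<close>

lemma Linf_norm_le: "g \<in> borel_measurable borel \<Longrightarrow> AE x in lborel. \<bar>g x\<bar> \<le> c \<Longrightarrow> Linf_norm g \<le> ennreal c"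
  unfolding Linf_norm_def by (rule esssup_I) (auto elim!: eventually_mono intro: ennreal_leI)

lemma Linf_norm_AE: "AE x in lborel. ennreal \<bar>g x\<bar> \<le> Linf_norm g"
  unfolding Linf_norm_def by (rule esssup_AE)

lemma Linf_norm_leD: "Linf_norm g \<le> ennreal c \<Longrightarrow> 0 \<le> c \<Longrightarrow> AE x in lborel. \<bar>g x\<bar> \<le> c"
  using Linf_norm_AE[of g]
proof eventually_elim
  case (elim x)
  then have "ennreal \<bar>g x\<bar> \<le> ennreal c" by (metis order_trans)
  then show ?case using elim by simp
qed

lemma Linf_norm_triangle:
  assumes [measurable]: "g \<in> borel_measurable borel"
  shows "Linf_norm g \<le> Linf_norm g' + Linf_norm (\<lambda>x. g x - g' x)"
proof -
  have "AE x in lborel. ennreal \<bar>g x\<bar> \<le> Linf_norm g' + Linf_norm (\<lambda>x. g x - g' x)"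
    using Linf_norm_AE[of g'] Linf_norm_AE[of "\<lambda>x. g x - g' x"]
  proof eventually_elim
    case (elim x)
    have "ennreal \<bar>g x\<bar> \<le> ennreal (\<bar>g' x\<bar> + \<bar>g x - g' x\<bar>)" by (intro ennreal_leI) linarith
    also have "\<dots> = ennreal \<bar>g' x\<bar> + ennreal \<bar>g x - g' x\<bar>" by simp
    also have "\<dots> \<le> Linf_norm g' + Linf_norm (\<lambda>x. g x - g' x)" by (intro add_mono elim)
    finally show ?case .
  qed
  then show ?thesis unfolding Linf_norm_def[of g] by (intro esssup_I) auto
qed

context semilinear
begin

text \<open>It concerns every mild solution y and so takes the place of uniqueness. The semigroup
  carries V s to V t, and f(2 V) \<le> a V with total weight at most 1, so the Duhamel term of 2 V
  is at most V t: thus 2 V is a supersolution. The excess of y over 2 V obeys a Gronwall inequality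
  with constant \<Lambda>, hence is at most M (\<Lambda> t)^n / n! for every n.\<close>

lemma mild_solution_le:
  fixes y :: "real \<Rightarrow> 'a \<Rightarrow> real" and a :: "real \<Rightarrow> real" and T M :: real
  defines "V \<equiv> \<lambda>t x. enn2real (P t (\<lambda>z. ennreal (u0 z)) x)"
  assumes y_meas: "\<And>t. 0 \<le> t \<Longrightarrow> t \<le> T \<Longrightarrow> y t \<in> borel_measurable borel"
    and y_nonneg: "\<And>t x. 0 \<le> t \<Longrightarrow> t \<le> T \<Longrightarrow> 0 \<le> y t x"
    and M: "0 \<le> M" and y_le: "\<And>t. 0 \<le> t \<Longrightarrow> t \<le> T \<Longrightarrow> AE x in lborel. y t x \<le> M"
    and y_eq: "\<And>t. 0 \<le> t \<Longrightarrow> t \<le> T \<Longrightarrow> AE x in lborel. y t x = V t x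
        + (LINT s:{0..t}|lborel. enn2real (P (t - s) (\<lambda>z. ennreal (h s * f (y s z))) x))"
    and a_nonneg: "\<And>s. 0 \<le> s \<Longrightarrow> 0 \<le> a s"
    and a: "\<And>s x. 0 \<le> s \<Longrightarrow> s \<le> T \<Longrightarrow> f (2 * V s x) \<le> a s * V s x"
    and a_int: "\<And>t. 0 \<le> t \<Longrightarrow> set_integrable lborel {0..t} (\<lambda>s. h s * a s)"
    and a_le: "\<And>t. 0 \<le> t \<Longrightarrow> (LINT s:{0..t}|lborel. h s * a s) \<le> 1"
    and t: "0 \<le> t" "t \<le> T"
  shows "AE x in lborel. y t x \<le> 2 * V t x"
proof -
  obtain B where B: "B > 0" "\<And>s. 0 \<le> s \<Longrightarrow> s \<le> T \<Longrightarrow> h s \<le> B" using h_bounded[of T] by blast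
  define \<Lambda> where "\<Lambda> = B * f (M + 1)"
  have fM: "0 < f (M + 1)" using M by (intro f_pos) simp
  have \<Lambda>: "0 < \<Lambda>" using B fM by (simp add: \<Lambda>_def)
  define E where "E n s = M * ((\<Lambda> * s) ^ n / fact n)" for n s
  have E_nonneg: "0 \<le> E n s" if "0 \<le> s" for n s using that M \<Lambda> by (simp add: E_def)
  have V_fin: "P s (\<lambda>z. ennreal (u0 z)) x < \<top>" for s x
    by (rule le_less_trans[OF P_le_const[of _ "ennreal U0"]]) (simp_all add: u0_le ennreal_leI)
  have V_ennreal: "ennreal (V s x) = P s (\<lambda>z. ennreal (u0 z)) x" for s x
    using V_fin[of s x] by (simp add: V_def)
  have V_nonneg: "0 \<le> V s x" for s x by (simp add: V_def)
  have [measurable]: "V s \<in> borel_measurable borel" for s unfolding V_def by measurable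
  have E_int: "(LINT s|lborel. indicator {0..t} s * (\<Lambda> * E n s)) = E (Suc n) t"
    and E_integrable: "integrable lborel (\<lambda>s. indicator {0..t} s * (\<Lambda> * E n s))" if "0 \<le> t" for n t
  proof -
    have eq: "indicator {0..t} s * (\<Lambda> * E n s) = (\<Lambda> ^ Suc n * M / fact n) * (s ^ n * indicator {0..t} s)" for s
      by (simp add: E_def power_mult_distrib)
    have "continuous_on {0..t} (\<lambda>s. s ^ n :: real)" by (intro continuous_intros)
    from borel_integrable_atLeastAtMost'[OF this]
    have "integrable lborel (\<lambda>s. s ^ n * indicator {0..t} s :: real)" by (simp add: set_integrable_def mult.commute)
    then show "integrable lborel (\<lambda>s. indicator {0..t} s * (\<Lambda> * E n s))" unfolding eq by (rule integrable_mult_right)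
    have "(LINT s|lborel. s ^ n * indicator {0..t} s) = t ^ Suc n / Suc n"
      using integral_power[OF that, of n] by simp
    then have "(LINT s|lborel. indicator {0..t} s * (\<Lambda> * E n s)) = (\<Lambda> ^ Suc n * M / fact n) * (t ^ Suc n / Suc n)"
      unfolding eq by simp
    also have "\<dots> = E (Suc n) t" by (simp add: E_def power_mult_distrib fact_Suc ac_simps)
    finally show "(LINT s|lborel. indicator {0..t} s * (\<Lambda> * E n s)) = E (Suc n) t" .
  qed
  \<comment> \<open>If b exceeds 2 V by at most e, the Lipschitz bound on [0, M] charges at most
    \<Lambda> e for the excess.\<close>
  have f_bound: "h s * f b \<le> h s * a s * V s x + \<Lambda> * e"
    if s: "0 \<le> s" "s \<le> T" and b: "0 \<le> b" "b \<le> M" "b \<le> 2 * V s x + e" and e: "0 \<le> e" for s x b e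
  proof -
    have "f b \<le> a s * V s x + f (M + 1) * e"
    proof (cases "b \<le> 2 * V s x")
      case True
      then have "f b \<le> f (2 * V s x)" using b by (intro f_mono) auto
      also have "\<dots> \<le> a s * V s x" by (rule a[OF s])
      finally show ?thesis using fM e by (simp add: add_increasing2)
    next
      case False
      have "f b - f (2 * V s x) \<le> f (M + 1) * (b - 2 * V s x)"
        using False b V_nonneg[of s x] by (intro f_lipschitz) auto
      also have "\<dots> \<le> f (M + 1) * e" using b fM by (intro mult_left_mono) auto
      finally show ?thesis using a[OF s, of x] by simp
    qed
    then have "h s * f b \<le> h s * (a s * V s x + f (M + 1) * e)" using h_nonneg[OF s(1)] by (intro mult_left_mono)
    also have "\<dots> \<le> h s * a s * V s x + \<Lambda> * e"
      using mult_right_mono[OF B(2)[OF s], of "f (M + 1) * e"] fM e by (simp add: \<Lambda>_def algebra_simps)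
    finally show ?thesis .
  qed
  have main: "AE x in lborel. y t x \<le> 2 * V t x + E n t" if "0 \<le> t" "t \<le> T" for n t
    using that
  proof (induction n arbitrary: t)
    case 0
    from y_le[OF 0] show ?case by eventually_elim (use V_nonneg in \<open>simp add: E_def add_increasing\<close>)
  next
    case (Suc n)
    from y_eq[OF Suc.prems] Suc.IH[OF Suc.prems] y_le[OF Suc.prems] show ?case
    proof eventually_elim
      case (elim x)
      have pt: "enn2real (P (t - s) (\<lambda>z. ennreal (h s * f (y s z))) x) \<le> h s * a s * V t x + \<Lambda> * E n s"
        if s: "0 \<le> s" "s \<le> t" for s
      \<comment> \<open>At s = t the operator is the identity, so the induction hypothesis is used
        at the point x itself; this is why x was taken outside the exceptional sets of time
        t.\<close>
      proof (cases "s = t")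
        case True
        have "0 \<le> h t * f (y t x)" using Suc.prems by (intro mult_nonneg_nonneg h_nonneg f_nonneg y_nonneg)
        then show ?thesis using True f_bound[of t "y t x" x "E n t"] Suc.prems elim E_nonneg[of t n] y_nonneg[of t x] by simp
      next
        case False
        then have ts: "0 < t - s" using s by simp
        have sT: "s \<le> T" using s Suc.prems by simp
        have ha: "0 \<le> h s * a s" using s by (intro mult_nonneg_nonneg h_nonneg a_nonneg) auto
        have le: "0 \<le> \<Lambda> * E n s" using \<Lambda> E_nonneg[OF s(1)] by simp
        have "P (t - s) (\<lambda>z. ennreal (h s * f (y s z))) x \<le> P (t - s) (\<lambda>z. ennreal (h s * a s) * ennreal (V s z) + ennreal (\<Lambda> * E n s)) x"
        proof (rule P_mono_AE[OF ts])
          from Suc.IH[OF s(1) sT] y_le[OF s(1) sT]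
          show "AE z in lborel. ennreal (h s * f (y s z)) \<le> ennreal (h s * a s) * ennreal (V s z) + ennreal (\<Lambda> * E n s)"
          proof eventually_elim
            case (elim z)
            have "ennreal (h s * f (y s z)) \<le> ennreal (h s * a s * V s z + \<Lambda> * E n s)"
              using f_bound[of s "y s z" z "E n s"] s sT elim E_nonneg[of s n] y_nonneg[of s z] by (intro ennreal_leI) auto
            also have "\<dots> = ennreal (h s * a s) * ennreal (V s z) + ennreal (\<Lambda> * E n s)"
              using ha le V_nonneg[of s z] by (simp add: ennreal_mult)
            finally show ?case .
          qed
        qed
        also have "\<dots> = ennreal (h s * a s) * P (t - s) (P s (\<lambda>z. ennreal (u0 z))) x + ennreal (\<Lambda> * E n s)"
          by (subst P_add; (subst P_cmult)?) (auto simp: V_ennreal)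
        also have "P (t - s) (P s (\<lambda>z. ennreal (u0 z))) x = ennreal (V t x)"
          using s by (subst P_P) (auto simp: V_ennreal)
        also have "ennreal (h s * a s) * ennreal (V t x) + ennreal (\<Lambda> * E n s) = ennreal (h s * a s * V t x + \<Lambda> * E n s)"
          using ha le V_nonneg[of t x] by (simp add: ennreal_mult)
        finally have "enn2real (P (t - s) (\<lambda>z. ennreal (h s * f (y s z))) x) \<le> enn2real (ennreal (h s * a s * V t x + \<Lambda> * E n s))"
          by (intro enn2real_mono) auto
        then show ?thesis using ha le V_nonneg[of t x] by (subst (asm) enn2real_ennreal) auto
      qed
      let ?R = "\<lambda>s. (indicator {0..t} s * (h s * a s)) * V t x + indicator {0..t} s * (\<Lambda> * E n s)"
      have hai: "integrable lborel (\<lambda>s. indicator {0..t} s * (h s * a s))"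
        using a_int[OF Suc.prems(1)] by (simp add: set_integrable_def)
      have "(LINT s:{0..t}|lborel. enn2real (P (t - s) (\<lambda>z. ennreal (h s * f (y s z))) x)) \<le> (LINT s|lborel. ?R s)"
        unfolding set_lebesgue_integral_def
      proof (rule integral_mono')
        show "integrable lborel ?R"
          by (intro Bochner_Integration.integrable_add integrable_mult_left hai E_integrable Suc.prems)
        fix s
        show "indicator {0..t} s *\<^sub>R enn2real (P (t - s) (\<lambda>z. ennreal (h s * f (y s z))) x) \<le> ?R s"
          using pt[of s] by (cases "s \<in> {0..t}") auto
        show "0 \<le> ?R s"
          using \<Lambda> E_nonneg[of s n] V_nonneg[of t x] h_nonneg[of s] a_nonneg[of s]
          by (cases "s \<in> {0..t}") (auto intro!: add_nonneg_nonneg mult_nonneg_nonneg)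
      qed
      also have "\<dots> = (LINT s|lborel. indicator {0..t} s * (h s * a s)) * V t x + E (Suc n) t"
        using hai E_integrable[OF Suc.prems(1), of n] E_int[OF Suc.prems(1), of n] by simp
      also have "\<dots> \<le> 1 * V t x + E (Suc n) t"
        using a_le[OF Suc.prems(1)] V_nonneg[of t x]
        by (intro add_right_mono mult_right_mono) (auto simp: set_lebesgue_integral_def)
      finally show ?case using elim(1) by simp
    qed
  qed
  \<comment> \<open>Countably many exceptional null sets are merged before n tends to infinity at a
    fixed x.\<close>
  have "AE x in lborel. \<forall>n. y t x \<le> 2 * V t x + E n t"
    unfolding AE_all_countable using main[OF t] by blast
  then show ?thesis
  proof eventually_elim
    case (elim x)
    have "(\<lambda>n. (\<Lambda> * t) ^ n /\<^sub>R fact n) \<longlonglongrightarrow> 0"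
      by (rule summable_LIMSEQ_zero[OF summable_exp_generic])
    then have "(\<lambda>n. 2 * V t x + M * ((\<Lambda> * t) ^ n /\<^sub>R fact n)) \<longlonglongrightarrow> 2 * V t x + M * 0"
      by (intro tendsto_intros)
    then have "(\<lambda>n. 2 * V t x + E n t) \<longlonglongrightarrow> 2 * V t x" by (simp add: E_def divide_inverse mult.commute)
    from LIMSEQ_le_const[OF this] elim show ?case by blast
  qed
qed

end

section \<open>Functions vanishing at infinity and limits in [0,\<infinity>]\<close>

lemma in_C0_bounded:
  fixes g :: "'a::euclidean_space \<Rightarrow> real"
  assumes "in_C0 g"
  shows "\<exists>U. \<forall>x. \<bar>g x\<bar> \<le> U"
proof -
  have cont: "continuous_on UNIV g" and lim: "(g \<longlongrightarrow> 0) at_infinity" using assms by (auto simp: in_C0_def)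
  have "eventually (\<lambda>x. dist (g x) 0 < 1) at_infinity" using lim by (rule tendstoD) simp
  then obtain b where b: "\<And>x. b \<le> norm x \<Longrightarrow> \<bar>g x\<bar> < 1"
    by (auto simp: eventually_at_infinity dist_real_def)
  have "compact (g ` cball 0 b)"
    by (intro compact_continuous_image continuous_on_subset[OF cont]) auto
  from compact_imp_bounded[OF this] obtain C where C: "\<forall>y\<in>g ` cball 0 b. norm y \<le> C"
    unfolding bounded_iff by (elim exE)
  have "\<bar>g x\<bar> \<le> max C 1" for x
  proof (cases "norm x \<le> b")
    case True
    then have "norm (g x) \<le> C" by (intro bspec[OF C] imageI) simp
    then show ?thesis by simp
  next
    case False
    then show ?thesis using b[of x] by simp
  qed
  then show ?thesis by blast
qed

lemma in_C0_uniformly_continuous: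
  fixes g :: "'a::euclidean_space \<Rightarrow> real"
  assumes "in_C0 g"
  shows "uniformly_continuous_on UNIV g"
  unfolding uniformly_continuous_on_def
proof (intro allI impI)
  fix e :: real assume e: "0 < e"
  have cont: "continuous_on UNIV g" and lim: "(g \<longlongrightarrow> 0) at_infinity" using assms by (auto simp: in_C0_def)
  have "eventually (\<lambda>x. dist (g x) 0 < e / 2) at_infinity" using lim by (rule tendstoD) (use e in simp)
  then obtain b where b: "\<And>x. b \<le> norm x \<Longrightarrow> \<bar>g x\<bar> < e / 2"
    by (auto simp: eventually_at_infinity dist_real_def)
  have "uniformly_continuous_on (cball 0 (b + 1)) g"
    by (intro compact_uniformly_continuous continuous_on_subset[OF cont]) auto
  then obtain d where d: "d > 0" "\<And>x y. x \<in> cball 0 (b + 1) \<Longrightarrow> y \<in> cball 0 (b + 1) \<Longrightarrow> dist y x < d \<Longrightarrow> dist (g y) (g x) < e"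
    unfolding uniformly_continuous_on_def using e by meson
  have "dist (g y) (g x) < e" if "dist y x < min d 1" for x y
  proof (cases "b \<le> norm x \<and> b \<le> norm y")
    case True
    then show ?thesis using b[of x] b[of y] by (simp add: dist_real_def)
  next
    case False
    have "norm x \<le> norm y + dist y x" "norm y \<le> norm x + dist y x"
      using norm_triangle_ineq2[of x y] norm_triangle_ineq2[of y x] by (auto simp: dist_norm norm_minus_commute)
    then have "norm x \<le> b + 1" "norm y \<le> b + 1" using False that by auto
    then show ?thesis using that by (intro d) auto
  qed
  then show "\<exists>d>0. \<forall>x\<in>UNIV. \<forall>x'\<in>UNIV. dist x' x < d \<longrightarrow> dist (g x') (g x) < e"
    using d(1) by (intro exI[of _ "min d 1"]) auto
qed

lemma ennreal_tendsto_0I: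
  fixes g :: "'b \<Rightarrow> ennreal"
  assumes "\<And>\<epsilon>. 0 < \<epsilon> \<Longrightarrow> eventually (\<lambda>x. g x \<le> ennreal \<epsilon>) \<F>"
  shows "(g \<longlongrightarrow> 0) \<F>"
proof (rule order_tendstoI)
  fix a :: ennreal assume "0 < a"
  then obtain z where z: "0 < z" "z < a" using dense by blast
  then obtain r where r: "z = ennreal r" "0 < r" by (cases z) (auto simp: ennreal_less_zero_iff)
  from assms[OF r(2)] show "eventually (\<lambda>x. g x < a) \<F>"
    by eventually_elim (use r z in \<open>auto intro: le_less_trans\<close>)
qed simp

lemma ennreal_tendsto_topI:
  fixes g :: "'b \<Rightarrow> ennreal"
  assumes "\<And>M. 0 \<le> M \<Longrightarrow> eventually (\<lambda>x. ennreal M < g x) \<F>"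
  shows "(g \<longlongrightarrow> \<infinity>) \<F>"
proof (rule order_tendstoI)
  fix a :: ennreal assume "a < \<infinity>"
  then obtain r where r: "a = ennreal r" "0 \<le> r" by (cases a) auto
  from assms[OF r(2)] show "eventually (\<lambda>x. a < g x) \<F>" by (simp add: r)
qed simp

lemma (in semilinear) bounded_untilE:
  assumes "bounded_until S"
  obtains M B where "0 \<le> S" "0 < M" "\<And>t x. 0 \<le> t \<Longrightarrow> t \<le> S \<Longrightarrow> W t x \<le> ennreal M"
    "0 < B" "\<And>t. 0 \<le> t \<Longrightarrow> t \<le> S \<Longrightarrow> h t \<le> B"
proof -
  obtain M where M: "M > 0" "\<And>t x. 0 \<le> t \<Longrightarrow> t \<le> S \<Longrightarrow> W t x \<le> ennreal M"
    using assms unfolding bounded_until_def by auto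
  obtain B where B: "B > 0" "\<And>t. 0 \<le> t \<Longrightarrow> t \<le> S \<Longrightarrow> h t \<le> B" using h_bounded[of S] by blast
  show ?thesis using that[of M B] M B assms by (simp add: bounded_until_def)
qed

section \<open>Test functions and blow-up for the mixed operator\<close>

locale mixed_dichotomy = mixed_order \<sigma> + convex_source f
  for \<sigma> :: real and f :: "real \<Rightarrow> real" +
  fixes h :: "real \<Rightarrow> real"
  assumes h_cont: "continuous_on {0..} h" and h_nn: "\<And>t. 0 \<le> t \<Longrightarrow> 0 \<le> h t"
begin

lemma semilinear_mixed:
  fixes u0 :: "'a::euclidean_space \<Rightarrow> real"
  assumes "in_C0 u0" "\<And>x. 0 \<le> u0 x" "\<And>x. u0 x \<le> U"
  shows "semilinear (mixed_kernel \<sigma>) f h u0 U"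
proof -
  interpret convolution_semigroup "mixed_kernel \<sigma> :: real \<Rightarrow> 'a \<Rightarrow> real"
    by (rule convolution_semigroup_mixed_kernel)
  show ?thesis
    by standard (use assms h_cont h_nn in_C0_uniformly_continuous in auto)
qed

lemma weight_mass:
  assumes t: "0 < t"
  shows "(\<integral>\<^sup>+x. ennreal (gauss (t powr (- (1 / \<sigma>))) (x::'a::euclidean_space)) \<partial>lborel)
    = ennreal (sqrt pi ^ DIM('a) * t powr (real DIM('a) / (2 * \<sigma>)))"
proof -
  let ?b = "t powr (- (1 / \<sigma>))"
  have b: "0 < ?b" using t by simp
  have sq: "sqrt ?b = t powr (- (1 / (2 * \<sigma>)))"
    using t by (simp add: powr_half_sqrt[symmetric] powr_powr mult.commute)
  have "sqrt (pi / ?b) = sqrt pi * t powr (1 / (2 * \<sigma>))"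
    unfolding real_sqrt_divide sq by (simp only: powr_minus divide_inverse inverse_inverse_eq)
  then have "sqrt (pi / ?b) ^ DIM('a) = sqrt pi ^ DIM('a) * t powr (real DIM('a) / (2 * \<sigma>))"
    using powr_realpow[of "t powr (1 / (2 * \<sigma>))" "DIM('a)"] t by (simp add: power_mult_distrib powr_powr)
  moreover have "(\<integral>\<^sup>+x. ennreal (gauss ?b (x::'a)) \<partial>lborel) = ennreal (LINT x|lborel. gauss ?b (x::'a))"
    by (rule nn_integral_eq_integral[OF gauss_fourier(1)[OF b]]) simp
  ultimately show ?thesis by (simp add: gauss_fourier(3)[OF b])
qed

text \<open>With b = t^(-1/\<sigma>) one has \<tau> b^\<sigma> \<le> 1 for all \<tau> \<le> t, and b
  \<le> 1 because t \<ge> 1: exactly the range of the uniform lower bound for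
  \<open>kernel_gauss\<close>. Passing from r to t only widens the Gaussian.\<close>

lemma weight_super:
  obtains c where "0 < c" "\<And>r t \<tau> x. 1 \<le> r \<Longrightarrow> r \<le> t \<Longrightarrow> 0 \<le> \<tau> \<Longrightarrow> \<tau> \<le> t \<Longrightarrow>
    ennreal c * ennreal (gauss (r powr (- (1 / \<sigma>))) (x::'a::euclidean_space))
      \<le> convolution_semigroup.P (mixed_kernel \<sigma>) \<tau> (\<lambda>y. ennreal (gauss (t powr (- (1 / \<sigma>))) y)) x"
proof -
  interpret convolution_semigroup "mixed_kernel \<sigma> :: real \<Rightarrow> 'a \<Rightarrow> real"
    by (rule convolution_semigroup_mixed_kernel)
  obtain c0 where c0: "c0 > 0" "\<And>t b. 0 \<le> t \<Longrightarrow> 0 < b \<Longrightarrow> b \<le> 1 \<Longrightarrow> t * b powr \<sigma> \<le> 1 \<Longrightarrow> c0 \<le> kernel_gauss TYPE('a) \<sigma> t b"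
    using kernel_gauss_lower[where 'a='a] by blast
  \<comment> \<open>The bound 1 settles \<tau> = 0, where no convolution takes place.\<close>
  define c where "c = min c0 1"
  have c: "0 < c" "c \<le> 1" "c \<le> c0" using c0 by (auto simp: c_def)
  show ?thesis
  proof (rule that[OF c(1)])
    fix r t \<tau> :: real and x :: 'a
    assume r: "1 \<le> r" "r \<le> t" and \<tau>: "0 \<le> \<tau>" "\<tau> \<le> t"
    let ?b = "t powr (- (1 / \<sigma>))"
    have t: "1 \<le> t" using r by simp
    have b: "0 < ?b" using t by simp
    have b1: "?b \<le> 1"
    proof -
      have "?b \<le> t powr 0" using t \<sigma> by (intro powr_mono) auto
      then show ?thesis using t by simp
    qed
    have br: "?b \<le> r powr (- (1 / \<sigma>))" using r \<sigma> by (intro powr_mono2') auto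
    have "gauss (r powr (- (1 / \<sigma>))) x \<le> gauss ?b x" by (rule gauss_antimono[OF br])
    then have g: "c * gauss (r powr (- (1 / \<sigma>))) x \<le> c * gauss ?b x" using c by (intro mult_left_mono) auto
    show "ennreal c * ennreal (gauss (r powr (- (1 / \<sigma>))) x) \<le> P \<tau> (\<lambda>y. ennreal (gauss ?b y)) x"
    proof (cases "\<tau> = 0")
      case True
      have "c * gauss ?b x \<le> 1 * gauss ?b x" using c by (intro mult_right_mono) auto
      then have "c * gauss (r powr (- (1 / \<sigma>))) x \<le> gauss ?b x" using g by linarith
      then show ?thesis using True c by (simp add: ennreal_mult[symmetric] ennreal_leI)
    next
      case False
      then have \<tau>': "0 < \<tau>" using \<tau> by simp
      have "\<tau> * ?b powr \<sigma> \<le> 1"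
      proof -
        have eq: "?b powr \<sigma> = inverse t" using t \<sigma> powr_minus[of t 1] by (simp add: powr_powr)
        show ?thesis unfolding eq using \<tau> t by (simp add: field_simps)
      qed
      then have kg: "c \<le> kernel_gauss TYPE('a) \<sigma> \<tau> ?b" using c0(2)[of \<tau> ?b] \<tau> b b1 c(3) by simp
      have i: "integrable lborel (\<lambda>y. mixed_kernel \<sigma> \<tau> y * gauss ?b (x - y))"
        by (rule Bochner_Integration.integrable_bound[OF integrable_mixed_kernel[of \<tau>]])
           (auto simp: abs_mult intro!: AE_I2 mult_left_le gauss_le_1)
      have "P \<tau> (\<lambda>y. ennreal (gauss ?b y)) x = (\<integral>\<^sup>+y. ennreal (mixed_kernel \<sigma> \<tau> y) * ennreal (gauss ?b (x - y)) \<partial>lborel)"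
        using nn_integral_reflect[of "\<lambda>y. ennreal (mixed_kernel \<sigma> \<tau> y) * ennreal (gauss ?b (x - y))" x] \<tau>' by (simp add: P_def)
      also have "\<dots> = (\<integral>\<^sup>+y. ennreal (mixed_kernel \<sigma> \<tau> y * gauss ?b (x - y)) \<partial>lborel)"
        by (simp add: ennreal_mult)
      also have "\<dots> = ennreal (LINT y|lborel. mixed_kernel \<sigma> \<tau> y * gauss ?b (x - y))"
        by (rule nn_integral_eq_integral[OF i]) simp
      finally have eq: "P \<tau> (\<lambda>y. ennreal (gauss ?b y)) x = ennreal (LINT y|lborel. mixed_kernel \<sigma> \<tau> y * gauss ?b (x - y))" .
      have "c * gauss (r powr (- (1 / \<sigma>))) x \<le> kernel_gauss TYPE('a) \<sigma> \<tau> ?b * gauss ?b x"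
        by (rule order_trans[OF g mult_right_mono[OF kg gauss_nonneg]])
      also have "\<dots> \<le> (LINT y|lborel. mixed_kernel \<sigma> \<tau> y * gauss ?b (x - y))"
        using mixed_kernel_conv_gauss_ge[OF \<tau>' b, of x] by (simp add: mult.commute)
      finally show ?thesis unfolding eq using c by (simp add: ennreal_mult[symmetric] ennreal_leI)
    qed
  qed
qed

text \<open>If W were bounded on all finite intervals, the test functions would contradict the
  divergence in (ii). So W has a finite blow-up time T, is a mild solution before T, and is maximal
  because any continuation would be bounded near T.\<close>

lemma blow_up:
  fixes u0 :: "'a::euclidean_space \<Rightarrow> real"
  assumes u0: "in_C0 u0" "\<And>x. 0 < u0 x"
    and fm: "(\<integral>\<^sup>+x. ennreal (1 / minorant f x) * indicator {1..} x \<partial>lborel) < \<infinity>"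
    and div: "\<And>\<epsilon>. 0 < \<epsilon> \<Longrightarrow> (\<integral>\<^sup>+t. ennreal (h t * t powr (real DIM('a) / (2 * \<sigma>)) * f (\<epsilon> * t powr (- (real DIM('a) / (2 * \<sigma>))))) * indicator {1..} t \<partial>lborel) = \<infinity>"
  shows "blows_up_in_finite_time \<sigma> h f u0"
proof -
  let ?\<gamma> = "real DIM('a) / (2 * \<sigma>)"
  obtain U where U: "\<And>x. \<bar>u0 x\<bar> \<le> U" using in_C0_bounded[OF u0(1)] by blast
  interpret semilinear "mixed_kernel \<sigma> :: real \<Rightarrow> 'a \<Rightarrow> real" f h u0 U
    by (rule semilinear_mixed) (use u0 U in \<open>auto simp: less_imp_le abs_le_iff\<close>)
  have "\<exists>T\<ge>0. \<not> bounded_until T"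
  proof (rule ccontr)
    assume "\<not> (\<exists>T\<ge>0. \<not> bounded_until T)"
    then have glob: "\<And>T. 0 \<le> T \<Longrightarrow> bounded_until T" by blast
    obtain c where c: "0 < c" "\<And>r t \<tau> x. 1 \<le> r \<Longrightarrow> r \<le> t \<Longrightarrow> 0 \<le> \<tau> \<Longrightarrow> \<tau> \<le> t \<Longrightarrow>
      ennreal c * ennreal (gauss (r powr (- (1 / \<sigma>))) (x::'a)) \<le> P \<tau> (\<lambda>y. ennreal (gauss (t powr (- (1 / \<sigma>))) y)) x"
      using weight_super[where 'a='a] by blast
    have m0: "0 < (\<integral>\<^sup>+x. ennreal (gauss (1 powr (- (1 / \<sigma>))) x) * ennreal (u0 x) \<partial>lborel)"
    proof (rule ccontr)
      assume "\<not> ?thesis"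
      then have "(\<integral>\<^sup>+x. ennreal (gauss (1 powr (- (1 / \<sigma>))) x) * ennreal (u0 x) \<partial>lborel) = 0" by (simp add: not_less)
      then have "AE x in lborel. ennreal (gauss (1 powr (- (1 / \<sigma>))) x) * ennreal (u0 x) = 0"
        by (subst (asm) nn_integral_0_iff_AE) auto
      then have "AE x::'a in lborel. False"
      proof eventually_elim
        case (elim x)
        then have "gauss (1 powr (- (1 / \<sigma>))) x \<le> 0 \<or> u0 x \<le> 0" by (simp only: mult_eq_0_iff ennreal_eq_0_iff)
        then show ?case using gauss_pos[of "1 powr (- (1 / \<sigma>))" x] u0(2)[of x] by linarith
      qed
      then show False using AE_False_lborel by blast
    qed
    have "\<exists>\<epsilon>>0. (\<integral>\<^sup>+t. ennreal (h t * t powr ?\<gamma> * f (\<epsilon> * t powr (- ?\<gamma>))) * indicator {1..} t \<partial>lborel) < \<infinity>"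
    proof (rule global_solution_impossible[OF glob, where \<psi> = "\<lambda>t. gauss (t powr (- (1 / \<sigma>)))" and \<zeta> = "sqrt pi ^ DIM('a)"])
      show "(\<lambda>(t, x). gauss (t powr (- (1 / \<sigma>))) (x::'a)) \<in> borel_measurable (borel \<Otimes>\<^sub>M borel)" by measurable
      show "0 < ?\<gamma>" using \<sigma> by simp
      show "(\<integral>\<^sup>+x. ennreal (gauss (t powr (- (1 / \<sigma>))) (x::'a)) \<partial>lborel) = ennreal (sqrt pi ^ DIM('a) * t powr ?\<gamma>)" if "1 \<le> t" for t
        by (rule weight_mass) (use that in simp)
    qed (use c m0 fm in auto)
    then show False using div by force
  qed
  then show ?thesis
  proof (cases rule: blow_up_time)
    case (time T)
    have below: "bounded_until t" if "0 \<le> t" "t < T" for t using time(2) that .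
    have heat_u0: "heat_semigroup \<sigma> t u0 x = enn2real (P t (\<lambda>y. ennreal (u0 y)) x)" if "0 \<le> t" for t x
      using that by (intro heat_semigroup_eq) (auto simp: u0_nonneg)
    have fu: "(\<lambda>z. h s * f (u s z)) \<in> borel_measurable borel" for s
    proof -
      have "(\<lambda>z. h s * f (max 0 (u s z))) \<in> borel_measurable borel" by measurable
      then show ?thesis by (simp add: max_absorb2)
    qed
    have mild: "mild_solution \<sigma> h f u0 (ereal T) u"
      unfolding mild_solution_def
    proof (intro conjI allI impI)
      show "0 < ereal T" using time(1) by simp
      fix t assume "0 \<le> t \<and> ereal t < ereal T"
      then have t: "0 \<le> t" "t < T" by auto
      show "0 \<le> u t x" for x by simp
      \<comment> \<open>A time strictly between t and T, so that continuity at t can be checked from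
        both sides within an interval on which u is bounded.\<close>
      define S where "S = (t + T) / 2"
      have S: "t < S" "S < T" "0 \<le> S" using t by (auto simp: S_def)
      obtain M B where MB: "0 \<le> S" "0 < M" "\<And>t x. 0 \<le> t \<Longrightarrow> t \<le> S \<Longrightarrow> W t x \<le> ennreal M"
        "0 < B" "\<And>t. 0 \<le> t \<Longrightarrow> t \<le> S \<Longrightarrow> h t \<le> B"
        using bounded_untilE[OF below[OF S(3,2)]] by metis
      show "in_Linf (u t)"
      proof -
        have "Linf_norm (u t) \<le> ennreal M"
          by (rule Linf_norm_le) (use u_le[OF MB] t S in \<open>auto intro!: AE_I2\<close>)
        also have "\<dots> < \<infinity>" by simp
        finally show ?thesis by (simp add: in_Linf_def)
      qed
      show "((\<lambda>s. Linf_norm (\<lambda>x. u s x - u t x)) \<longlongrightarrow> 0) (at t within {s. 0 \<le> s \<and> ereal s < ereal T})"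
        unfolding tendsto_at_iff_sequentially
      proof (intro allI impI)
        fix X :: "nat \<Rightarrow> real"
        assume X: "\<forall>i. X i \<in> {s. 0 \<le> s \<and> ereal s < ereal T} - {t}" "X \<longlonglongrightarrow> t"
        \<comment> \<open>Truncation keeps the whole sequence in [0, S] and eventually changes
          nothing.\<close>
        define Y where "Y n = min (X n) S" for n
        have "Y \<longlonglongrightarrow> min t S" unfolding Y_def by (intro tendsto_intros X)
        then have Y: "Y \<longlonglongrightarrow> t" "\<And>n. 0 \<le> Y n" "\<And>n. Y n \<le> S" using S X(1) by (auto simp: Y_def min_def split: if_splits)
        show "((\<lambda>s. Linf_norm (\<lambda>x. u s x - u t x)) \<circ> X) \<longlonglongrightarrow> 0"
        proof (rule ennreal_tendsto_0I)
          fix \<epsilon> :: real assume \<epsilon>: "0 < \<epsilon>"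
          have "eventually (\<lambda>n. X n < S) sequentially" using order_tendstoD(2)[OF X(2) S(1)] .
          moreover have "eventually (\<lambda>n. \<forall>x. \<bar>u (Y n) x - u t x\<bar> \<le> \<epsilon>) sequentially"
            by (rule u_tendsto[OF MB t(1) less_imp_le[OF S(1)] Y \<epsilon>])
          ultimately show "eventually (\<lambda>n. ((\<lambda>s. Linf_norm (\<lambda>x. u s x - u t x)) \<circ> X) n \<le> ennreal \<epsilon>) sequentially"
          proof eventually_elim
            case (elim n)
            then have "Y n = X n" by (simp add: Y_def)
            then show ?case using elim unfolding comp_def by (intro Linf_norm_le AE_I2) auto
          qed
        qed
      qed
      show "AE x in lborel. u t x = heat_semigroup \<sigma> t u0 x + (LINT s:{0..t}|lborel. heat_semigroup \<sigma> (t - s) (\<lambda>y. h s * f (u s y)) x)"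
      proof (rule AE_I2)
        fix x
        have "(LINT s:{0..t}|lborel. heat_semigroup \<sigma> (t - s) (\<lambda>y. h s * f (u s y)) x)
          = (LINT s:{0..t}|lborel. enn2real (P (t - s) (\<lambda>y. ennreal (h s * f (u s y))) x))"
          by (rule set_lebesgue_integral_cong) (auto intro!: heat_semigroup_eq fu mult_nonneg_nonneg h_nonneg f_nonneg)
        then show "u t x = heat_semigroup \<sigma> t u0 x + (LINT s:{0..t}|lborel. heat_semigroup \<sigma> (t - s) (\<lambda>y. h s * f (u s y)) x)"
          using mild_equation[OF MB t(1) less_imp_le[OF S(1)], of x] heat_u0[OF t(1)] by simp
      qed
    qed
    have W_u': "W t x = ennreal (u t x)" if t: "0 \<le> t" "t < T" for t x
    proof -
      obtain M B where MB: "0 \<le> t" "0 < M" "\<And>s x. 0 \<le> s \<Longrightarrow> s \<le> t \<Longrightarrow> W s x \<le> ennreal M"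
        "0 < B" "\<And>s. 0 \<le> s \<Longrightarrow> s \<le> t \<Longrightarrow> h s \<le> B"
        using bounded_untilE[OF below[OF t]] by metis
      show ?thesis by (rule W_u[OF MB]) (use t in auto)
    qed
    have pos_ev: "eventually (\<lambda>t. 0 < t \<and> t < T) (at_left T)"
      using time(1) by (intro eventually_at_leftI[of 0]) auto
    have blow: "((\<lambda>t. Linf_norm (u t)) \<longlongrightarrow> \<infinity>) (at_left T)"
    proof (rule ennreal_tendsto_topI)
      fix M :: real assume M: "0 \<le> M"
      from time(3)[of M] pos_ev show "eventually (\<lambda>t. ennreal M < Linf_norm (u t)) (at_left T)"
      proof eventually_elim
        case (elim t)
        show ?case
        proof (rule ccontr)
          assume "\<not> ?thesis"
          then have "AE x in lborel. \<bar>u t x\<bar> \<le> M" using M by (intro Linf_norm_leD) auto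
          then have "AE x in lborel. W t x \<le> ennreal M"
            by eventually_elim (use elim in \<open>auto simp: W_u' intro: ennreal_leI\<close>)
          then show False using elim by blast
        qed
      qed
    qed
    \<comment> \<open>A continuation v has a finite norm M at T and is continuous in norm there, so
      v, and with it u, is essentially bounded by M + 1 just before T, against the choice of
      T.\<close>
    have "\<not> (\<exists>T' v. ereal T < T' \<and> mild_solution \<sigma> h f u0 T' v \<and> (\<forall>t. 0 \<le> t \<and> ereal t < ereal T \<longrightarrow> (AE x in lborel. v t x = u t x)))"
    proof
      assume "\<exists>T' v. ereal T < T' \<and> mild_solution \<sigma> h f u0 T' v \<and> (\<forall>t. 0 \<le> t \<and> ereal t < ereal T \<longrightarrow> (AE x in lborel. v t x = u t x))"
      then obtain T' v where T': "ereal T < T'" and v: "mild_solution \<sigma> h f u0 T' v"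
        and eq: "\<And>t. 0 \<le> t \<Longrightarrow> t < T \<Longrightarrow> AE x in lborel. v t x = u t x" by auto
      have vT: "in_Linf (v T)" "((\<lambda>s. Linf_norm (\<lambda>x. v s x - v T x)) \<longlongrightarrow> 0) (at T within {s. 0 \<le> s \<and> ereal s < T'})"
        using v T' time(1) unfolding mild_solution_def by auto
      obtain M where M: "Linf_norm (v T) = ennreal M" "0 \<le> M"
        using vT(1) unfolding in_Linf_def by (cases "Linf_norm (v T)") auto
      have "eventually (\<lambda>s. Linf_norm (\<lambda>x. v s x - v T x) < 1) (at T within {s. 0 \<le> s \<and> ereal s < T'})"
        using vT(2) by (rule order_tendstoD) simp
      then have "eventually (\<lambda>s. s \<in> {s. 0 \<le> s \<and> ereal s < T'} \<longrightarrow> Linf_norm (\<lambda>x. v s x - v T x) < 1) (at T)"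
        by (auto simp: eventually_at_filter elim: eventually_mono)
      then have "eventually (\<lambda>s. s \<in> {s. 0 \<le> s \<and> ereal s < T'} \<longrightarrow> Linf_norm (\<lambda>x. v s x - v T x) < 1) (at_left T)"
        by (rule filter_leD[OF at_le, rotated]) simp
      with time(3)[of "M + 1"] pos_ev have "eventually (\<lambda>t. False) (at_left T)"
      proof eventually_elim
        case (elim s)
        have "ereal s < T'" using elim T' by (meson ereal_less_eq(3) le_less_trans less_imp_le)
        then have L: "Linf_norm (\<lambda>x. v s x - v T x) \<le> ennreal 1" using elim by simp
        have "AE x in lborel. \<bar>v s x - v T x\<bar> \<le> 1" by (rule Linf_norm_leD[OF L]) simp
        moreover have "AE x in lborel. \<bar>v T x\<bar> \<le> M" by (rule Linf_norm_leD) (use M in auto)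
        moreover have "AE x in lborel. v s x = u s x" using eq[of s] elim by simp
        ultimately have "AE x in lborel. W s x \<le> ennreal (M + 1)"
        proof eventually_elim
          case (elim x)
          then show ?case using \<open>0 < s \<and> s < T\<close> by (simp add: W_u' ennreal_leI del: ennreal_plus)
        qed
        then show False using elim by blast
      qed
      then show False by (simp add: trivial_limit_at_left_real)
    qed
    with mild have "maximal_mild_solution \<sigma> h f u0 (ereal T) u"
      unfolding maximal_mild_solution_def by blast
    with blow show ?thesis unfolding blows_up_in_finite_time_def by blast
  qed
qed

end

section \<open>Decay of the heat semigroup and the dichotomy\<close>

lemma in_C0_gauss: "in_C0 (\<lambda>x::'a::euclidean_space. k * gauss 1 x)"
  unfolding in_C0_def
proof
  show "continuous_on UNIV (\<lambda>x::'a. k * gauss 1 x)" by (intro continuous_intros)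
  have "((\<lambda>x::'a. inverse (norm x)) \<longlongrightarrow> 0) at_infinity"
    by (rule tendsto_inverse_0_at_top[OF filterlim_norm_at_top])
  moreover have "eventually (\<lambda>x::'a. norm (gauss 1 x) \<le> inverse (norm x)) at_infinity"
    unfolding eventually_at_infinity
  proof (intro exI[of _ 1] allI impI)
    fix x :: 'a assume x: "1 \<le> norm x"
    have "norm x * 1 \<le> norm x * norm x" using x by (intro mult_left_mono) auto
    also have "\<dots> \<le> exp ((norm x)\<^sup>2)" using exp_ge_add_one_self[of "(norm x)\<^sup>2"] unfolding power2_eq_square by linarith
    finally have "inverse (exp ((norm x)\<^sup>2)) \<le> inverse (norm x)" using x by (intro le_imp_inverse_le) auto
    then show "norm (gauss 1 x) \<le> inverse (norm x)" by (simp add: gauss_def exp_minus)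
  qed
  ultimately have "((\<lambda>x::'a. gauss 1 x) \<longlongrightarrow> 0) at_infinity" by (rule Lim_null_comparison[rotated])
  then show "((\<lambda>x::'a. k * gauss 1 x) \<longlongrightarrow> 0) at_infinity" by (rule tendsto_mult_right_zero)
qed

text \<open>The norm is a continuous real function of time on a compact interval. The bound obtained
  is the constant M that \<open>mild_solution_le\<close> asks for.\<close>

lemma mild_solution_bounded:
  fixes y :: "real \<Rightarrow> 'a::euclidean_space \<Rightarrow> real"
  assumes y: "mild_solution \<sigma> h f u0 (ereal T) y" and T': "0 \<le> T'" "T' < T"
  shows "\<exists>M\<ge>0. \<forall>t. 0 \<le> t \<and> t \<le> T' \<longrightarrow> (AE x in lborel. y t x \<le> M)"
proof -
  let ?S = "{s. 0 \<le> s \<and> ereal s < ereal T}"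
  have Linf: "in_Linf (y t)" and lim: "((\<lambda>s. Linf_norm (\<lambda>x. y s x - y t x)) \<longlongrightarrow> 0) (at t within ?S)" if "0 \<le> t" "t \<le> T'" for t
    using y that T' unfolding mild_solution_def by auto
  have meas: "y t \<in> borel_measurable borel" and fin: "Linf_norm (y t) < \<infinity>" if "0 \<le> t" "t \<le> T'" for t
    using Linf[OF that] by (auto simp: in_Linf_def)
  define \<phi> where "\<phi> t = enn2real (Linf_norm (y t))" for t
  have \<phi>: "Linf_norm (y t) = ennreal (\<phi> t)" if "0 \<le> t" "t \<le> T'" for t
    using fin[OF that] by (simp add: \<phi>_def)
  have "continuous_on {0..T'} \<phi>"
    unfolding continuous_on_def
  proof
    fix t assume t: "t \<in> {0..T'}"
    let ?d = "\<lambda>s. Linf_norm (\<lambda>x. y s x - y t x)"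
    have sub: "{0..T'} \<subseteq> ?S" using T' by auto
    have "(?d \<longlongrightarrow> ennreal 0) (at t within {0..T'})"
      using tendsto_within_subset[OF lim sub] t by simp
    then have d: "((\<lambda>s. enn2real (?d s)) \<longlongrightarrow> 0) (at t within {0..T'})"
      by (rule tendsto_enn2real) simp
    have le: "norm (\<phi> s - \<phi> t) \<le> enn2real (?d s)" if s: "s \<in> {0..T'}" for s
    proof -
      note [measurable] = meas[of s] meas[of t]
      have ms: "y s \<in> borel_measurable borel" and mt: "y t \<in> borel_measurable borel" using meas s t by auto
      have "Linf_norm (\<lambda>x. y t x - y s x) = ?d s"
        unfolding Linf_norm_def by (simp add: abs_minus_commute)
      then have 1: "Linf_norm (y t) \<le> Linf_norm (y s) + ?d s" using Linf_norm_triangle[OF mt, of "y s"] by simp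
      have 2: "Linf_norm (y s) \<le> Linf_norm (y t) + ?d s" by (rule Linf_norm_triangle[OF ms])
      \<comment> \<open>Finiteness of the distance comes first, since \<open>enn2real\<close> would
        turn an infinite distance into 0.\<close>
      have "?d s \<le> Linf_norm (y s) + Linf_norm (\<lambda>x. (y s x - y t x) - y s x)"
        by (rule Linf_norm_triangle) (use ms mt in measurable)
      also have "Linf_norm (\<lambda>x. (y s x - y t x) - y s x) = Linf_norm (y t)" unfolding Linf_norm_def by simp
      finally have "?d s < \<infinity>" using fin[of s] fin[of t] s t by (auto elim!: le_less_trans)
      then obtain r where r: "?d s = ennreal r" "0 \<le> r" by (cases "?d s") auto
      have "0 \<le> \<phi> s" "0 \<le> \<phi> t" by (auto simp: \<phi>_def)
      then have "\<phi> t \<le> \<phi> s + r" "\<phi> s \<le> \<phi> t + r"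
        using 1 2 s t r by (auto simp: \<phi> ennreal_plus[symmetric] simp del: ennreal_plus)
      then show ?thesis using r by (simp add: abs_le_iff)
    qed
    have "((\<lambda>s. \<phi> s - \<phi> t) \<longlongrightarrow> 0) (at t within {0..T'})"
      by (rule Lim_null_comparison[OF _ d]) (auto simp: eventually_at_filter intro!: always_eventually le[simplified])
    then show "(\<phi> \<longlongrightarrow> \<phi> t) (at t within {0..T'})" by (simp add: LIM_zero_iff)
  qed
  then have "compact (\<phi> ` {0..T'})" by (rule compact_continuous_image) simp
  from compact_imp_bounded[OF this] obtain M where M: "\<forall>z\<in>\<phi> ` {0..T'}. norm z \<le> M"
    unfolding bounded_iff by (elim exE)
  show ?thesis
  proof (intro exI[of _ "max M 0"] conjI allI impI)
    fix t assume t: "0 \<le> t \<and> t \<le> T'"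
    have "norm (\<phi> t) \<le> M" using t by (intro bspec[OF M] imageI) simp
    then have "Linf_norm (y t) \<le> ennreal (max M 0)" using t by (auto simp: \<phi> intro!: ennreal_leI)
    from Linf_norm_leD[OF this] show "AE x in lborel. y t x \<le> max M 0" by (auto elim!: eventually_mono)
  qed simp
qed

context mixed_dichotomy
begin

lemma heat_Linf_le:
  fixes u0 :: "'a::euclidean_space \<Rightarrow> real"
  assumes [measurable]: "u0 \<in> borel_measurable borel" and nn: "\<And>x. 0 \<le> u0 x" and le: "\<And>x. u0 x \<le> U" and t: "0 \<le> t"
  shows "Linf_norm (heat_semigroup \<sigma> t u0) \<le> ennreal U"
proof -
  interpret convolution_semigroup "mixed_kernel \<sigma> :: real \<Rightarrow> 'a \<Rightarrow> real"
    by (rule convolution_semigroup_mixed_kernel)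
  have eq: "heat_semigroup \<sigma> t u0 = (\<lambda>x. enn2real (P t (\<lambda>y. ennreal (u0 y)) x))"
    using heat_semigroup_eq[of u0 t] nn t by (auto simp: fun_eq_iff)
  have U: "0 \<le> U" using nn[of 0] le[of 0] by linarith
  show ?thesis
  proof (rule Linf_norm_le)
    show "heat_semigroup \<sigma> t u0 \<in> borel_measurable borel" unfolding eq by measurable
    show "AE x in lborel. \<bar>heat_semigroup \<sigma> t u0 x\<bar> \<le> U"
    proof (rule AE_I2)
      fix x
      have "P t (\<lambda>y. ennreal (u0 y)) x \<le> ennreal U" by (intro P_le_const ennreal_leI le)
      then have "enn2real (P t (\<lambda>y. ennreal (u0 y)) x) \<le> enn2real (ennreal U)" by (intro enn2real_mono) auto
      then show "\<bar>heat_semigroup \<sigma> t u0 x\<bar> \<le> U" using U by (simp add: eq)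
    qed
  qed
qed

lemma P_decay:
  fixes u0 :: "'a::euclidean_space \<Rightarrow> real"
  assumes C: "\<And>t x. 0 < t \<Longrightarrow> mixed_kernel \<sigma> t (x::'a) \<le> C * t powr (- (real DIM('a) / (2 * \<sigma>)))" "0 < C"
    and u0: "integrable lborel u0" "\<And>x. 0 \<le> u0 x" and t: "0 < t"
  shows "convolution_semigroup.P (mixed_kernel \<sigma>) t (\<lambda>y. ennreal (u0 y)) x
     \<le> ennreal (C * t powr (- (real DIM('a) / (2 * \<sigma>))) * (LINT y|lborel. u0 y))"
proof -
  interpret convolution_semigroup "mixed_kernel \<sigma> :: real \<Rightarrow> 'a \<Rightarrow> real"
    by (rule convolution_semigroup_mixed_kernel)
  have [measurable]: "u0 \<in> borel_measurable borel" using u0(1) by auto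
  have "P t (\<lambda>y. ennreal (u0 y)) x \<le> (\<integral>\<^sup>+y. ennreal (C * t powr (- (real DIM('a) / (2 * \<sigma>)))) * ennreal (u0 y) \<partial>lborel)"
    using t unfolding P_def by (auto intro!: nn_integral_mono mult_right_mono ennreal_leI C(1))
  also have "\<dots> = ennreal (C * t powr (- (real DIM('a) / (2 * \<sigma>)))) * ennreal (LINT y|lborel. u0 y)"
    using u0 by (simp add: nn_integral_cmult nn_integral_eq_integral)
  also have "\<dots> = ennreal (C * t powr (- (real DIM('a) / (2 * \<sigma>))) * (LINT y|lborel. u0 y))"
    using C(2) u0(2) by (intro ennreal_mult[symmetric] mult_nonneg_nonneg Bochner_Integration.integral_nonneg) auto
  finally show ?thesis .
qed

text \<open>The data exceed some k > 0 on the unit ball, and the kernel is at least c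
  t^(-d/(2\<sigma>)) at differences of its points. The resulting bound holds on the whole ball, a
  set of positive measure, as the essential supremum demands.\<close>

lemma heat_Linf_lower:
  fixes u0 :: "'a::euclidean_space \<Rightarrow> real"
  assumes u0: "in_C0 u0" "\<And>x. 0 < u0 x"
  shows "\<exists>a>0. \<forall>t\<ge>1. a * t powr (- (real DIM('a) / (2 * \<sigma>))) \<le> enn2real (Linf_norm (heat_semigroup \<sigma> t u0))"
proof -
  let ?\<gamma> = "real DIM('a) / (2 * \<sigma>)"
  interpret convolution_semigroup "mixed_kernel \<sigma> :: real \<Rightarrow> 'a \<Rightarrow> real"
    by (rule convolution_semigroup_mixed_kernel)
  obtain U where U: "\<And>x. \<bar>u0 x\<bar> \<le> U" using in_C0_bounded[OF u0(1)] by blast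
  have m[measurable]: "u0 \<in> borel_measurable borel"
    using u0(1) by (intro borel_measurable_continuous_onI) (simp add: in_C0_def)
  have nn: "0 \<le> u0 x" for x using u0(2)[of x] by simp
  obtain c where c: "0 < c" "\<And>t x. 1 \<le> t \<Longrightarrow> norm (x::'a) \<le> 2 \<Longrightarrow> c * t powr (- ?\<gamma>) \<le> mixed_kernel \<sigma> t x"
    using mixed_kernel_lower[where 'a='a] by blast
  let ?B = "cball (0::'a) 1"
  have Bpos: "0 < emeasure lborel ?B" "emeasure lborel ?B < \<infinity>"
    by (auto simp: emeasure_cball)
  obtain k where k: "0 < k" "\<And>x. x \<in> ?B \<Longrightarrow> k \<le> u0 x"
  proof -
    have "continuous_on ?B u0" using u0(1) by (auto simp: in_C0_def intro: continuous_on_subset)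
    then obtain z where "z \<in> ?B" "\<And>x. x \<in> ?B \<Longrightarrow> u0 z \<le> u0 x"
      using continuous_attains_inf[of ?B u0] by auto
    then show ?thesis using that[of "u0 z"] u0(2) by blast
  qed
  define a where "a = c * k * measure lborel ?B"
  have "0 < measure lborel ?B" using Bpos by (simp add: measure_def enn2real_positive_iff)
  then have a: "0 < a" using c(1) k(1) by (simp add: a_def)
  have "a * t powr (- ?\<gamma>) \<le> enn2real (Linf_norm (heat_semigroup \<sigma> t u0))" if t: "1 \<le> t" for t
  proof -
    have t0: "0 < t" using t by simp
    let ?v = "a * t powr (- ?\<gamma>)"
    have v0: "0 < ?v" using a t by simp
    have ge: "?v \<le> heat_semigroup \<sigma> t u0 x" if x: "x \<in> ?B" for x
    proof -
      have "(\<integral>\<^sup>+y. ennreal (c * t powr (- ?\<gamma>) * k) * indicator ?B y \<partial>lborel) = ennreal (c * t powr (- ?\<gamma>) * k) * emeasure lborel ?B"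
        by (rule nn_integral_cmult_indicator) simp
      also have "emeasure lborel ?B = ennreal (measure lborel ?B)"
        by (rule emeasure_eq_ennreal_measure) (use Bpos in auto)
      also have "ennreal (c * t powr (- ?\<gamma>) * k) * ennreal (measure lborel ?B) = ennreal ?v"
        using c(1) k(1) by (subst ennreal_mult[symmetric]) (auto simp: a_def ac_simps)
      finally have "ennreal ?v = (\<integral>\<^sup>+y. ennreal (c * t powr (- ?\<gamma>) * k) * indicator ?B y \<partial>lborel)" ..
      also have "\<dots> \<le> P t (\<lambda>y. ennreal (u0 y)) x"
        using t0 unfolding P_def
      proof (simp, intro nn_integral_mono)
        fix y
        show "ennreal (c * t powr (- ?\<gamma>) * k) * indicator ?B y \<le> ennreal (mixed_kernel \<sigma> t (x - y)) * ennreal (u0 y)"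
        proof (cases "y \<in> ?B")
          case True
          have "norm (x - y) \<le> 2" using True x norm_triangle_ineq4[of x y] by simp
          then have "c * t powr (- ?\<gamma>) * k \<le> mixed_kernel \<sigma> t (x - y) * u0 y"
            using c(1) k(1) k(2)[OF True] t by (intro mult_mono c(2)) auto
          then show ?thesis using True nn[of y] by (simp add: ennreal_mult[symmetric] ennreal_leI)
        qed simp
      qed
      finally have "ennreal ?v \<le> P t (\<lambda>y. ennreal (u0 y)) x" .
      moreover have "P t (\<lambda>y. ennreal (u0 y)) x \<le> ennreal U"
        by (intro P_le_const ennreal_leI) (use U in \<open>auto simp: abs_le_iff\<close>)
      ultimately have "enn2real (ennreal ?v) \<le> enn2real (P t (\<lambda>y. ennreal (u0 y)) x)"
        by (intro enn2real_mono) (auto intro: le_less_trans)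
      then show ?thesis using v0 heat_semigroup_eq[OF m nn, of t x] t0 by simp
    qed
    have fin: "Linf_norm (heat_semigroup \<sigma> t u0) \<le> ennreal U"
      by (rule heat_Linf_le) (use nn U t0 in \<open>auto simp: abs_le_iff\<close>)
    then obtain N where N: "Linf_norm (heat_semigroup \<sigma> t u0) = ennreal N" "0 \<le> N"
      by (cases "Linf_norm (heat_semigroup \<sigma> t u0)") (auto simp: top_unique)
    have "?v \<le> N"
    proof (rule ccontr)
      assume "\<not> ?v \<le> N"
      have "AE x in lborel. \<bar>heat_semigroup \<sigma> t u0 x\<bar> \<le> N" using N by (intro Linf_norm_leD) auto
      then have "AE x in lborel. x \<notin> ?B"
      proof eventually_elim
        case (elim x)
        show ?case
        proof
          assume "x \<in> ?B"
          from ge[OF this] elim \<open>\<not> ?v \<le> N\<close> show False by linarith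
        qed
      qed
      then have "emeasure lborel {x. \<not> x \<notin> ?B} = 0"
        by (subst (asm) AE_iff_measurable[OF _ refl]) auto
      then have "emeasure lborel ?B = 0" by (simp only: not_not Collect_mem_eq)
      then show False using Bpos by simp
    qed
    then show ?thesis using N by simp
  qed
  with a show ?thesis by blast
qed

lemma borel_measurable_weighted:
  "(\<lambda>t. ennreal (h t * t powr \<gamma> * f (\<epsilon> * t powr (- \<gamma>))) * indicator {1..} t) \<in> borel_measurable borel" if "0 < \<epsilon>"
proof -
  have [measurable]: "(\<lambda>x. h (max 0 x)) \<in> borel_measurable borel"
    by (intro borel_measurable_continuous_onI continuous_on_compose2[OF h_cont]) (auto intro!: continuous_intros)
  have "(\<lambda>t. ennreal (h (max 0 t) * t powr \<gamma> * f (max 0 (\<epsilon> * t powr (- \<gamma>)))) * indicator {1..} t) \<in> borel_measurable borel"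
    by measurable
  moreover have "(\<lambda>t. ennreal (h (max 0 t) * t powr \<gamma> * f (max 0 (\<epsilon> * t powr (- \<gamma>)))) * indicator {1..} t)
    = (\<lambda>t. ennreal (h t * t powr \<gamma> * f (\<epsilon> * t powr (- \<gamma>))) * indicator {1..} t)"
    using that by (auto simp: fun_eq_iff indicator_def max_absorb2)
  ultimately show ?thesis by simp
qed

text \<open>The link between (i) and (ii): up to the factor \<epsilon> the integrand of (ii) is h
  times the quotient f(r) / r at r = \<epsilon> t^(-\<gamma>).\<close>

lemma weighted_eq_ratio:
  assumes "0 < \<epsilon>" "0 < t"
  shows "1 / \<epsilon> * (h t * t powr \<gamma> * f (\<epsilon> * t powr (- \<gamma>))) = h t * (f (\<epsilon> * t powr (- \<gamma>)) / (\<epsilon> * t powr (- \<gamma>)))"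
  using assms by (simp add: powr_minus field_simps)

text \<open>N is an abstract decay profile because the estimate serves twice: for the norm of the
  heat flow, and for the envelope \<open>m\<close> in \<open>no_blow_up\<close>. Monotonicity of
  f(r) / r transfers the bounds, and h is bounded on [0, 1] by compactness.\<close>

lemma ratio_integral_finite:
  assumes \<epsilon>: "0 < \<epsilon>" and fin: "(\<integral>\<^sup>+t. ennreal (h t * t powr \<gamma> * f (\<epsilon> * t powr (- \<gamma>))) * indicator {1..} t \<partial>lborel) < \<infinity>"
    and N: "\<And>t. 0 \<le> t \<Longrightarrow> 0 \<le> N t" "\<And>t. 0 \<le> t \<Longrightarrow> t \<le> 1 \<Longrightarrow> N t \<le> k" "\<And>t. 1 \<le> t \<Longrightarrow> N t \<le> \<epsilon> * t powr (- \<gamma>)"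
  shows "(\<integral>\<^sup>+t. ennreal (h t * (f (N t) / N t)) * indicator {0..} t \<partial>lborel) < \<infinity>"
proof -
  have "compact (h ` {0..1})"
    by (intro compact_continuous_image continuous_on_subset[OF h_cont]) auto
  from compact_imp_bounded[OF this] obtain B where B: "\<forall>z\<in>h ` {0..1}. norm z \<le> B"
    unfolding bounded_iff by (elim exE)
  have k: "0 \<le> k" using N(1)[of 0] N(2)[of 0] by simp
  have "(\<integral>\<^sup>+t. ennreal (h t * (f (N t) / N t)) * indicator {0..} t \<partial>lborel)
    \<le> (\<integral>\<^sup>+t. ennreal (B * (f k / k)) * indicator {0..1} t
        + ennreal (1 / \<epsilon>) * (ennreal (h t * t powr \<gamma> * f (\<epsilon> * t powr (- \<gamma>))) * indicator {1..} t) \<partial>lborel)"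
  proof (rule nn_integral_mono)
    fix t :: real
    consider "t < 0" | "0 \<le> t" "t < 1" | "1 \<le> t" by linarith
    then show "ennreal (h t * (f (N t) / N t)) * indicator {0..} t \<le> ennreal (B * (f k / k)) * indicator {0..1} t
        + ennreal (1 / \<epsilon>) * (ennreal (h t * t powr \<gamma> * f (\<epsilon> * t powr (- \<gamma>))) * indicator {1..} t)"
    proof cases
      case 2
      have "norm (h t) \<le> B" using 2 by (intro bspec[OF B] imageI) simp
      then have "h t * (f (N t) / N t) \<le> B * (f k / k)"
        using 2 k N(1,2)[of t] h_nn[of t] f_nonneg by (intro mult_mono f_ratio_mono0 divide_nonneg_nonneg) auto
      then show ?thesis using 2 by (simp add: ennreal_leI)
    next
      case 3
      have "h t * (f (N t) / N t) \<le> h t * (f (\<epsilon> * t powr (- \<gamma>)) / (\<epsilon> * t powr (- \<gamma>)))"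
        using 3 N(1,3)[of t] h_nn[of t] by (intro mult_left_mono f_ratio_mono0) auto
      also have "\<dots> = 1 / \<epsilon> * (h t * t powr \<gamma> * f (\<epsilon> * t powr (- \<gamma>)))"
        using weighted_eq_ratio[OF \<epsilon>, of t] 3 by simp
      finally have "ennreal (h t * (f (N t) / N t)) \<le> ennreal (1 / \<epsilon>) * ennreal (h t * t powr \<gamma> * f (\<epsilon> * t powr (- \<gamma>)))"
        using \<epsilon> 3 h_nn[of t] f_nonneg by (subst ennreal_mult[symmetric]) (auto intro!: ennreal_leI mult_nonneg_nonneg)
      then show ?thesis using 3 by (simp add: add_increasing)
    qed simp
  qed
  also have "\<dots> = (\<integral>\<^sup>+t. ennreal (B * (f k / k)) * indicator {0..1} t \<partial>(lborel::real measure))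
     + ennreal (1 / \<epsilon>) * (\<integral>\<^sup>+t. ennreal (h t * t powr \<gamma> * f (\<epsilon> * t powr (- \<gamma>))) * indicator {1..} t \<partial>lborel)"
    using borel_measurable_weighted[OF \<epsilon>, of \<gamma>] by (subst nn_integral_add) (auto simp: nn_integral_cmult)
  also have "\<dots> < \<infinity>"
    using fin by (simp add: nn_integral_cmult ennreal_mult_less_top)
  finally show ?thesis .
qed

text \<open>The norm is at least a t^(-d/(2\<sigma>)) for t \<ge> 1, so (ii) with \<epsilon> = a
  forces divergence.\<close>

lemma heat_integral_infinite:
  fixes u0 :: "'a::euclidean_space \<Rightarrow> real"
  assumes u0: "in_C0 u0" "\<And>x. 0 < u0 x"
    and div: "\<And>\<epsilon>. 0 < \<epsilon> \<Longrightarrow> (\<integral>\<^sup>+t. ennreal (h t * t powr (real DIM('a) / (2 * \<sigma>)) * f (\<epsilon> * t powr (- (real DIM('a) / (2 * \<sigma>))))) * indicator {1..} t \<partial>lborel) = \<infinity>"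
  shows "(\<integral>\<^sup>+t. ennreal (h t * (f (enn2real (Linf_norm (heat_semigroup \<sigma> t u0))) / enn2real (Linf_norm (heat_semigroup \<sigma> t u0)))) * indicator {0..} t \<partial>lborel) = \<infinity>"
proof -
  let ?\<gamma> = "real DIM('a) / (2 * \<sigma>)"
  let ?N = "\<lambda>t. enn2real (Linf_norm (heat_semigroup \<sigma> t u0))"
  obtain a where a: "0 < a" "\<And>t. 1 \<le> t \<Longrightarrow> a * t powr (- ?\<gamma>) \<le> ?N t"
    using heat_Linf_lower[OF u0] by blast
  have "\<infinity> = ennreal (1 / a) * (\<integral>\<^sup>+t. ennreal (h t * t powr ?\<gamma> * f (a * t powr (- ?\<gamma>))) * indicator {1..} t \<partial>lborel)"
    using a(1) div[OF a(1)] by (simp add: ennreal_mult_top)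
  also have "\<dots> = (\<integral>\<^sup>+t. ennreal (1 / a) * (ennreal (h t * t powr ?\<gamma> * f (a * t powr (- ?\<gamma>))) * indicator {1..} t) \<partial>lborel)"
    using borel_measurable_weighted[OF a(1), of ?\<gamma>] by (intro nn_integral_cmult[symmetric]) simp
  also have "\<dots> \<le> (\<integral>\<^sup>+t. ennreal (h t * (f (?N t) / ?N t)) * indicator {0..} t \<partial>lborel)"
  proof (rule nn_integral_mono)
    fix t :: real
    show "ennreal (1 / a) * (ennreal (h t * t powr ?\<gamma> * f (a * t powr (- ?\<gamma>))) * indicator {1..} t) \<le> ennreal (h t * (f (?N t) / ?N t)) * indicator {0..} t"
    proof (cases "1 \<le> t")
      case True
      have "ennreal (1 / a) * ennreal (h t * t powr ?\<gamma> * f (a * t powr (- ?\<gamma>))) = ennreal (1 / a * (h t * t powr ?\<gamma> * f (a * t powr (- ?\<gamma>))))"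
        using a(1) True h_nn[of t] f_nonneg by (intro ennreal_mult[symmetric]) (auto intro!: mult_nonneg_nonneg)
      also have "1 / a * (h t * t powr ?\<gamma> * f (a * t powr (- ?\<gamma>))) = h t * (f (a * t powr (- ?\<gamma>)) / (a * t powr (- ?\<gamma>)))"
        using True by (intro weighted_eq_ratio a(1)) simp
      also have "ennreal \<dots> \<le> ennreal (h t * (f (?N t) / ?N t))"
        using True a h_nn[of t] by (intro ennreal_leI mult_left_mono f_ratio_mono0) auto
      finally show ?thesis using True by simp
    qed simp
  qed
  finally show ?thesis by (simp add: top_unique)
qed

text \<open>The mass of the data times the decay constant C of the kernel must not exceed
  \<epsilon>, and their height must not exceed \<epsilon>'; both hold for a small multiple of a
  Gaussian.\<close>

lemma gauss_data:
  assumes \<epsilon>: "0 < \<epsilon>" "0 < \<epsilon>'"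
  obtains k where "0 < k" "k \<le> \<epsilon>'"
    "\<And>t x. 0 < t \<Longrightarrow> convolution_semigroup.P (mixed_kernel \<sigma>) t (\<lambda>y::'a::euclidean_space. ennreal (k * gauss 1 y)) x
      \<le> ennreal (\<epsilon> * t powr (- (real DIM('a) / (2 * \<sigma>))))"
proof -
  obtain C where C: "0 < C" "\<And>t x. 0 < t \<Longrightarrow> mixed_kernel \<sigma> t (x::'a) \<le> C * t powr (- (real DIM('a) / (2 * \<sigma>)))"
    using mixed_kernel_upper[where 'a='a] by blast
  define S where "S = (LINT x|lborel. gauss 1 (x::'a))"
  have S: "0 < S" unfolding S_def by (subst gauss_fourier(3)) auto
  define k where "k = min \<epsilon>' (\<epsilon> / (C * S))"
  have k: "0 < k" "k \<le> \<epsilon>'" "k \<le> \<epsilon> / (C * S)" using \<epsilon> C(1) S by (auto simp: k_def)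
  show ?thesis
  proof (rule that[OF k(1,2)])
    fix t :: real and x :: 'a assume t: "0 < t"
    have "convolution_semigroup.P (mixed_kernel \<sigma>) t (\<lambda>y::'a. ennreal (k * gauss 1 y)) x
      \<le> ennreal (C * t powr (- (real DIM('a) / (2 * \<sigma>))) * (LINT y|lborel. k * gauss 1 (y::'a)))"
      by (rule P_decay[OF C(2,1) _ _ t]) (use k(1) in \<open>auto intro!: integrable_mult_right gauss_fourier(1)\<close>)
    also have "C * t powr (- (real DIM('a) / (2 * \<sigma>))) * (LINT y|lborel. k * gauss 1 (y::'a)) = (k * (C * S)) * t powr (- (real DIM('a) / (2 * \<sigma>)))"
      by (simp add: S_def)
    also have "ennreal \<dots> \<le> ennreal (\<epsilon> * t powr (- (real DIM('a) / (2 * \<sigma>))))"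
      using k(3) C(1) S by (intro ennreal_leI mult_right_mono) (auto simp: pos_le_divide_eq)
    finally show "convolution_semigroup.P (mixed_kernel \<sigma>) t (\<lambda>y::'a. ennreal (k * gauss 1 y)) x
      \<le> ennreal (\<epsilon> * t powr (- (real DIM('a) / (2 * \<sigma>))))" .
  qed
qed

lemma heat_integral_finite:
  assumes \<epsilon>: "0 < \<epsilon>"
    and fin: "(\<integral>\<^sup>+t. ennreal (h t * t powr (real DIM('a::euclidean_space) / (2 * \<sigma>)) * f (\<epsilon> * t powr (- (real DIM('a) / (2 * \<sigma>))))) * indicator {1..} t \<partial>lborel) < \<infinity>"
  shows "\<exists>u0 :: 'a \<Rightarrow> real. in_C0 u0 \<and> integrable lborel u0 \<and> (\<forall>x. 0 < u0 x) \<and>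
    (\<integral>\<^sup>+t. ennreal (h t * (f (enn2real (Linf_norm (heat_semigroup \<sigma> t u0))) / enn2real (Linf_norm (heat_semigroup \<sigma> t u0)))) * indicator {0..} t \<partial>lborel) < \<infinity>"
proof -
  let ?\<gamma> = "real DIM('a) / (2 * \<sigma>)"
  interpret convolution_semigroup "mixed_kernel \<sigma> :: real \<Rightarrow> 'a \<Rightarrow> real"
    by (rule convolution_semigroup_mixed_kernel)
  obtain k where k: "0 < k" "\<And>t x. 0 < t \<Longrightarrow> P t (\<lambda>y. ennreal (k * gauss 1 y)) x \<le> ennreal (\<epsilon> * t powr (- ?\<gamma>))"
    using gauss_data[OF \<epsilon> \<epsilon>, where 'a='a] by metis
  let ?u0 = "\<lambda>x::'a. k * gauss 1 x"
  have u0nn: "0 \<le> ?u0 x" for x using k(1) by simp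
  have m: "?u0 \<in> borel_measurable borel" by measurable
  have eq: "heat_semigroup \<sigma> t ?u0 = (\<lambda>x. enn2real (P t (\<lambda>y. ennreal (?u0 y)) x))" if "0 \<le> t" for t
    using heat_semigroup_eq[OF m u0nn that] by (simp add: fun_eq_iff)
  have "(\<integral>\<^sup>+t. ennreal (h t * (f (enn2real (Linf_norm (heat_semigroup \<sigma> t ?u0))) / enn2real (Linf_norm (heat_semigroup \<sigma> t ?u0)))) * indicator {0..} t \<partial>lborel) < \<infinity>"
  proof (rule ratio_integral_finite[OF \<epsilon> fin])
    fix t :: real
    show "enn2real (Linf_norm (heat_semigroup \<sigma> t ?u0)) \<le> k" if "0 \<le> t" "t \<le> 1"
    proof -
      have "Linf_norm (heat_semigroup \<sigma> t ?u0) \<le> ennreal k"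
        by (rule heat_Linf_le[OF m u0nn _ that(1)]) (use k(1) gauss_le_1[of 1] in \<open>auto intro: mult_left_le\<close>)
      from enn2real_mono[OF this] k(1) show ?thesis by simp
    qed
    show "enn2real (Linf_norm (heat_semigroup \<sigma> t ?u0)) \<le> \<epsilon> * t powr (- ?\<gamma>)" if t: "1 \<le> t"
    proof -
      have t0: "0 < t" using t by simp
      have e0: "0 \<le> \<epsilon> * t powr (- ?\<gamma>)" using \<epsilon> by simp
      have "Linf_norm (heat_semigroup \<sigma> t ?u0) \<le> ennreal (\<epsilon> * t powr (- ?\<gamma>))"
      proof (rule Linf_norm_le)
        show "heat_semigroup \<sigma> t ?u0 \<in> borel_measurable borel" unfolding eq[OF less_imp_le[OF t0]] by measurable
        show "AE x in lborel. \<bar>heat_semigroup \<sigma> t ?u0 x\<bar> \<le> \<epsilon> * t powr (- ?\<gamma>)"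
        proof (rule AE_I2)
          fix x
          have "enn2real (P t (\<lambda>y. ennreal (?u0 y)) x) \<le> enn2real (ennreal (\<epsilon> * t powr (- ?\<gamma>)))"
            by (rule enn2real_mono[OF k(2)[OF t0]]) simp
          then show "\<bar>heat_semigroup \<sigma> t ?u0 x\<bar> \<le> \<epsilon> * t powr (- ?\<gamma>)" using e0 t0 by (simp add: eq)
        qed
      qed
      from enn2real_mono[OF this] e0 show ?thesis by simp
    qed
  qed simp
  then show ?thesis
    using k(1) by (intro exI[of _ ?u0]) (auto intro!: in_C0_gauss integrable_mult_right gauss_fourier(1))
qed

end

section \<open>Small data without blow-up\<close>

context mixed_dichotomy
begin

text \<open>The data are \<delta> times k \<open>gauss 1\<close>. The heat flow of k
  \<open>gauss 1\<close> is v, with an envelope m < 1, and the integral Q of h f(m) / m is finite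
  and fixed before \<delta> is chosen. The supersolution condition becomes f_M(2 \<delta>) Q /
  \<delta> \<le> 1, which holds for small \<delta> by the limit of f_M(u) / u.\<close>

lemma no_blow_up:
  assumes \<epsilon>: "0 < \<epsilon>"
    and fin: "(\<integral>\<^sup>+t. ennreal (h t * t powr (real DIM('a::euclidean_space) / (2 * \<sigma>)) * f (\<epsilon> * t powr (- (real DIM('a) / (2 * \<sigma>))))) * indicator {1..} t \<partial>lborel) < \<infinity>"
    and fM: "((\<lambda>v. majorant f v / v) \<longlongrightarrow> 0) (at_right 0)"
  shows "\<exists>u0 :: 'a \<Rightarrow> real. in_C0 u0 \<and> integrable lborel u0 \<and> (\<forall>x. 0 < u0 x) \<and> \<not> blows_up_in_finite_time \<sigma> h f u0"
proof -
  let ?\<gamma> = "real DIM('a) / (2 * \<sigma>)"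
  interpret convolution_semigroup "mixed_kernel \<sigma> :: real \<Rightarrow> 'a \<Rightarrow> real"
    by (rule convolution_semigroup_mixed_kernel)
  \<comment> \<open>Kept below 1 because values of the envelope serve as the argument \<alpha> in
    the majorant, which ranges over (0, 1).\<close>
  define \<epsilon>' where "\<epsilon>' = min \<epsilon> (1 / 2)"
  have \<epsilon>': "0 < \<epsilon>'" "\<epsilon>' \<le> \<epsilon>" "\<epsilon>' < 1" using \<epsilon> by (auto simp: \<epsilon>'_def)
  obtain k where k: "0 < k" "k \<le> \<epsilon>'" "\<And>t x. 0 < t \<Longrightarrow> P t (\<lambda>y. ennreal (k * gauss 1 y)) x \<le> ennreal (\<epsilon>' * t powr (- ?\<gamma>))"
    using gauss_data[OF \<epsilon>'(1) \<epsilon>'(1), where 'a='a] by metis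
  define v where "v s x = enn2real (P s (\<lambda>y. ennreal (k * gauss 1 y)) x)" for s and x :: 'a
  have P_le_k: "P s (\<lambda>y. ennreal (k * gauss 1 y)) x \<le> ennreal k" for s x
    by (intro P_le_const ennreal_leI) (use k(1) gauss_le_1[of 1] in \<open>auto intro: mult_left_le\<close>)
  have v_ennreal: "P s (\<lambda>y. ennreal (k * gauss 1 y)) x = ennreal (v s x)" for s x
    using le_less_trans[OF P_le_k[of s x]] by (simp add: v_def)
  have v_nonneg: "0 \<le> v s x" for s x by (simp add: v_def)
  \<comment> \<open>Constant on [0, 1], where the height of the data is the better bound, and
    decaying like the kernel afterwards.\<close>
  define m where "m s = \<epsilon>' * max 1 s powr (- ?\<gamma>)" for s
  have m: "0 < m s" "m s < 1" "m s \<le> \<epsilon>'" for s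
  proof -
    show "0 < m s" using \<epsilon>'(1) by (simp add: m_def)
    have "max 1 s powr (- ?\<gamma>) \<le> max 1 s powr 0" using \<sigma> by (intro powr_mono) auto
    also have "max 1 s powr 0 = 1" by (auto simp: max_def)
    finally have "\<epsilon>' * max 1 s powr (- ?\<gamma>) \<le> \<epsilon>' * 1" using \<epsilon>'(1) by (intro mult_left_mono) auto
    then show "m s \<le> \<epsilon>'" by (simp add: m_def)
    with \<epsilon>'(3) show "m s < 1" by simp
  qed
  have v_le: "v s x \<le> m s" if s: "0 \<le> s" for s x
  proof (cases "1 \<le> s")
    case True
    then have "ennreal (v s x) \<le> ennreal (m s)" using k(3)[of s x] by (simp add: v_ennreal m_def max_absorb2)
    then show ?thesis using m(1)[of s] by (simp add: ennreal_le_iff2)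
  next
    case False
    have "ennreal (v s x) \<le> ennreal \<epsilon>'"
      using P_le_k[of s x] k(2) unfolding v_ennreal by (auto intro: order_trans ennreal_leI)
    then show ?thesis using False \<epsilon>'(1) by (simp add: ennreal_le_iff2 m_def max_absorb1)
  qed
  have m_meas: "m \<in> borel_measurable borel" unfolding m_def by measurable
  define q where "q s = h s * (f (m s) / m s)" for s
  have q_nonneg: "0 \<le> q s" if "0 \<le> s" for s
    unfolding q_def using that m(1)[of s] by (intro mult_nonneg_nonneg divide_nonneg_nonneg h_nn f_nonneg) auto
  have q_meas: "(\<lambda>s. indicator {0..} s * q s) \<in> borel_measurable borel"
  proof -
    note [measurable] = m_meas
    have [measurable]: "(\<lambda>x. h (max 0 x)) \<in> borel_measurable borel"
      by (intro borel_measurable_continuous_onI continuous_on_compose2[OF h_cont]) (auto intro!: continuous_intros)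
    have "(\<lambda>s. indicator {0..} s * (h (max 0 s) * (f (max 0 (m s)) / m s))) \<in> borel_measurable borel" by measurable
    moreover have "(\<lambda>s. indicator {0..} s * (h (max 0 s) * (f (max 0 (m s)) / m s))) = (\<lambda>s. indicator {0..} s * q s)"
      using m(1) by (auto simp: fun_eq_iff q_def indicator_def max_absorb2 less_imp_le)
    ultimately show ?thesis by (simp only:)
  qed
  have "(\<integral>\<^sup>+t. ennreal (h t * (f (m t) / m t)) * indicator {0..} t \<partial>lborel) < \<infinity>"
  proof (rule ratio_integral_finite[OF \<epsilon> fin])
    show "0 \<le> m t" for t using m(1)[of t] by simp
    show "m t \<le> \<epsilon>'" for t by (rule m(3))
    show "m t \<le> \<epsilon> * t powr (- ?\<gamma>)" if "1 \<le> t" for t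
      using that \<epsilon>' by (simp add: m_def max_absorb2 mult_right_mono)
  qed
  moreover have "ennreal (h t * (f (m t) / m t)) * indicator {0..} t = ennreal (norm (indicator {0..} t * q t))" for t
    unfolding q_def[symmetric] using q_nonneg[of t] by (cases "0 \<le> t") simp_all
  ultimately have q_int: "integrable lborel (\<lambda>s. indicator {0..} s * q s)"
    using q_meas by (intro integrableI_bounded) auto
  define Q where "Q = (LINT s|lborel. indicator {0..} s * q s)"
  have Q: "0 \<le> Q" unfolding Q_def by (intro Bochner_Integration.integral_nonneg) (auto simp: indicator_def q_nonneg)
  \<comment> \<open>With r = 2 \<delta> the target f_M(r) Q / \<delta> \<le> 1 asks for f_M(r) / r
    \<le> 1 / (2 Q); writing Q + 1 covers Q = 0 as well.\<close>
  have "eventually (\<lambda>r. majorant f r / r < 1 / (2 * (Q + 1))) (at_right 0)"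
    using fM by (rule order_tendstoD) (use Q in simp)
  then obtain b where b: "0 < b" "\<And>r. 0 < r \<Longrightarrow> r < b \<Longrightarrow> majorant f r / r < 1 / (2 * (Q + 1))"
    unfolding eventually_at_right_field by blast
  \<comment> \<open>The cap 1 / 2 keeps r in the range where the majorant is a genuine
    supremum.\<close>
  define r where "r = min (b / 2) (1 / 2)"
  have r: "0 < r" "r < b" "r < 1" using b(1) by (auto simp: r_def)
  define \<delta> where "\<delta> = r / 2"
  have \<delta>: "0 < \<delta>" "2 * \<delta> = r" using r by (auto simp: \<delta>_def)
  define R where "R = majorant f r"
  have R_ge: "f (\<alpha> * r) \<le> R * f \<alpha>" if "0 < \<alpha>" "\<alpha> < 1" for \<alpha>
    unfolding R_def using that r by (intro majorant_mult_ge) auto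
  have R: "0 \<le> R"
  proof -
    have "0 \<le> R * f (1 / 2)" using R_ge[of "1 / 2"] f_nonneg[of "1 / 2 * r"] r by auto
    then show ?thesis using f_pos[of "1 / 2"] by (simp add: zero_le_mult_iff)
  qed
  have RQ: "R / \<delta> * Q \<le> 1"
  proof -
    have "R / r < 1 / (2 * (Q + 1))" using b(2)[OF r(1,2)] by (simp add: R_def)
    then have "R / \<delta> \<le> 1 / (Q + 1)" using r Q by (simp add: \<delta>_def field_simps)
    then have "R / \<delta> * Q \<le> 1 / (Q + 1) * Q" using Q by (intro mult_right_mono) auto
    also have "\<dots> \<le> 1" using Q by simp
    finally show ?thesis .
  qed
  define u0 where "u0 x = \<delta> * k * gauss 1 x" for x :: 'a
  have u0_C0: "in_C0 u0" unfolding u0_def by (rule in_C0_gauss)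
  have u0_pos: "0 < u0 x" for x using \<delta>(1) k(1) by (simp add: u0_def)
  have u0_int: "integrable lborel u0"
    unfolding u0_def by (intro integrable_mult_right gauss_fourier(1)) simp
  have u0_le: "u0 x \<le> \<delta> * k" for x
    using \<delta>(1) k(1) gauss_le_1[of 1 x] by (simp add: u0_def mult_left_le)
  interpret semilinear "mixed_kernel \<sigma> :: real \<Rightarrow> 'a \<Rightarrow> real" f h u0 "\<delta> * k"
    by (rule semilinear_mixed[OF u0_C0 less_imp_le[OF u0_pos] u0_le])
  have V: "enn2real (P s (\<lambda>z. ennreal (u0 z)) x) = \<delta> * v s x" for s x
  proof -
    have "P s (\<lambda>z. ennreal (u0 z)) x = P s (\<lambda>z. ennreal \<delta> * ennreal (k * gauss 1 z)) x"
      using \<delta>(1) k(1) by (simp add: u0_def ennreal_mult[symmetric] mult.assoc)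
    also have "\<dots> = ennreal \<delta> * ennreal (v s x)" by (subst P_cmult) (auto simp: v_ennreal)
    finally show ?thesis using \<delta>(1) v_nonneg[of s x] by (simp add: ennreal_mult[symmetric])
  qed
  \<comment> \<open>The chain behind this choice is f(r v) / (r v) \<le> f(r m) / (r m) \<le> f_M(r)
    f(m) / (r m), by monotonicity of the quotient and then the majorant at \<alpha> = m.\<close>
  define a where "a s = R / \<delta> * (f (m s) / m s)" for s
  have a_nonneg: "0 \<le> a s" for s
    unfolding a_def using R \<delta>(1) m(1)[of s] f_nonneg[of "m s"] by (intro mult_nonneg_nonneg) auto
  have f_le_a: "f (2 * (\<delta> * v s x)) \<le> a s * (\<delta> * v s x)" if s: "0 \<le> s" for s x
  proof (cases "v s x = 0")
    case False
    then have v: "0 < v s x" using v_nonneg[of s x] by simp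
    have "f (r * v s x) / (r * v s x) \<le> f (r * m s) / (r * m s)"
      using v r(1) v_le[OF s, of x] by (intro f_ratio_mono) auto
    also have "\<dots> \<le> R * f (m s) / (r * m s)"
      using R_ge[OF m(1,2), of s] r(1) m(1)[of s] by (intro divide_right_mono) (auto simp: mult.commute)
    finally have "f (r * v s x) \<le> R * f (m s) / (r * m s) * (r * v s x)"
      using v r(1) by (simp add: pos_divide_le_eq)
    also have "\<dots> = a s * (\<delta> * v s x)" using r(1) \<delta> m(1)[of s] by (simp add: a_def field_simps)
    finally show ?thesis using \<delta>(2) by (simp add: mult.assoc[symmetric])
  qed simp
  have ha: "indicator {0..t} s * (h s * a s) = R / \<delta> * (indicator {0..t} s * (indicator {0..} s * q s))" for s t
    by (auto simp: a_def q_def indicator_def)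
  have ha_int: "integrable lborel (\<lambda>s. indicator {0..t} s * (indicator {0..} s * q s))" for t
    by (rule Bochner_Integration.integrable_bound[OF q_int]) (use q_meas in \<open>auto simp: indicator_def\<close>)
  have a_int: "set_integrable lborel {0..t} (\<lambda>s. h s * a s)" for t
    unfolding set_integrable_def real_scaleR_def ha by (rule integrable_mult_right) (rule ha_int)
  have a_le: "(LINT s:{0..t}|lborel. h s * a s) \<le> 1" for t
  proof -
    have "(LINT s|lborel. indicator {0..t} s * (indicator {0..} s * q s)) \<le> Q"
      unfolding Q_def by (rule integral_mono[OF ha_int q_int]) (auto simp: indicator_def q_nonneg)
    then have "R / \<delta> * (LINT s|lborel. indicator {0..t} s * (indicator {0..} s * q s)) \<le> R / \<delta> * Q"
      using R \<delta>(1) by (intro mult_left_mono) auto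
    then show ?thesis
      unfolding set_lebesgue_integral_def real_scaleR_def ha using RQ by simp
  qed
  have "\<not> blows_up_in_finite_time \<sigma> h f u0"
  proof
    assume "blows_up_in_finite_time \<sigma> h f u0"
    then obtain T y where mild: "mild_solution \<sigma> h f u0 (ereal T) y"
      and blow: "((\<lambda>t. Linf_norm (y t)) \<longlongrightarrow> \<infinity>) (at_left T)"
      unfolding blows_up_in_finite_time_def maximal_mild_solution_def by blast
    have T: "0 < T" using mild by (simp add: mild_solution_def)
    \<comment> \<open>The comparison is applied up to each t < T, and its bound does not depend on
      t, which excludes divergence at T.\<close>
    have bound: "Linf_norm (y t) \<le> ennreal (2 * (\<delta> * k))" if t: "0 \<le> t" "t < T" for t
    proof -
      have y: "y s \<in> borel_measurable borel" "0 \<le> y s x"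
        "AE x in lborel. y s x = heat_semigroup \<sigma> s u0 x + (LINT z:{0..s}|lborel. heat_semigroup \<sigma> (s - z) (\<lambda>x. h z * f (y z x)) x)"
        if "0 \<le> s" "s \<le> t" for s x
        using mild that t unfolding mild_solution_def in_Linf_def by auto
      obtain M where M: "0 \<le> M" "\<And>s. 0 \<le> s \<Longrightarrow> s \<le> t \<Longrightarrow> AE x in lborel. y s x \<le> M"
        using mild_solution_bounded[OF mild t] by blast
      have src: "(\<lambda>x. h z * f (y z x)) \<in> borel_measurable borel" "0 \<le> h z * f (y z x)" if z: "0 \<le> z" "z \<le> t" for z x
      proof -
        note [measurable] = y(1)[OF z]
        have "(\<lambda>x. h z * f (max 0 (y z x))) \<in> borel_measurable borel" by measurable
        then show "(\<lambda>x. h z * f (y z x)) \<in> borel_measurable borel" using y(2)[OF z] by (simp add: max_absorb2)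
        show "0 \<le> h z * f (y z x)" using y(2)[OF z] z by (intro mult_nonneg_nonneg h_nn f_nonneg) auto
      qed
      have "AE x in lborel. y t x \<le> 2 * enn2real (P t (\<lambda>z. ennreal (u0 z)) x)"
      proof (rule mild_solution_le[where T = t and M = M and a = a])
        show "AE x in lborel. y s x = enn2real (P s (\<lambda>z. ennreal (u0 z)) x) + (LINT z:{0..s}|lborel. enn2real (P (s - z) (\<lambda>x. ennreal (h z * f (y z x))) x))"
          if s: "0 \<le> s" "s \<le> t" for s
        proof -
          have eq1: "heat_semigroup \<sigma> s u0 x = enn2real (P s (\<lambda>z. ennreal (u0 z)) x)" for x
            by (rule heat_semigroup_eq) (use s u0_pos in \<open>auto simp: less_imp_le\<close>)
          have eq2: "(LINT z:{0..s}|lborel. heat_semigroup \<sigma> (s - z) (\<lambda>x. h z * f (y z x)) x)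
            = (LINT z:{0..s}|lborel. enn2real (P (s - z) (\<lambda>x. ennreal (h z * f (y z x))) x))" for x
            by (rule set_lebesgue_integral_cong) (use s in \<open>auto intro!: heat_semigroup_eq src\<close>)
          show ?thesis using y(3)[OF s] by (simp add: eq1 eq2)
        qed
        show "f (2 * enn2real (P s (\<lambda>z. ennreal (u0 z)) x)) \<le> a s * enn2real (P s (\<lambda>z. ennreal (u0 z)) x)" if "0 \<le> s" for s x
          unfolding V by (rule f_le_a[OF that])
      qed (use y M a_nonneg a_int a_le t in auto)
      then have "AE x in lborel. \<bar>y t x\<bar> \<le> 2 * (\<delta> * k)"
      proof eventually_elim
        case (elim x)
        have "ennreal (v t x) \<le> ennreal k" using P_le_k[of t x] by (simp add: v_ennreal)
        then have "v t x \<le> k" using k(1) by simp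
        then have "2 * (\<delta> * v t x) \<le> 2 * (\<delta> * k)" using \<delta>(1) by simp
        then show ?case using elim y(2)[OF t(1) order_refl, of x] by (simp add: V)
      qed
      then show ?thesis by (intro Linf_norm_le y(1)) (use t in auto)
    qed
    have "eventually (\<lambda>t. ennreal (2 * (\<delta> * k)) < Linf_norm (y t)) (at_left T)"
      using blow by (rule order_tendstoD) simp
    moreover have "eventually (\<lambda>t. 0 < t \<and> t < T) (at_left T)"
      using T by (intro eventually_at_leftI[of 0]) auto
    ultimately have "eventually (\<lambda>t. False) (at_left T)"
      by eventually_elim (use bound in \<open>auto simp: not_less[symmetric]\<close>)
    then show False by (simp add: trivial_limit_at_left_real)
  qed
  then show ?thesis using u0_C0 u0_int u0_pos by blast
qed

end

section \<open>The equivalence of the three statements\<close>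

theorem theorem1p2:
  fixes \<sigma> :: real and h f :: "real \<Rightarrow> real"
  assumes "0 < \<sigma>" and "\<sigma> < 1"
    and "continuous_on {0..} h" and "\<forall>t\<ge>0. 0 \<le> h t"
    and "continuous_on {0..} f" and "\<forall>u\<ge>0. 0 \<le> f u"
    and "convex_on {0..} f" and "f 0 = 0" and "\<forall>u>0. 0 < f u"
    and "(\<integral>\<^sup>+u\<in>{1..}. ennreal (1 / minorant f u) \<partial>lborel) < \<infinity>"
    and "((\<lambda>u. majorant f u / u) \<longlongrightarrow> 0) (at_right 0)"
  defines "stmt_i \<equiv>
      \<forall>u0 :: 'a::euclidean_space \<Rightarrow> real.
        in_C0 u0 \<and> integrable lborel u0 \<and> (\<forall>x. 0 < u0 x) \<longrightarrow>
        (\<integral>\<^sup>+t\<in>{0..}. ennreal (h t * (f (enn2real (Linf_norm (heat_semigroup \<sigma> t u0)))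
                                / enn2real (Linf_norm (heat_semigroup \<sigma> t u0)))) \<partial>lborel) = \<infinity>"
    and "stmt_ii \<equiv>
      \<forall>\<epsilon>>0.
        (\<integral>\<^sup>+t\<in>{1..}. ennreal (h t * t powr (real DIM('a) / (2 * \<sigma>))
                          * f (\<epsilon> * t powr (- (real DIM('a) / (2 * \<sigma>))))) \<partial>lborel) = \<infinity>"
    and "stmt_iii \<equiv>
      \<forall>u0 :: 'a \<Rightarrow> real.
        in_C0 u0 \<and> integrable lborel u0 \<and> (\<forall>x. 0 < u0 x) \<longrightarrow>
        blows_up_in_finite_time \<sigma> h f u0"
  shows "(stmt_i \<longleftrightarrow> stmt_ii) \<and> (stmt_ii \<longleftrightarrow> stmt_iii)"
proof -
  interpret mixed_dichotomy \<sigma> f h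
    by standard (use assms(1-9) in auto)
  have ii_fin: "\<exists>\<epsilon>>0. (\<integral>\<^sup>+t. ennreal (h t * t powr (real DIM('a) / (2 * \<sigma>)) * f (\<epsilon> * t powr (- (real DIM('a) / (2 * \<sigma>))))) * indicator {1..} t \<partial>lborel) < \<infinity>"
    if "\<not> stmt_ii"
    using that unfolding stmt_ii_def by (auto simp: less_top[symmetric])
  have "stmt_ii" if i: "stmt_i"
  proof (rule ccontr)
    assume "\<not> stmt_ii"
    then obtain \<epsilon> where "0 < \<epsilon>" "(\<integral>\<^sup>+t. ennreal (h t * t powr (real DIM('a) / (2 * \<sigma>)) * f (\<epsilon> * t powr (- (real DIM('a) / (2 * \<sigma>))))) * indicator {1..} t \<partial>lborel) < \<infinity>"
      using ii_fin by blast
    from heat_integral_finite[OF this] show False using i unfolding stmt_i_def by fastforce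
  qed
  moreover have "stmt_i" if ii: "stmt_ii"
    unfolding stmt_i_def using ii unfolding stmt_ii_def by (blast intro: heat_integral_infinite)
  moreover have "stmt_iii" if ii: "stmt_ii"
    unfolding stmt_iii_def using ii assms(10) unfolding stmt_ii_def by (blast intro: blow_up)
  moreover have "stmt_ii" if iii: "stmt_iii"
  proof (rule ccontr)
    assume "\<not> stmt_ii"
    then obtain \<epsilon> where "0 < \<epsilon>" "(\<integral>\<^sup>+t. ennreal (h t * t powr (real DIM('a) / (2 * \<sigma>)) * f (\<epsilon> * t powr (- (real DIM('a) / (2 * \<sigma>))))) * indicator {1..} t \<partial>lborel) < \<infinity>"
      using ii_fin by blast
    from no_blow_up[OF this assms(11)] show False using iii unfolding stmt_iii_def by blast
  qed
  ultimately show ?thesis by blast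
qed

end
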